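(* Let $P_1,\dots,P_k$ be finite simple graphs with density functionals $\tau_1,\dots,\tau_k$, let $(t_1,\dots,t_k)$ be a point in the space of achievable parameter values, and suppose that there is a unique reduced graphon $g_0$ that maximizes $S(g)$ subject to the constraint $(\tau_1(g),\dots,\tau_k(g))=(t_1,\dots,t_k)$. For $\delta>0$ and a positive integer $n$, let $\mathcal G_{\delta,n}$ be the set of labeled graphs on $n$ vertices whose densities of $P_i$ lie in $(t_i-\delta,t_i+\delta)$ for each $i$. Then, for any $\epsilon>0$, there exist positive constants $\delta$, $N$ and $K$ such that, for all $n>N$, the fraction of graphs in $\mathcal G_{\delta,n}$ that are within $\epsilon$ of $g_0$ in the cut metric exceeds $1-e^{-Kn^2}$.
   Context: A graphon is a symmetric measurable function $g:[0,1]^2\to[0,1]$. A reduced graphon is an equivalence class of graphons at cut distance zero from each other (graphons up to measure-preserving rearrangements of $[0,1]$); the cut metric is the standard cut distance $\delta_\square$ on reduced graphons. If a simple graph $P$ has $m$ vertices and $\ell$ edges, the $k$-th edge connecting vertices $s_k$ and $f_k$, the density of $P$ in a graphon $g$ is $\tau(g)=\int_{[0,1]^m}\prod_{k=1}^{\ell}g(x_{s_k},x_{f_k})\,d^mx$; $\tau_i$ denotes the density functional of $P_i$. The checkerboard graphon $g^G$ of a simple graph $G$ on vertices $\{1,\dots,n\}$ equals $1$ on $(\frac{i-1}{n},\frac in)\times(\frac{j-1}{n},\frac jn)$ if $\{i,j\}$ is an edge and $0$ otherwise; densities in $G$ and the cut distance from $G$ to a graphon are those of $g^G$. A tuple $(t_1,\dots,t_k)$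 is achievable if some graphon $g$ has $(\tau_1(g),\dots,\tau_k(g))=(t_1,\dots,t_k)$. The Shannon entropy is $S(g)=\int_0^1\int_0^1 H(g(x,y))\,dx\,dy$ with $H(u)=-\frac12\left(u\ln u+(1-u)\ln(1-u)\right)$ (and $0\ln0=0$). *)

theory Defs
  imports "HOL-Analysis.Analysis"
begin

text \<open>Graphons are Borel functions; values outside the unit square play no role below.
  A Lebesgue measurable graphon agrees almost everywhere with a Borel one, so the reduced
  graphons are the same.\<close>

abbreviation unit_interval :: "real measure" where
  "unit_interval \<equiv> restrict_space lborel {0..1}"

abbreviation unit_square :: "(real \<times> real) measure" where
  "unit_square \<equiv> unit_interval \<Otimes>\<^sub>M unit_interval"

definition graphon :: "(real \<times> real \<Rightarrow> real) \<Rightarrow> bool" where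
  "graphon g \<longleftrightarrow> g \<in> borel_measurable unit_square \<and>
     (\<forall>x\<in>{0..1}. \<forall>y\<in>{0..1}. g (x, y) = g (y, x) \<and> g (x, y) \<in> {0..1})"

definition cut_norm :: "(real \<times> real \<Rightarrow> real) \<Rightarrow> real" where
  "cut_norm w = (SUP (S, T) \<in> sets unit_interval \<times> sets unit_interval.
     \<bar>LINT z:S \<times> T|unit_square. w z\<bar>)"

definition measure_preserving :: "(real \<Rightarrow> real) \<Rightarrow> bool" where
  "measure_preserving \<phi> \<longleftrightarrow> \<phi> \<in> unit_interval \<rightarrow>\<^sub>M unit_interval \<and>
     distr unit_interval unit_interval \<phi> = unit_interval"

definition rearrangements :: "(real \<Rightarrow> real) set" where
  "rearrangements = {\<phi>. measure_preserving \<phi> \<and> (\<exists>\<psi>. measure_preserving \<psi> \<and>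
     (\<forall>x\<in>{0..1}. \<psi> (\<phi> x) = x \<and> \<phi> (\<psi> x) = x))}"

definition cut_distance :: "(real \<times> real \<Rightarrow> real) \<Rightarrow> (real \<times> real \<Rightarrow> real) \<Rightarrow> real" where
  "cut_distance f g =
     (INF \<phi>\<in>rearrangements. cut_norm (\<lambda>(x, y). f (x, y) - g (\<phi> x, \<phi> y)))"

definition cut_equiv :: "((real \<times> real \<Rightarrow> real) \<times> (real \<times> real \<Rightarrow> real)) set" where
  "cut_equiv = {(f, g). graphon f \<and> graphon g \<and> cut_distance f g = 0}"

definition reduced_graphons :: "(real \<times> real \<Rightarrow> real) set set" where
  "reduced_graphons = Collect graphon // cut_equiv"

text \<open>A pair \<open>(m, E)\<close> is the graph on the vertices \<open>1, \<dots>, m\<close> whose edges are the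
  two-element sets in \<open>E\<close>.\<close>

type_synonym sgraph = "nat \<times> nat set set"

definition simple_graph :: "sgraph \<Rightarrow> bool" where
  "simple_graph P \<longleftrightarrow> snd P \<subseteq> {e. e \<subseteq> {1..fst P} \<and> card e = 2}"

definition labeled_graphs :: "nat \<Rightarrow> sgraph set" where
  "labeled_graphs n = {G. simple_graph G \<and> fst G = n}"

text \<open>Ordering the two endpoints of an edge makes each edge contribute exactly one factor;
  the choice of order is immaterial for symmetric \<open>g\<close>.\<close>

definition subgraph_density :: "sgraph \<Rightarrow> (real \<times> real \<Rightarrow> real) \<Rightarrow> real" where
  "subgraph_density P g = (\<integral>x. (\<Prod>(u, v) | u < v \<and> {u, v} \<in> snd P. g (x u, x v))
     \<partial>(\<Pi>\<^sub>M i\<in>{1..fst P}. unit_interval))"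

definition checkerboard :: "sgraph \<Rightarrow> real \<times> real \<Rightarrow> real" where
  "checkerboard G = (\<lambda>(x, y). if \<exists>i j. {i, j} \<in> snd G \<and>
       x \<in> {(real i - 1) / real (fst G) <..< real i / real (fst G)} \<and>
       y \<in> {(real j - 1) / real (fst G) <..< real j / real (fst G)}
     then 1 else 0)"

text \<open>Since \<open>ln 0 = 0\<close>, the convention \<open>0 ln 0 = 0\<close> holds.\<close>

definition binary_entropy :: "real \<Rightarrow> real" where
  "binary_entropy u = - (1 / 2) * (u * ln u + (1 - u) * ln (1 - u))"

definition graphon_entropy :: "(real \<times> real \<Rightarrow> real) \<Rightarrow> real" where
  "graphon_entropy g = (\<integral>x. (\<integral>y. binary_entropy (g (x, y)) \<partial>unit_interval) \<partial>unit_interval)"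

definition achievable :: "nat \<Rightarrow> (nat \<Rightarrow> sgraph) \<Rightarrow> (nat \<Rightarrow> real) \<Rightarrow> bool" where
  "achievable k P t \<longleftrightarrow> (\<exists>g. graphon g \<and> (\<forall>i\<in>{1..k}. subgraph_density (P i) g = t i))"

text \<open>Densities, entropy and distance to a fixed graphon are constant on each class of
  \<^const>\<open>cut_equiv\<close>; a reduced graphon is assigned that common value.\<close>

definition reduced_density :: "sgraph \<Rightarrow> (real \<times> real \<Rightarrow> real) set \<Rightarrow> real" where
  "reduced_density P g = the_elem (subgraph_density P ` g)"

definition reduced_entropy :: "(real \<times> real \<Rightarrow> real) set \<Rightarrow> real" where
  "reduced_entropy g = the_elem (graphon_entropy ` g)"

definition graph_cut_distance :: "sgraph \<Rightarrow> (real \<times> real \<Rightarrow> real) set \<Rightarrow> real" where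
  "graph_cut_distance G g = the_elem (cut_distance (checkerboard G) ` g)"

definition entropy_maximizer ::
  "nat \<Rightarrow> (nat \<Rightarrow> sgraph) \<Rightarrow> (nat \<Rightarrow> real) \<Rightarrow> (real \<times> real \<Rightarrow> real) set \<Rightarrow> bool" where
  "entropy_maximizer k P t = is_arg_max reduced_entropy
     (\<lambda>g. g \<in> reduced_graphons \<and> (\<forall>i\<in>{1..k}. reduced_density (P i) g = t i))"

definition constrained_graphs ::
  "nat \<Rightarrow> (nat \<Rightarrow> sgraph) \<Rightarrow> (nat \<Rightarrow> real) \<Rightarrow> real \<Rightarrow> nat \<Rightarrow> sgraph set" where
  "constrained_graphs k P t \<delta> n = {G \<in> labeled_graphs n.
     \<forall>i\<in>{1..k}. subgraph_density (P i) (checkerboard G) \<in> {t i - \<delta> <..< t i + \<delta>}}"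

end

theory Submission
  imports Defs "HOL-Probability.Probability" "HOL-Complex_Analysis.Great_Picard" "HOL-Real_Asymp.Real_Asymp"
begin

text \<open>
  The fraction is estimated by counting. Roughly, that is, up to a factor \<open>exp (o (n\<^sup>2))\<close>, the number of labeled graphs on \<open>n\<close>
  vertices that are close to a graphon \<open>h\<close> is \<open>exp (n\<^sup>2 S(h))\<close>; the factor \<open>1/2\<close> in the entropy accounts for the
  \<open>n\<^sup>2 / 2\<close> pairs of vertices. The graphs that satisfy the constraints approximately include those near the
  maximizer \<open>g\<close>, so there are at least \<open>exp (n\<^sup>2 (S(g) - o(1)))\<close> of them. Those that are in addition far from \<open>g\<close>
  look like graphons whose entropy falls short of \<open>S(g)\<close> by a fixed amount \<open>\<eta>\<close>, so there are at most
  \<open>exp (n\<^sup>2 (S(g) - \<eta> + o(1)))\<close>. The quotient is exponentially small in \<open>n\<^sup>2\<close>.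

  The amount \<open>\<eta>\<close> comes from a compactness argument (\<open>entropy_gap\<close>). If it did not exist, there would be finite
  weighted graphs at cut distance at least \<open>\<epsilon>\<close> from \<open>g\<close> whose densities tend to the prescribed values and
  whose entropies are eventually almost \<open>S(g)\<close> or more. By \<open>finite_graphons_precompact\<close> some subsequence
  converges in the cut distance. Densities are Lipschitz for the cut distance (\<open>density_diff_le_cut_distance\<close>), and the entropy
  is upper semicontinuous (\<open>graphon_entropy_upper_semicontinuous\<close>, by concavity). So the limit is a second
  maximizer, which contradicts uniqueness. The same two facts show that densities and entropy are well defined on
  reduced graphons.

  Only finite weighted graphs occur in that sequence, for the following reason. By weak regularity every graph \<open>G\<close> is
  close in cut norm to its averages \<open>W\<close> over the blocks of a partition with a bounded number of classes. The
  number of graphs with a given partition and given averages \<open>W\<close> is at most \<open>exp (n\<^sup>2 S(W))\<close>, because each of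
  them has probability at least \<open>exp (- n\<^sup>2 S(W))\<close> when the edges are drawn independently with probabilities \<open>W\<close>
  (\<open>card_graphs_with_block_averages\<close>). There are only \<open>exp (O(n))\<close> partitions and polynomially many values
  of \<open>W\<close>, so it suffices to bound \<open>S(W)\<close> by the gap. Working with finite graphs also makes compactness elementary:
  sorting the vertices turns nested partitions into nested partitions into intervals, which converge as soon as their
  end points do.

  The lower bound also uses random graphs (\<open>many_graphs_near_graphon\<close>). Approximate \<open>g\<close> in \<open>L\<^sup>1\<close> by a step function \<open>w\<close> on the
  \<open>n\<close>-grid with values away from \<open>0\<close> and \<open>1\<close>, and draw the edges with probabilities \<open>w\<close>. An exponential
  moment bound beats the \<open>4\<^sup>n\<close> rectangles that enter the cut norm, so the random graph is near \<open>w\<close> with probability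
  almost one, while its likelihood rarely exceeds \<open>exp (- n\<^sup>2 (S(w) - o(1)))\<close>. Hence the nearby graphs must be numerous.
\<close>

section \<open>Bounded kernels and the cut norm\<close>

lemma space_unit_interval [simp]: "space unit_interval = {0..1}"
  by (simp add: space_restrict_space)

lemma space_unit_square [simp]: "space unit_square = {0..1} \<times> {0..1}"
  by (simp add: space_pair_measure)

lemma prob_space_unit_interval: "prob_space unit_interval"
  by (rule prob_spaceI) (simp add: emeasure_restrict_space)

interpretation unit_interval: prob_space unit_interval
  by (rule prob_space_unit_interval)

interpretation unit_square: pair_prob_space unit_interval unit_interval ..

text \<open>The cut norm is a supremum in a conditionally complete lattice, so it behaves as expected only on
  functions with bounded integrals over rectangles. This class is closed under all operations used below.\<close>

definition bounded_kernel :: "(real \<times> real \<Rightarrow> real) \<Rightarrow> bool" where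
  "bounded_kernel w \<longleftrightarrow> w \<in> borel_measurable unit_square \<and>
     (\<exists>B. \<forall>x\<in>{0..1}. \<forall>y\<in>{0..1}. \<bar>w (x, y)\<bar> \<le> B)"

lemma kernelI:
  assumes "w \<in> borel_measurable unit_square"
    and "\<And>x y. x \<in> {0..1} \<Longrightarrow> y \<in> {0..1} \<Longrightarrow> \<bar>w (x, y)\<bar> \<le> B"
  shows "bounded_kernel w"
  using assms unfolding bounded_kernel_def by blast

lemma kernel_measurable [measurable_dest]: "bounded_kernel w \<Longrightarrow> w \<in> borel_measurable unit_square"
  by (simp add: bounded_kernel_def)

lemma kernel_integrable: "bounded_kernel w \<Longrightarrow> integrable unit_square w"
proof -
  assume "bounded_kernel w"
  then obtain B where "w \<in> borel_measurable unit_square"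
    and B: "\<forall>x\<in>{0..1}. \<forall>y\<in>{0..1}. \<bar>w (x, y)\<bar> \<le> B"
    by (auto simp: bounded_kernel_def)
  then show ?thesis
    by (intro unit_square.integrable_const_bound[where B = B]) (auto intro!: AE_I2)
qed

lemma kernel_graphon: "graphon g \<Longrightarrow> bounded_kernel g"
  by (rule kernelI[where B = 1]) (auto simp: graphon_def)

lemma kernel_add: "bounded_kernel f \<Longrightarrow> bounded_kernel g \<Longrightarrow> bounded_kernel (\<lambda>z. f z + g z)"
proof -
  assume "bounded_kernel f" "bounded_kernel g"
  then obtain A B where *: "\<forall>x\<in>{0..1}. \<forall>y\<in>{0..1}. \<bar>f (x, y)\<bar> \<le> A" "\<forall>x\<in>{0..1}. \<forall>y\<in>{0..1}. \<bar>g (x, y)\<bar> \<le> B"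
    and [measurable]: "f \<in> borel_measurable unit_square" "g \<in> borel_measurable unit_square"
    by (auto simp: bounded_kernel_def)
  have "\<bar>f (x, y) + g (x, y)\<bar> \<le> A + B" if "x \<in> {0..1}" "y \<in> {0..1}" for x y
    using * that abs_triangle_ineq[of "f (x, y)" "g (x, y)"] by fastforce
  then show ?thesis by (intro kernelI) auto
qed

lemma kernel_mult: "bounded_kernel f \<Longrightarrow> bounded_kernel g \<Longrightarrow> bounded_kernel (\<lambda>z. f z * g z)"
proof -
  assume "bounded_kernel f" "bounded_kernel g"
  then obtain A B where *: "\<forall>x\<in>{0..1}. \<forall>y\<in>{0..1}. \<bar>f (x, y)\<bar> \<le> A" "\<forall>x\<in>{0..1}. \<forall>y\<in>{0..1}. \<bar>g (x, y)\<bar> \<le> B"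
    and [measurable]: "f \<in> borel_measurable unit_square" "g \<in> borel_measurable unit_square"
    by (auto simp: bounded_kernel_def)
  have "\<bar>f (x, y) * g (x, y)\<bar> \<le> A * B" if "x \<in> {0..1}" "y \<in> {0..1}" for x y
    unfolding abs_mult using * that order_trans[OF abs_ge_zero, of "f (x, y)" A] by (intro mult_mono) auto
  then show ?thesis by (intro kernelI) auto
qed

lemma kernel_const [simp]: "bounded_kernel (\<lambda>z. c)"
  by (rule kernelI[where B = "\<bar>c\<bar>"]) auto

lemma kernel_uminus: "bounded_kernel f \<Longrightarrow> bounded_kernel (\<lambda>z. - f z)"
  using kernel_mult[of "\<lambda>z. - 1" f] by simp

lemma kernel_diff: "bounded_kernel f \<Longrightarrow> bounded_kernel g \<Longrightarrow> bounded_kernel (\<lambda>z. f z - g z)"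
  using kernel_add[of f "\<lambda>z. - g z"] kernel_uminus[of g] by simp

lemma kernel_abs: "bounded_kernel f \<Longrightarrow> bounded_kernel (\<lambda>z. \<bar>f z\<bar>)"
  unfolding bounded_kernel_def by auto

lemma kernel_fst:
  assumes "a \<in> borel_measurable unit_interval" "\<And>x. x \<in> {0..1} \<Longrightarrow> \<bar>a x\<bar> \<le> B"
  shows "bounded_kernel (\<lambda>z. a (fst z))"
  using assms by (intro kernelI[where B = B]) auto

lemma kernel_snd:
  assumes "a \<in> borel_measurable unit_interval" "\<And>x. x \<in> {0..1} \<Longrightarrow> \<bar>a x\<bar> \<le> B"
  shows "bounded_kernel (\<lambda>z. a (snd z))"
  using assms by (intro kernelI[where B = B]) auto

lemma cut_integral_le_L1:
  assumes "bounded_kernel w" "S \<in> sets unit_interval" "T \<in> sets unit_interval"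
  shows "\<bar>LINT z:S \<times> T|unit_square. w z\<bar> \<le> (\<integral>z. \<bar>w z\<bar> \<partial>unit_square)"
proof -
  have ST: "S \<times> T \<in> sets unit_square" using assms by auto
  note i = kernel_integrable[OF assms(1)]
  have "\<bar>LINT z:S \<times> T|unit_square. w z\<bar> \<le> (\<integral>z. \<bar>indicator (S \<times> T) z *\<^sub>R w z\<bar> \<partial>unit_square)"
    unfolding set_lebesgue_integral_def by (rule integral_abs_bound)
  also have "\<dots> \<le> (\<integral>z. \<bar>w z\<bar> \<partial>unit_square)"
    using i ST by (intro integral_mono integrable_abs integrable_mult_indicator)
      (auto simp: abs_mult indicator_def)
  finally show ?thesis .
qed

lemma cut_integrals_bdd_above:
  assumes "bounded_kernel w"
  shows "bdd_above ((\<lambda>(S, T). \<bar>LINT z:S \<times> T|unit_square. w z\<bar>) ` (sets unit_interval \<times> sets unit_interval))"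
  using cut_integral_le_L1[OF assms] by (intro bdd_aboveI2) auto

lemma cut_integral_le_cut_norm:
  assumes "bounded_kernel w" "S \<in> sets unit_interval" "T \<in> sets unit_interval"
  shows "\<bar>LINT z:S \<times> T|unit_square. w z\<bar> \<le> cut_norm w"
  unfolding cut_norm_def
  using cSUP_upper[OF _ cut_integrals_bdd_above[OF assms(1)], of "(S, T)"] assms by auto

lemma cut_norm_least:
  assumes "\<And>S T. S \<in> sets unit_interval \<Longrightarrow> T \<in> sets unit_interval \<Longrightarrow>
      \<bar>LINT z:S \<times> T|unit_square. w z\<bar> \<le> B"
  shows "cut_norm w \<le> B"
  unfolding cut_norm_def using assms by (intro cSUP_least) auto

lemma cut_norm_le_L1: "bounded_kernel w \<Longrightarrow> cut_norm w \<le> (\<integral>z. \<bar>w z\<bar> \<partial>unit_square)"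
  by (intro cut_norm_least cut_integral_le_L1)

lemma cut_norm_nonneg: "bounded_kernel w \<Longrightarrow> 0 \<le> cut_norm w"
  using cut_integral_le_cut_norm[of w "{}" "{}"] by auto

lemma cut_norm_add:
  assumes "bounded_kernel f" "bounded_kernel g"
  shows "cut_norm (\<lambda>z. f z + g z) \<le> cut_norm f + cut_norm g"
proof (rule cut_norm_least)
  fix S T assume ST: "S \<in> sets unit_interval" "T \<in> sets unit_interval"
  then have "S \<times> T \<in> sets unit_square" by auto
  then have "(LINT z:S \<times> T|unit_square. f z + g z) =
      (LINT z:S \<times> T|unit_square. f z) + (LINT z:S \<times> T|unit_square. g z)"
    using kernel_integrable[OF assms(1)] kernel_integrable[OF assms(2)]
    by (intro set_integral_add; unfold set_integrable_def; intro integrable_mult_indicator)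
  with cut_integral_le_cut_norm[OF assms(1) ST] cut_integral_le_cut_norm[OF assms(2) ST]
  show "\<bar>LINT z:S \<times> T|unit_square. f z + g z\<bar> \<le> cut_norm f + cut_norm g" by linarith
qed

lemma cut_norm_uminus: "cut_norm (\<lambda>z. - f z) = cut_norm f"
  unfolding cut_norm_def set_lebesgue_integral_def by simp

lemma cut_norm_minus_commute: "cut_norm (\<lambda>z. f z - g z) = cut_norm (\<lambda>z. g z - f z)"
  using cut_norm_uminus[of "\<lambda>z. f z - g z"] by simp

lemma cut_norm_cong_AE:
  assumes [measurable]: "f \<in> borel_measurable unit_square" "g \<in> borel_measurable unit_square"
    and ae: "AE z in unit_square. f z = g z"
  shows "cut_norm f = cut_norm g"
proof -
  have "(LINT z:S \<times> T|unit_square. f z) = (LINT z:S \<times> T|unit_square. g z)"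
    if [measurable]: "S \<in> sets unit_interval" "T \<in> sets unit_interval" for S T
    unfolding set_lebesgue_integral_def using ae
    by (intro integral_cong_AE) (auto elim: eventually_mono)
  then show ?thesis unfolding cut_norm_def by (intro SUP_cong) auto
qed

lemma cut_norm_cong:
  assumes "bounded_kernel f" "\<And>x y. x \<in> {0..1} \<Longrightarrow> y \<in> {0..1} \<Longrightarrow> f (x, y) = g (x, y)"
  shows "cut_norm f = cut_norm g"
proof (rule cut_norm_cong_AE)
  show f: "f \<in> borel_measurable unit_square" using assms(1) by measurable
  show "g \<in> borel_measurable unit_square"
    using f by (rule measurable_cong[THEN iffD1, rotated]) (auto simp: assms(2))
qed (auto simp: assms(2) intro!: AE_I2)

lemma cut_norm_triangle:
  assumes "bounded_kernel f" "bounded_kernel g" "bounded_kernel h"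
  shows "cut_norm (\<lambda>z. f z - h z) \<le> cut_norm (\<lambda>z. f z - g z) + cut_norm (\<lambda>z. g z - h z)"
  using cut_norm_add[OF kernel_diff[OF assms(1,2)] kernel_diff[OF assms(2,3)]] by simp

text \<open>The functional is affine in each of the test functions, so replacing \<open>a\<close> by the indicator
  of the set where the inner integral is nonnegative can only increase it, and likewise for \<open>b\<close>.\<close>

lemma test_integral_le_cut_norm:
  assumes w: "bounded_kernel w"
    and a [measurable]: "a \<in> borel_measurable unit_interval" and a01: "\<And>x. x \<in> {0..1} \<Longrightarrow> a x \<in> {0..1}"
    and b [measurable]: "b \<in> borel_measurable unit_interval" and b01: "\<And>x. x \<in> {0..1} \<Longrightarrow> b x \<in> {0..1}"
  shows "(\<integral>z. a (fst z) * b (snd z) * w z \<partial>unit_square) \<le> cut_norm w"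
proof -
  have wm [measurable]: "w \<in> borel_measurable unit_square" using w by measurable
  define F where "F = (\<lambda>x. \<integral>y. b y * w (x, y) \<partial>unit_interval)"
  have F [measurable]: "F \<in> borel_measurable unit_interval" unfolding F_def by measurable
  define S where "S = {x \<in> space unit_interval. 0 \<le> F x}"
  have S [measurable]: "S \<in> sets unit_interval" unfolding S_def by measurable
  have ka: "bounded_kernel (\<lambda>z. a (fst z) * b (snd z) * w z)"
    using a01 b01 by (intro kernel_mult kernel_fst[where B = 1] kernel_snd[where B = 1] w) auto
  have kS: "bounded_kernel (\<lambda>z. indicator S (fst z) * b (snd z) * w z)"
    using b01 by (intro kernel_mult kernel_fst[where B = 1] kernel_snd[where B = 1] w) (auto simp: indicator_def)
  have "(\<integral>z. a (fst z) * b (snd z) * w z \<partial>unit_square) = (\<integral>x. a x * F x \<partial>unit_interval)"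
    unfolding F_def by (subst unit_square.integral_fst'[OF kernel_integrable[OF ka], symmetric])
      (simp add: mult.assoc)
  also have "\<dots> \<le> (\<integral>x. indicator S x * F x \<partial>unit_interval)"
  proof (rule integral_mono)
    show "integrable unit_interval (\<lambda>x. a x * F x)"
      using unit_square.integrable_fst'[OF kernel_integrable[OF ka]] unfolding F_def by (simp add: mult.assoc)
    show "integrable unit_interval (\<lambda>x. indicator S x * F x)"
      using unit_square.integrable_fst'[OF kernel_integrable[OF kS]] unfolding F_def by (simp add: mult.assoc)
    fix x assume x: "x \<in> space unit_interval"
    show "a x * F x \<le> indicator S x * F x"
      using a01[of x] x by (cases "0 \<le> F x") (auto simp: S_def mult_left_le_one_le mult_nonneg_nonpos)
  qed
  also have "\<dots> = (\<integral>z. indicator S (fst z) * b (snd z) * w z \<partial>unit_square)"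
    unfolding F_def by (subst unit_square.integral_fst'[OF kernel_integrable[OF kS], symmetric])
      (simp add: mult.assoc)
  finally have step1: "(\<integral>z. a (fst z) * b (snd z) * w z \<partial>unit_square)
      \<le> (\<integral>z. indicator S (fst z) * b (snd z) * w z \<partial>unit_square)" .
  define G where "G = (\<lambda>y. \<integral>x. indicator S x * w (x, y) \<partial>unit_interval)"
  have G [measurable]: "G \<in> borel_measurable unit_interval" unfolding G_def by measurable
  define T where "T = {y \<in> space unit_interval. 0 \<le> G y}"
  have T [measurable]: "T \<in> sets unit_interval" unfolding T_def by measurable
  have kT: "bounded_kernel (\<lambda>z. indicator S (fst z) * indicator T (snd z) * w z)"
    by (intro kernel_mult kernel_fst[where B = 1] kernel_snd[where B = 1] w) (auto simp: indicator_def)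
  have snd_int: "(\<integral>z. indicator S (fst z) * c (snd z) * w z \<partial>unit_square) = (\<integral>y. c y * G y \<partial>unit_interval)"
    and snd_able: "integrable unit_interval (\<lambda>y. c y * G y)"
    if k: "bounded_kernel (\<lambda>z. indicator S (fst z) * c (snd z) * w z)" for c :: "real \<Rightarrow> real"
  proof -
    have i: "integrable unit_square (\<lambda>(x, y). indicator S x * c y * w (x, y))"
      using kernel_integrable[OF k] by (simp add: case_prod_beta')
    have eq: "(\<integral>x. indicator S x * c y * w (x, y) \<partial>unit_interval) = c y * G y" for y
      unfolding G_def by (subst integral_mult_right_zero[symmetric]) (simp add: mult_ac)
    show "(\<integral>z. indicator S (fst z) * c (snd z) * w z \<partial>unit_square) = (\<integral>y. c y * G y \<partial>unit_interval)"
      using unit_square.integral_snd[OF i] by (simp add: eq case_prod_beta')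
    show "integrable unit_interval (\<lambda>y. c y * G y)"
      using unit_square.integrable_snd[OF i] by (simp add: eq)
  qed
  have "(\<integral>z. indicator S (fst z) * b (snd z) * w z \<partial>unit_square) = (\<integral>y. b y * G y \<partial>unit_interval)"
    by (rule snd_int[OF kS])
  also have "\<dots> \<le> (\<integral>y. indicator T y * G y \<partial>unit_interval)"
  proof (rule integral_mono[OF snd_able[OF kS] snd_able[OF kT]])
    fix y assume y: "y \<in> space unit_interval"
    show "b y * G y \<le> indicator T y * G y"
      using b01[of y] y by (cases "0 \<le> G y") (auto simp: T_def mult_left_le_one_le mult_nonneg_nonpos)
  qed
  also have "\<dots> = (\<integral>z. indicator S (fst z) * indicator T (snd z) * w z \<partial>unit_square)"
    by (rule snd_int[OF kT, symmetric])
  also have "\<dots> = (LINT z:S \<times> T|unit_square. w z)"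
    unfolding set_lebesgue_integral_def by (intro Bochner_Integration.integral_cong) (auto simp: indicator_def)
  also have "\<dots> \<le> cut_norm w" using cut_integral_le_cut_norm[OF w S T] by simp
  finally show ?thesis using step1 by simp
qed

lemma abs_test_integral_le_cut_norm:
  assumes w: "bounded_kernel w"
    and a: "a \<in> borel_measurable unit_interval" and a01: "\<And>x. x \<in> {0..1} \<Longrightarrow> a x \<in> {0..1}"
    and b: "b \<in> borel_measurable unit_interval" and b01: "\<And>x. x \<in> {0..1} \<Longrightarrow> b x \<in> {0..1}"
  shows "\<bar>\<integral>z. a (fst z) * b (snd z) * w z \<partial>unit_square\<bar> \<le> cut_norm w"
  using test_integral_le_cut_norm[OF w a a01 b b01]
    test_integral_le_cut_norm[OF kernel_uminus[OF w] a a01 b b01]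
  by (simp add: cut_norm_uminus[of w])

section \<open>Rearrangements and the cut distance\<close>

definition pull :: "(real \<Rightarrow> real) \<Rightarrow> (real \<times> real \<Rightarrow> real) \<Rightarrow> real \<times> real \<Rightarrow> real" where
  "pull \<phi> w = (\<lambda>(x, y). w (\<phi> x, \<phi> y))"

lemma measure_preservingD:
  assumes "measure_preserving \<phi>"
  shows "\<phi> \<in> unit_interval \<rightarrow>\<^sub>M unit_interval" "distr unit_interval unit_interval \<phi> = unit_interval"
    "x \<in> {0..1} \<Longrightarrow> \<phi> x \<in> {0..1}"
  using assms measurable_space[of \<phi> unit_interval unit_interval x] by (auto simp: measure_preserving_def)

lemma measure_preserving_comp:
  assumes "measure_preserving \<phi>" "measure_preserving \<psi>"
  shows "measure_preserving (\<psi> \<circ> \<phi>)"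
proof -
  note m = measure_preservingD[OF assms(1)] measure_preservingD[OF assms(2)]
  have "distr unit_interval unit_interval (\<psi> \<circ> \<phi>)
      = distr (distr unit_interval unit_interval \<phi>) unit_interval \<psi>"
    by (rule distr_distr[symmetric]) (use m in auto)
  also have "\<dots> = unit_interval" using m by simp
  finally show ?thesis unfolding measure_preserving_def using m(1,4) by (auto intro: measurable_comp)
qed

lemma rearrangements_id: "id \<in> rearrangements"
  unfolding rearrangements_def measure_preserving_def by (auto simp: id_def distr_id2 intro!: exI[of _ "\<lambda>x. x"])

lemma rearrangements_comp:
  assumes "\<phi> \<in> rearrangements" "\<psi> \<in> rearrangements"
  shows "\<psi> \<circ> \<phi> \<in> rearrangements"
proof -
  from assms obtain \<phi>' \<psi>' where *: "measure_preserving \<phi>" "measure_preserving \<psi>"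
    "measure_preserving \<phi>'" "measure_preserving \<psi>'"
    "\<forall>x\<in>{0..1}. \<phi>' (\<phi> x) = x \<and> \<phi> (\<phi>' x) = x" "\<forall>x\<in>{0..1}. \<psi>' (\<psi> x) = x \<and> \<psi> (\<psi>' x) = x"
    unfolding rearrangements_def by blast
  have "measure_preserving (\<phi>' \<circ> \<psi>')" "measure_preserving (\<psi> \<circ> \<phi>)"
    using * by (auto intro: measure_preserving_comp)
  moreover have "\<forall>x\<in>{0..1}. (\<phi>' \<circ> \<psi>') ((\<psi> \<circ> \<phi>) x) = x \<and> (\<psi> \<circ> \<phi>) ((\<phi>' \<circ> \<psi>') x) = x"
    using * measure_preservingD(3)[OF *(1)] measure_preservingD(3)[OF *(4)] by auto
  ultimately show ?thesis unfolding rearrangements_def by blast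
qed

lemma rearrangementsE:
  assumes "\<phi> \<in> rearrangements"
  obtains \<psi> where "measure_preserving \<phi>" "\<psi> \<in> rearrangements" "measure_preserving \<psi>"
    "\<And>x. x \<in> {0..1} \<Longrightarrow> \<psi> (\<phi> x) = x" "\<And>x. x \<in> {0..1} \<Longrightarrow> \<phi> (\<psi> x) = x"
  using assms unfolding rearrangements_def by blast

lemma measurable_pair_map:
  assumes "measure_preserving \<phi>"
  shows "(\<lambda>(x, y). (\<phi> x, \<phi> y)) \<in> unit_square \<rightarrow>\<^sub>M unit_square"
proof -
  note [measurable] = measure_preservingD(1)[OF assms]
  show ?thesis by measurable
qed

lemma distr_pair_map:
  assumes "measure_preserving \<phi>"
  shows "distr unit_square unit_square (\<lambda>(x, y). (\<phi> x, \<phi> y)) = unit_square"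
proof -
  note m = measure_preservingD[OF assms]
  have "sigma_finite_measure (distr unit_interval unit_interval \<phi>)"
    unfolding m(2) by (rule unit_interval.sigma_finite_measure_axioms)
  from pair_measure_distr[OF m(1) m(1) this] show ?thesis unfolding m(2) by simp
qed

lemma integral_pull:
  assumes "measure_preserving \<phi>" "w \<in> borel_measurable unit_square"
  shows "(\<integral>z. pull \<phi> w z \<partial>unit_square) = (\<integral>z. w z \<partial>unit_square)"
proof -
  have "(\<integral>z. w z \<partial>distr unit_square unit_square (\<lambda>(x, y). (\<phi> x, \<phi> y))) =
     (\<integral>z. w ((\<lambda>(x, y). (\<phi> x, \<phi> y)) z) \<partial>unit_square)"
    by (rule integral_distr[OF measurable_pair_map[OF assms(1)] assms(2)])
  then show ?thesis unfolding distr_pair_map[OF assms(1)] pull_def by (simp add: case_prod_beta')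
qed

lemma kernel_pull:
  assumes "measure_preserving \<phi>" "bounded_kernel w"
  shows "bounded_kernel (pull \<phi> w)"
proof -
  obtain B where B: "\<forall>x\<in>{0..1}. \<forall>y\<in>{0..1}. \<bar>w (x, y)\<bar> \<le> B" using assms by (auto simp: bounded_kernel_def)
  have "w \<in> borel_measurable unit_square" using assms by measurable
  from measurable_comp[OF measurable_pair_map[OF assms(1)] this]
  have "pull \<phi> w \<in> borel_measurable unit_square" by (simp add: pull_def comp_def case_prod_beta')
  then show ?thesis using B measure_preservingD(3)[OF assms(1)]
    by (intro kernelI[where B = B]) (auto simp: pull_def)
qed

lemma graphon_pull: "measure_preserving \<phi> \<Longrightarrow> graphon g \<Longrightarrow> graphon (pull \<phi> g)"
  using kernel_pull[OF _ kernel_graphon, of \<phi> g] measure_preservingD(3)[of \<phi>]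
  by (auto simp: graphon_def bounded_kernel_def pull_def)

text \<open>A rectangle is pulled back to a rectangle along the inverse rearrangement.\<close>

lemma cut_norm_pull_le:
  assumes \<phi>: "\<phi> \<in> rearrangements" and w: "bounded_kernel w"
  shows "cut_norm (pull \<phi> w) \<le> cut_norm w"
proof (rule cut_norm_least)
  fix S T assume ST: "S \<in> sets unit_interval" "T \<in> sets unit_interval"
  from \<phi> obtain \<psi> where mp: "measure_preserving \<phi>" "measure_preserving \<psi>"
    and inv: "\<And>x. x \<in> {0..1} \<Longrightarrow> \<psi> (\<phi> x) = x"
    using rearrangementsE by metis
  define pre where "pre = (\<lambda>S. \<psi> -` S \<inter> {0..1})"
  have pre: "pre S \<in> sets unit_interval" "pre T \<in> sets unit_interval"
    using ST measurable_sets[OF measure_preservingD(1)[OF mp(2)]] by (auto simp: pre_def)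
  have mem: "\<phi> x \<in> pre A \<longleftrightarrow> x \<in> A" if "x \<in> {0..1}" for x A
    using measure_preservingD(3)[OF mp(1)] that inv by (auto simp: pre_def)
  have [measurable]: "w \<in> borel_measurable unit_square" using w by measurable
  have "(LINT z:S \<times> T|unit_square. pull \<phi> w z) =
      (\<integral>z. pull \<phi> (\<lambda>z. indicator (pre S \<times> pre T) z *\<^sub>R w z) z \<partial>unit_square)"
    unfolding set_lebesgue_integral_def
    by (intro Bochner_Integration.integral_cong) (auto simp: pull_def mem indicator_def)
  also have "\<dots> = (LINT z:pre S \<times> pre T|unit_square. w z)"
    unfolding set_lebesgue_integral_def using pre mp(1) by (intro integral_pull) auto
  finally show "\<bar>LINT z:S \<times> T|unit_square. pull \<phi> w z\<bar> \<le> cut_norm w"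
    using cut_integral_le_cut_norm[OF w pre] by simp
qed

lemma cut_norm_pull:
  assumes \<phi>: "\<phi> \<in> rearrangements" and w: "bounded_kernel w"
  shows "cut_norm (pull \<phi> w) = cut_norm w"
proof (rule antisym[OF cut_norm_pull_le[OF assms]])
  from \<phi> obtain \<psi> where mp: "measure_preserving \<phi>" "\<psi> \<in> rearrangements"
    and inv: "\<And>x. x \<in> {0..1} \<Longrightarrow> \<phi> (\<psi> x) = x"
    using rearrangementsE by metis
  have "cut_norm w = cut_norm (pull \<psi> (pull \<phi> w))"
    using w inv by (intro cut_norm_cong) (auto simp: pull_def)
  also have "\<dots> \<le> cut_norm (pull \<phi> w)" by (rule cut_norm_pull_le[OF mp(2) kernel_pull[OF mp(1) w]])
  finally show "cut_norm w \<le> cut_norm (pull \<phi> w)" .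
qed

lemma cut_distance_pull:
  "cut_distance f g = (INF \<phi>\<in>rearrangements. cut_norm (\<lambda>z. f z - pull \<phi> g z))"
  unfolding cut_distance_def pull_def by (simp add: case_prod_beta')

lemma cut_norm_pull_diff_nonneg:
  assumes "bounded_kernel f" "bounded_kernel g" "\<phi> \<in> rearrangements"
  shows "0 \<le> cut_norm (\<lambda>z. f z - pull \<phi> g z)"
  using assms by (intro cut_norm_nonneg kernel_diff kernel_pull) (auto elim: rearrangementsE)

lemma cut_distance_le:
  assumes "bounded_kernel f" "bounded_kernel g" "\<phi> \<in> rearrangements"
  shows "cut_distance f g \<le> cut_norm (\<lambda>z. f z - pull \<phi> g z)"
  unfolding cut_distance_pull using cut_norm_pull_diff_nonneg[OF assms(1,2)] assms(3)
  by (intro cINF_lower bdd_belowI2)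

lemma cut_distance_le_cut_norm:
  assumes "bounded_kernel f" "bounded_kernel g"
  shows "cut_distance f g \<le> cut_norm (\<lambda>z. f z - g z)"
  using cut_distance_le[OF assms rearrangements_id] by (simp add: pull_def)

lemma cut_distance_nonneg:
  assumes "bounded_kernel f" "bounded_kernel g"
  shows "0 \<le> cut_distance f g"
  unfolding cut_distance_pull using cut_norm_pull_diff_nonneg[OF assms] rearrangements_id
  by (intro cINF_greatest) auto

lemma cut_distance_less:
  assumes "cut_distance f g < c"
  obtains \<phi> where "\<phi> \<in> rearrangements" "measure_preserving \<phi>" "cut_norm (\<lambda>z. f z - pull \<phi> g z) < c"
proof -
  have "\<exists>\<phi>\<in>rearrangements. cut_norm (\<lambda>z. f z - pull \<phi> g z) < c"
  proof (rule ccontr)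
    assume "\<not> ?thesis"
    then have "c \<le> cut_distance f g"
      unfolding cut_distance_pull using rearrangements_id by (intro cINF_greatest) (auto simp: not_less)
    with assms show False by simp
  qed
  then show thesis using that by (auto elim: rearrangementsE)
qed

lemma cut_distance_commute_le:
  assumes "bounded_kernel f" "bounded_kernel g"
  shows "cut_distance g f \<le> cut_distance f g"
proof (rule field_le_epsilon)
  fix e :: real assume "0 < e"
  then obtain \<phi> where "\<phi> \<in> rearrangements" and less: "cut_norm (\<lambda>z. f z - pull \<phi> g z) < cut_distance f g + e"
    using cut_distance_less[of f g "cut_distance f g + e"] by auto
  then obtain \<psi> where mp: "measure_preserving \<phi>" "measure_preserving \<psi>" "\<psi> \<in> rearrangements"
    and inv: "\<And>x. x \<in> {0..1} \<Longrightarrow> \<phi> (\<psi> x) = x"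
    by (auto elim: rearrangementsE)
  have "cut_distance g f \<le> cut_norm (\<lambda>z. g z - pull \<psi> f z)"
    using assms mp by (intro cut_distance_le)
  also have "\<dots> = cut_norm (\<lambda>z. pull \<psi> f z - g z)" by (rule cut_norm_minus_commute)
  also have "\<dots> = cut_norm (pull \<psi> (\<lambda>z. f z - pull \<phi> g z))"
    using assms mp inv by (intro cut_norm_cong kernel_diff kernel_pull) (auto simp: pull_def)
  also have "\<dots> = cut_norm (\<lambda>z. f z - pull \<phi> g z)"
    using assms mp by (intro cut_norm_pull kernel_diff kernel_pull)
  finally show "cut_distance g f \<le> cut_distance f g + e" using less by simp
qed

lemma cut_distance_commute: "bounded_kernel f \<Longrightarrow> bounded_kernel g \<Longrightarrow> cut_distance f g = cut_distance g f"
  by (intro antisym cut_distance_commute_le)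

lemma cut_distance_triangle:
  assumes f: "bounded_kernel f" and g: "bounded_kernel g" and h: "bounded_kernel h"
  shows "cut_distance f h \<le> cut_distance f g + cut_distance g h"
proof (rule field_le_epsilon)
  fix e :: real assume "0 < e"
  then have less: "cut_distance f g < cut_distance f g + e / 2" "cut_distance g h < cut_distance g h + e / 2"
    by simp_all
  obtain \<phi> where phi: "\<phi> \<in> rearrangements" "measure_preserving \<phi>"
      "cut_norm (\<lambda>z. f z - pull \<phi> g z) < cut_distance f g + e / 2"
    by (rule cut_distance_less[OF less(1)])
  obtain \<psi> where psi: "\<psi> \<in> rearrangements" "measure_preserving \<psi>"
      "cut_norm (\<lambda>z. g z - pull \<psi> h z) < cut_distance g h + e / 2"
    by (rule cut_distance_less[OF less(2)])
  have pull_pull: "pull (\<psi> \<circ> \<phi>) h = pull \<phi> (pull \<psi> h)" by (auto simp: pull_def)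
  have "cut_distance f h \<le> cut_norm (\<lambda>z. f z - pull (\<psi> \<circ> \<phi>) h z)"
    by (intro cut_distance_le rearrangements_comp phi psi f h)
  also have "\<dots> \<le> cut_norm (\<lambda>z. f z - pull \<phi> g z) + cut_norm (\<lambda>z. pull \<phi> g z - pull \<phi> (pull \<psi> h) z)"
    unfolding pull_pull using f g h phi(2) psi(2) by (intro cut_norm_triangle kernel_pull)
  also have "cut_norm (\<lambda>z. pull \<phi> g z - pull \<phi> (pull \<psi> h) z) = cut_norm (pull \<phi> (\<lambda>z. g z - pull \<psi> h z))"
    by (simp add: pull_def case_prod_beta')
  also have "\<dots> = cut_norm (\<lambda>z. g z - pull \<psi> h z)"
    using g h phi psi by (intro cut_norm_pull kernel_diff kernel_pull)
  finally show "cut_distance f h \<le> cut_distance f g + cut_distance g h + e" using phi psi by simp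
qed

lemma cut_distance_refl: "bounded_kernel f \<Longrightarrow> cut_distance f f = 0"
  using cut_distance_le_cut_norm[of f f] cut_distance_nonneg[of f f] cut_norm_le_L1[of "\<lambda>z. 0"]
  by simp

lemma equiv_cut_equiv: "equiv (Collect graphon) cut_equiv"
proof (rule equivI)
  show "cut_equiv \<subseteq> Collect graphon \<times> Collect graphon" by (auto simp: cut_equiv_def)
  show "refl_on (Collect graphon) cut_equiv"
    by (rule refl_onI) (auto simp: cut_equiv_def cut_distance_refl kernel_graphon)
  show "sym cut_equiv"
    by (rule symI) (auto simp: cut_equiv_def cut_distance_commute kernel_graphon)
  show "trans cut_equiv"
  proof (rule transI)
    fix f g h assume "(f, g) \<in> cut_equiv" "(g, h) \<in> cut_equiv"
    then show "(f, h) \<in> cut_equiv"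
      using cut_distance_triangle[of f g h] cut_distance_nonneg[of f h]
      by (auto simp: cut_equiv_def kernel_graphon)
  qed
qed

section \<open>The counting lemma\<close>

abbreviation unit_cube :: "nat set \<Rightarrow> (nat \<Rightarrow> real) measure" where
  "unit_cube I \<equiv> \<Pi>\<^sub>M i\<in>I. unit_interval"

lemma prob_space_unit_cube: "prob_space (unit_cube I)"
  by (intro prob_space_PiM prob_space_unit_interval)

interpretation unit_cube: product_sigma_finite "\<lambda>_::nat. unit_interval" ..

lemma (in prob_space) abs_integral_le_bound:
  fixes f :: "'a \<Rightarrow> real"
  assumes "\<And>x. x \<in> space M \<Longrightarrow> \<bar>f x\<bar> \<le> c"
  shows "\<bar>integral\<^sup>L M f\<bar> \<le> c"
proof (cases "integrable M f")
  case True
  have "\<bar>integral\<^sup>L M f\<bar> \<le> (\<integral>x. \<bar>f x\<bar> \<partial>M)" by (rule integral_abs_bound)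
  also have "\<dots> \<le> (\<integral>x. c \<partial>M)" using True assms by (intro integral_mono) auto
  finally show ?thesis by (simp add: prob_space)
next
  case False
  obtain x where "x \<in> space M" using not_empty by blast
  then have "0 \<le> c" using assms[of x] by linarith
  then show ?thesis using False by (simp add: not_integrable_integral_eq)
qed

text \<open>Freezing every coordinate except \<open>u\<close> and \<open>v\<close> leaves a product of a function of \<open>x u\<close> and
  a function of \<open>x v\<close>, that is, a pair of test functions for the cut norm.\<close>

lemma edge_integral_le_cut_norm:
  assumes w: "bounded_kernel w" and I: "finite I" "u \<in> I" "v \<in> I" "u \<noteq> v"
    and A [measurable]: "A \<in> borel_measurable (unit_cube I)" and A01: "\<And>x. x \<in> space (unit_cube I) \<Longrightarrow> A x \<in> {0..1}"
    and B [measurable]: "B \<in> borel_measurable (unit_cube I)" and B01: "\<And>x. x \<in> space (unit_cube I) \<Longrightarrow> B x \<in> {0..1}"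
    and Av: "\<And>x t. A (x(v := t)) = A x" and Bu: "\<And>x s. B (x(u := s)) = B x"
  shows "\<bar>\<integral>x. A x * B x * w (x u, x v) \<partial>unit_cube I\<bar> \<le> cut_norm w"
proof -
  define J where "J = I - {u, v}"
  have IJ: "I = insert u (insert v J)" and J: "finite J" "v \<notin> J" "u \<notin> insert v J"
    using I by (auto simp: J_def)
  obtain C where C: "\<forall>x\<in>{0..1}. \<forall>y\<in>{0..1}. \<bar>w (x, y)\<bar> \<le> C" using w by (auto simp: bounded_kernel_def)
  have [measurable]: "w \<in> borel_measurable unit_square" using w by measurable
  define F where "F = (\<lambda>x. A x * B x * w (x u, x v))"
  have [measurable]: "(\<lambda>x. x u) \<in> unit_cube I \<rightarrow>\<^sub>M unit_interval" "(\<lambda>x. x v) \<in> unit_cube I \<rightarrow>\<^sub>M unit_interval"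
    using I by (auto intro: measurable_component_singleton)
  have Fm [measurable]: "F \<in> borel_measurable (unit_cube I)" unfolding F_def by measurable
  have Fb: "\<bar>F x\<bar> \<le> C" if x: "x \<in> space (unit_cube I)" for x
  proof -
    have "x u \<in> {0..1}" "x v \<in> {0..1}" using x I by (auto simp: space_PiM PiE_def)
    then have *: "\<bar>w (x u, x v)\<bar> \<le> C" using C by blast
    have "\<bar>A x * B x\<bar> \<le> 1" using A01[OF x] B01[OF x] by (simp add: abs_mult mult_le_one)
    then have "\<bar>A x * B x\<bar> * \<bar>w (x u, x v)\<bar> \<le> 1 * C" using * by (intro mult_mono) auto
    then show ?thesis by (simp add: F_def abs_mult)
  qed
  interpret cI: prob_space "unit_cube I" by (rule prob_space_unit_cube)
  interpret cv: prob_space "unit_cube (insert v J)" by (rule prob_space_unit_cube)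
  interpret cJ: prob_space "unit_cube J" by (rule prob_space_unit_cube)
  have upd: "x(u := s) \<in> space (unit_cube I)" if "x \<in> space (unit_cube (insert v J))" "s \<in> {0..1}" for x s
    using that unfolding IJ by (auto simp: space_PiM PiE_def extensional_def)
  have updv: "x(v := t) \<in> space (unit_cube (insert v J))" if "x \<in> space (unit_cube J)" "t \<in> {0..1}" for x t
    using that by (auto simp: space_PiM PiE_def extensional_def)
  have inner_m: "(\<lambda>x. \<integral>s. F (x(u := s)) \<partial>unit_interval) \<in> borel_measurable (unit_cube (insert v J))"
  proof (rule unit_interval.borel_measurable_lebesgue_integral)
    have "(\<lambda>(x, s). x(u := s)) \<in> unit_cube (insert v J) \<Otimes>\<^sub>M unit_interval \<rightarrow>\<^sub>M unit_cube I"
      unfolding case_prod_beta' IJ by (rule measurable_fun_upd[where J = "insert v J"]) auto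
    from measurable_comp[OF this Fm]
    show "(\<lambda>(x, s). F (x(u := s))) \<in> borel_measurable (unit_cube (insert v J) \<Otimes>\<^sub>M unit_interval)"
      by (simp add: comp_def case_prod_beta')
  qed
  have "integrable (unit_cube I) F" using Fb Fm by (intro cI.integrable_const_bound[where B = C]) (auto intro!: AE_I2)
  then have "(\<integral>x. F x \<partial>unit_cube I) = (\<integral>x. (\<integral>s. F (x(u := s)) \<partial>unit_interval) \<partial>unit_cube (insert v J))"
    unfolding IJ using J by (intro unit_cube.product_integral_insert) auto
  also have "\<dots> = (\<integral>x. (\<integral>t. (\<integral>s. F (x(v := t, u := s)) \<partial>unit_interval) \<partial>unit_interval) \<partial>unit_cube J)"
    using J inner_m Fb upd
    by (intro unit_cube.product_integral_insert cv.integrable_const_bound[where B = C])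
      (auto intro!: AE_I2 unit_interval.abs_integral_le_bound)
  also have "\<bar>\<dots>\<bar> \<le> cut_norm w"
  proof (rule cJ.abs_integral_le_bound)
    fix x assume x: "x \<in> space (unit_cube J)"
    define a where "a = (\<lambda>s. A (x(v := 0, u := s)))"
    define b where "b = (\<lambda>t. B (x(v := t, u := 0)))"
    have mu: "(\<lambda>s. x(v := 0, u := s)) \<in> unit_interval \<rightarrow>\<^sub>M unit_cube I"
      unfolding IJ by (rule measurable_component_update[OF updv[OF x] J(3)]) simp
    have mv: "(\<lambda>t. x(v := t, u := 0)) \<in> unit_interval \<rightarrow>\<^sub>M unit_cube I"
      unfolding IJ by (rule measurable_fun_upd[where J = "insert v J"])
        (use J x in \<open>auto intro!: measurable_component_update simp: space_restrict_space\<close>)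
    have am: "a \<in> borel_measurable unit_interval" unfolding a_def using measurable_comp[OF mu A] by (simp add: comp_def)
    have bm: "b \<in> borel_measurable unit_interval" unfolding b_def using measurable_comp[OF mv B] by (simp add: comp_def)
    have a01: "a s \<in> {0..1}" if "s \<in> {0..1}" for s
      unfolding a_def using A01 upd updv x that by auto
    have b01: "b t \<in> {0..1}" if "t \<in> {0..1}" for t
      unfolding b_def using B01 upd updv x that by auto
    have eq: "F (x(v := t, u := s)) = a s * b t * w (s, t)" for s t
    proof -
      have "A (x(v := t, u := s)) = a s"
        using Av[of "x(u := s)" t] Av[of "x(u := s)" 0] I(4) by (simp add: a_def fun_upd_twist)
      moreover have "B (x(v := t, u := s)) = b t"
        using Bu[of "x(v := t)" s] Bu[of "x(v := t)" 0] by (simp add: b_def)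
      ultimately show ?thesis using I(4) by (simp add: F_def)
    qed
    have k: "bounded_kernel (\<lambda>z. a (fst z) * b (snd z) * w z)"
      using a01 b01 by (intro kernel_mult kernel_fst[where B = 1] kernel_snd[where B = 1] w am bm) auto
    have "(\<integral>t. (\<integral>s. F (x(v := t, u := s)) \<partial>unit_interval) \<partial>unit_interval)
        = (\<integral>z. a (fst z) * b (snd z) * w z \<partial>unit_square)"
      unfolding eq using unit_square.integral_snd[of "\<lambda>s t. a s * b t * w (s, t)"] kernel_integrable[OF k]
      by (simp add: case_prod_beta')
    then show "\<bar>\<integral>t. (\<integral>s. F (x(v := t, u := s)) \<partial>unit_interval) \<partial>unit_interval\<bar> \<le> cut_norm w"
      using abs_test_integral_le_cut_norm[OF w am a01 bm b01] by simp
  qed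
  finally show ?thesis by (simp add: F_def)
qed

definition edge_pairs :: "sgraph \<Rightarrow> (nat \<times> nat) set" where
  "edge_pairs P = {(u, v). u < v \<and> {u, v} \<in> snd P}"

lemma subgraph_density_edge_pairs:
  "subgraph_density P g = (\<integral>x. (\<Prod>(u, v)\<in>edge_pairs P. g (x u, x v)) \<partial>unit_cube {1..fst P})"
  unfolding subgraph_density_def edge_pairs_def by simp

lemma edge_pairs_bounds:
  "simple_graph P \<Longrightarrow> (u, v) \<in> edge_pairs P \<Longrightarrow> u \<in> {1..fst P} \<and> v \<in> {1..fst P} \<and> u < v"
  by (auto simp: simple_graph_def edge_pairs_def)

lemma finite_edge_pairs:
  assumes "simple_graph P"
  shows "finite (edge_pairs P)"
proof (rule finite_subset)
  show "edge_pairs P \<subseteq> {1..fst P} \<times> {1..fst P}" using edge_pairs_bounds[OF assms] by auto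
qed simp

text \<open>The edges are switched from \<open>g\<close> to \<open>f\<close> one at a time. The factors that avoid \<open>v\<close> and those
  that contain \<open>v\<close> (hence avoid \<open>u\<close>) are the two test functions for the switched edge \<open>(u, v)\<close>.\<close>

lemma density_diff_le_cut_norm:
  assumes P: "simple_graph P" and f: "graphon f" and g: "graphon g"
  shows "\<bar>subgraph_density P f - subgraph_density P g\<bar>
    \<le> real (card (edge_pairs P)) * cut_norm (\<lambda>z. f z - g z)"
proof -
  define E where "E = edge_pairs P"
  define I where "I = {1..fst P}"
  have E: "u \<in> I" "v \<in> I" "u < v" if "(u, v) \<in> E" for u v
    using edge_pairs_bounds[OF P] that by (auto simp: E_def I_def)
  have finE: "finite E" unfolding E_def by (rule finite_edge_pairs[OF P])
  define h where "h = (\<lambda>D x. \<Prod>(u, v)\<in>E. (if (u, v) \<in> D then f else g) (x u, x v))"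
  have val: "(if Q then f else g) (x u, x v) \<in> {0..1}"
    if "x \<in> space (unit_cube I)" "u \<in> I" "v \<in> I" for Q and x :: "nat \<Rightarrow> real" and u v
  proof -
    have "x u \<in> {0..1}" "x v \<in> {0..1}" using that by (auto simp: space_PiM PiE_def)
    then show ?thesis using f g by (simp add: graphon_def)
  qed
  have meas: "(\<lambda>x. (if Q then f else g) (x u, x v)) \<in> borel_measurable (unit_cube I)"
    if "u \<in> I" "v \<in> I" for Q u v
  proof -
    have [measurable]: "f \<in> borel_measurable unit_square" "g \<in> borel_measurable unit_square"
      using f g by (auto simp: graphon_def)
    have [measurable]: "(\<lambda>x. x u) \<in> unit_cube I \<rightarrow>\<^sub>M unit_interval" "(\<lambda>x. x v) \<in> unit_cube I \<rightarrow>\<^sub>M unit_interval"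
      using that by (auto intro: measurable_component_singleton)
    show ?thesis by (cases Q) simp_all
  qed
  have prod_meas: "(\<lambda>x. \<Prod>(u, v)\<in>E'. (if (u, v) \<in> D then f else g) (x u, x v)) \<in> borel_measurable (unit_cube I)"
    if "E' \<subseteq> E" for E' D
    unfolding case_prod_beta'
  proof (rule borel_measurable_prod)
    fix e assume "e \<in> E'"
    then show "(\<lambda>x. (if (fst e, snd e) \<in> D then f else g) (x (fst e), x (snd e))) \<in> borel_measurable (unit_cube I)"
      using that E(1,2)[of "fst e" "snd e"] by (intro meas) auto
  qed
  have prod_val: "(\<Prod>(u, v)\<in>E'. (if (u, v) \<in> D then f else g) (x u, x v)) \<in> {0..1}"
    if "E' \<subseteq> E" "x \<in> space (unit_cube I)" for E' D x
  proof -
    have "(if (u, v) \<in> D then f else g) (x u, x v) \<in> {0..1}" if "(u, v) \<in> E'" for u v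
      using E val that \<open>E' \<subseteq> E\<close> \<open>x \<in> _\<close> by blast
    then show ?thesis by (auto simp: case_prod_beta' intro!: prod_nonneg prod_le_1)
  qed
  interpret c: prob_space "unit_cube I" by (rule prob_space_unit_cube)
  have h_int: "integrable (unit_cube I) (h D)" for D
    unfolding h_def using prod_meas[of E D] prod_val[of E _ D]
    by (intro c.integrable_const_bound[where B = 1]) (auto intro!: AE_I2)
  have step: "\<bar>(\<integral>x. h (insert e D) x \<partial>unit_cube I) - (\<integral>x. h D x \<partial>unit_cube I)\<bar> \<le> cut_norm (\<lambda>z. f z - g z)"
    if e: "e \<in> E" "e \<notin> D" for e D
  proof -
    obtain u v where uv: "e = (u, v)" by (cases e)
    have "u < v" "u \<in> I" "v \<in> I" using E e uv by auto
    define EB where "EB = {(a, b) \<in> E - {e}. a = v \<or> b = v}"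
    define EA where "EA = {(a, b) \<in> E - {e}. a \<noteq> v \<and> b \<noteq> v}"
    have EAB: "E - {e} = EA \<union> EB" "EA \<inter> EB = {}" "EA \<subseteq> E" "EB \<subseteq> E" by (auto simp: EA_def EB_def)
    define q where "q = (\<lambda>E' x. \<Prod>(u, v)\<in>E'. (if (u, v) \<in> D then f else g) (x u, x v))"
    have split: "h D' x = (if e \<in> D' then f else g) (x u, x v) * (q EA x * q EB x)"
      if "D' = D \<or> D' = insert e D" for D' x
    proof -
      have "h D' x = (if e \<in> D' then f else g) (x u, x v)
          * (\<Prod>(u, v)\<in>E - {e}. (if (u, v) \<in> D' then f else g) (x u, x v))"
        unfolding h_def using e finE uv by (subst prod.remove[of E e]) auto
      also have "(\<Prod>(u, v)\<in>E - {e}. (if (u, v) \<in> D' then f else g) (x u, x v)) = q (E - {e}) x"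
        unfolding q_def using that by (intro prod.cong) auto
      also have "\<dots> = q EA x * q EB x"
        unfolding q_def EAB(1) using finE EAB by (intro prod.union_disjoint) (auto intro: finite_subset)
      finally show ?thesis .
    qed
    have "h (insert e D) x - h D x = q EA x * q EB x * (\<lambda>z. f z - g z) (x u, x v)" for x
      using e by (simp add: split algebra_simps)
    then have "(\<integral>x. h (insert e D) x \<partial>unit_cube I) - (\<integral>x. h D x \<partial>unit_cube I)
       = (\<integral>x. q EA x * q EB x * (\<lambda>z. f z - g z) (x u, x v) \<partial>unit_cube I)"
      by (subst Bochner_Integration.integral_diff[symmetric]) (auto simp: h_int)
    also have "\<bar>\<dots>\<bar> \<le> cut_norm (\<lambda>z. f z - g z)"
    proof (rule edge_integral_le_cut_norm)
      show "bounded_kernel (\<lambda>z. f z - g z)" by (intro kernel_diff kernel_graphon f g)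
      show "finite I" "u \<in> I" "v \<in> I" "u \<noteq> v" using \<open>u < v\<close> \<open>u \<in> I\<close> \<open>v \<in> I\<close> by (auto simp: I_def)
      show "q EA \<in> borel_measurable (unit_cube I)" "q EB \<in> borel_measurable (unit_cube I)"
        unfolding q_def using prod_meas EAB by auto
      show "q EA x \<in> {0..1}" "q EB x \<in> {0..1}" if "x \<in> space (unit_cube I)" for x
        unfolding q_def using prod_val EAB that by blast+
      show "q EA (x(v := t)) = q EA x" for x t
        unfolding q_def by (intro prod.cong) (auto simp: EA_def)
      show "q EB (x(u := s)) = q EB x" for x s
        unfolding q_def
      proof (intro prod.cong refl)
        fix p assume p: "p \<in> EB"
        have "fst p \<noteq> u" "snd p \<noteq> u"
          using p E(3)[of "fst p" "snd p"] \<open>u < v\<close> uv by (auto simp: EB_def)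
        then show "(case p of (a, b) \<Rightarrow> (if (a, b) \<in> D then f else g) ((x(u := s)) a, (x(u := s)) b)) =
            (case p of (a, b) \<Rightarrow> (if (a, b) \<in> D then f else g) (x a, x b))"
          by (cases p) simp
      qed
    qed
    finally show ?thesis .
  qed
  have "\<bar>(\<integral>x. h D x \<partial>unit_cube I) - (\<integral>x. h {} x \<partial>unit_cube I)\<bar> \<le> real (card D) * cut_norm (\<lambda>z. f z - g z)"
    if "finite D" "D \<subseteq> E" for D
    using that
  proof (induction D rule: finite_induct)
    case (insert e D)
    then show ?case using step[of e D] by (simp add: algebra_simps)
  qed simp
  from this[OF finE order_refl] show ?thesis
    unfolding subgraph_density_edge_pairs h_def E_def I_def
    by (simp add: case_prod_beta' cong: prod.cong)
qed

lemma subgraph_density_pull: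
  assumes P: "simple_graph P" and g: "graphon g" and mp: "measure_preserving \<phi>"
  shows "subgraph_density P (pull \<phi> g) = subgraph_density P g"
proof -
  define I where "I = {1..fst P}"
  define q where "q = ((\<lambda>g x. \<Prod>(u, v)\<in>edge_pairs P. g (x u, x v)) :: (real \<times> real \<Rightarrow> real) \<Rightarrow> (nat \<Rightarrow> real) \<Rightarrow> real)"
  have E: "u \<in> I" "v \<in> I" if "(u, v) \<in> edge_pairs P" for u v
    using edge_pairs_bounds[OF P] that by (auto simp: I_def)
  note \<phi> = measure_preservingD[OF mp]
  have gm [measurable]: "g \<in> borel_measurable unit_square" using g by (auto simp: graphon_def)
  have qm: "q g \<in> borel_measurable (unit_cube I)"
    unfolding q_def case_prod_beta'
  proof (rule borel_measurable_prod)
    fix e assume "e \<in> edge_pairs P"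
    then have [measurable]: "(\<lambda>x. x (fst e)) \<in> unit_cube I \<rightarrow>\<^sub>M unit_interval"
       "(\<lambda>x. x (snd e)) \<in> unit_cube I \<rightarrow>\<^sub>M unit_interval"
      using E[of "fst e" "snd e"] by (auto intro: measurable_component_singleton)
    show "(\<lambda>x. g (x (fst e), x (snd e))) \<in> borel_measurable (unit_cube I)" by measurable
  qed
  have d: "distr (unit_cube I) (unit_cube I) (compose I \<phi>) = unit_cube I"
    using distr_PiM_finite_prob_space'[of I "\<lambda>_. unit_interval" "\<lambda>_. unit_interval" \<phi>]
      prob_space_unit_interval \<phi> by (simp add: I_def)
  have cm: "compose I \<phi> \<in> unit_cube I \<rightarrow>\<^sub>M unit_cube I"
    unfolding compose_def using \<phi>(1)
    by (intro measurable_restrict measurable_compose[OF measurable_component_singleton]) auto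
  have "subgraph_density P g = (\<integral>x. q g x \<partial>distr (unit_cube I) (unit_cube I) (compose I \<phi>))"
    unfolding d unfolding subgraph_density_edge_pairs q_def I_def by simp
  also have "\<dots> = (\<integral>x. q g (compose I \<phi> x) \<partial>unit_cube I)"
    by (rule integral_distr[OF cm qm])
  also have "\<dots> = (\<integral>x. q (pull \<phi> g) x \<partial>unit_cube I)"
    unfolding q_def using E
    by (intro Bochner_Integration.integral_cong refl prod.cong) (auto simp: compose_def pull_def)
  finally show ?thesis unfolding subgraph_density_edge_pairs q_def I_def by simp
qed

text \<open>Rearranging \<open>g\<close> does not change its densities, so the bound passes to the infimum over rearrangements.\<close>

theorem density_diff_le_cut_distance:
  assumes P: "simple_graph P" and f: "graphon f" and g: "graphon g"
  shows "\<bar>subgraph_density P f - subgraph_density P g\<bar>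
    \<le> real (card (edge_pairs P)) * cut_distance f g"
proof (rule field_le_epsilon)
  fix e :: real assume e: "0 < e"
  define m where "m = real (card (edge_pairs P))"
  have m: "0 \<le> m" by (simp add: m_def)
  have "cut_distance f g < cut_distance f g + e / (m + 1)" using e m by simp
  from cut_distance_less[OF this] obtain \<phi> where phi: "measure_preserving \<phi>"
      "cut_norm (\<lambda>z. f z - pull \<phi> g z) < cut_distance f g + e / (m + 1)"
    by blast
  have "\<bar>subgraph_density P f - subgraph_density P g\<bar>
      \<le> m * cut_norm (\<lambda>z. f z - pull \<phi> g z)"
    using density_diff_le_cut_norm[OF P f graphon_pull[OF phi(1) g]] subgraph_density_pull[OF P g phi(1)]
    by (simp add: m_def)
  also have "\<dots> \<le> m * (cut_distance f g + e / (m + 1))" using phi(2) m by (intro mult_left_mono) auto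
  also have "\<dots> = m * cut_distance f g + e * (m / (m + 1))" by (simp add: field_simps)
  also have "\<dots> \<le> m * cut_distance f g + e" using e m by (simp add: field_simps)
  finally show "\<bar>subgraph_density P f - subgraph_density P g\<bar>
      \<le> real (card (edge_pairs P)) * cut_distance f g + e" by (simp add: m_def)
qed

section \<open>Step functions\<close>

text \<open>For \<open>0 < x \<le> 1\<close> this is the index \<open>u\<close> with \<open>(u - 1) / n < x \<le> u / n\<close>. The maximum moves the
  point \<open>0\<close> into the first cell, so that all of the closed unit interval is covered by the cells \<open>1, \<dots>, n\<close>.\<close>

definition cell :: "nat \<Rightarrow> real \<Rightarrow> nat" where
  "cell n x = max 1 (nat \<lceil>real n * x\<rceil>)"

definition step :: "nat \<Rightarrow> (nat \<Rightarrow> nat \<Rightarrow> real) \<Rightarrow> real \<times> real \<Rightarrow> real" where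
  "step n A = (\<lambda>(x, y). A (cell n x) (cell n y))"

definition cell_set :: "nat \<Rightarrow> nat \<Rightarrow> real set" where
  "cell_set n u = {x \<in> {0..1}. cell n x = u}"

lemma cell_ge_1: "cell n x \<ge> 1"
  by (simp add: cell_def)

lemma cell_le_iff: "m \<ge> 1 \<Longrightarrow> cell n x \<le> m \<longleftrightarrow> real n * x \<le> real m"
  by (simp add: cell_def)

lemma cell_in_range: "n \<ge> 1 \<Longrightarrow> x \<in> {0..1} \<Longrightarrow> cell n x \<in> {1..n}"
  using cell_ge_1[of n x] cell_le_iff[of n n x] by (simp add: mult_left_le)

lemma cell_eqI:
  assumes "n \<ge> 1" "u \<ge> 1" "(real u - 1) / real n < x" "x \<le> real u / real n"
  shows "cell n x = u"
proof -
  have "real u - 1 < real n * x" "real n * x \<le> real u" using assms by (auto simp: field_simps)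
  then have "\<lceil>real n * x\<rceil> = int u" by (simp add: ceiling_eq_iff)
  then show ?thesis using assms by (simp add: cell_def)
qed

lemma cell_bounds:
  assumes "n \<ge> 1" "0 < x"
  shows "(real (cell n x) - 1) / real n < x" "x \<le> real (cell n x) / real n"
proof -
  define c where "c = \<lceil>real n * x\<rceil>"
  have c: "of_int c - 1 < real n * x" "real n * x \<le> of_int c"
    using ceiling_correct[of "real n * x"] by (auto simp: c_def)
  have "0 < real n * x" using assms by simp
  then have "1 \<le> c" using c by linarith
  then have *: "real (cell n x) = of_int c" unfolding cell_def c_def[symmetric] by simp
  show "(real (cell n x) - 1) / real n < x" "x \<le> real (cell n x) / real n"
    using assms c unfolding * by (simp_all add: field_simps)
qed

lemma measurable_cell [measurable]: "cell n \<in> unit_interval \<rightarrow>\<^sub>M count_space UNIV"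
proof -
  have "(\<lambda>x. \<lceil>real n * x\<rceil>) \<in> borel \<rightarrow>\<^sub>M count_space UNIV" by measurable
  from measurable_compose[OF this, of "\<lambda>i. max 1 (nat i)" "count_space UNIV"]
  have "cell n \<in> lborel \<rightarrow>\<^sub>M count_space UNIV" by (simp add: cell_def[abs_def])
  then show ?thesis by (rule measurable_restrict_space1)
qed

lemma sets_cell_set [measurable]: "cell_set n u \<in> sets unit_interval"
proof -
  have "cell_set n u = cell n -` {u} \<inter> space unit_interval" by (auto simp: cell_set_def)
  also have "\<dots> \<in> sets unit_interval" by (rule measurable_sets[OF measurable_cell]) simp
  finally show ?thesis .
qed

lemma measure_cell_set:
  assumes "u \<in> {1..n}"
  shows "measure unit_interval (cell_set n u) = 1 / real n"
proof -
  have n: "n \<ge> 1" using assms by auto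
  have "measure unit_interval (cell_set n u) = measure lborel (cell_set n u)"
    using sets_cell_set[of n u] by (intro measure_restrict_space) (auto simp: cell_set_def)
  also have "\<dots> = 1 / real n"
  proof (cases "u = 1")
    case True
    have "x \<in> cell_set n u \<longleftrightarrow> x \<in> {0..1 / real n}" for x
    proof -
      have "cell n x = 1 \<longleftrightarrow> real n * x \<le> 1"
        using cell_ge_1[of n x] cell_le_iff[of 1 n x] by auto
      moreover have "real n * x \<le> 1 \<longleftrightarrow> x \<le> 1 / real n" using n by (simp add: field_simps)
      moreover have "1 / real n \<le> 1" using n by simp
      ultimately show ?thesis unfolding cell_set_def True by auto
    qed
    then have "cell_set n u = {0..1 / real n}" by blast
    then show ?thesis by simp
  next
    case False
    have "cell_set n u = {(real u - 1) / real n<..real u / real n}"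
    proof (intro set_eqI iffI)
      fix x assume "x \<in> cell_set n u"
      then have x: "x \<in> {0..1}" "cell n x = u" by (auto simp: cell_set_def)
      then have "x \<noteq> 0" using False by (auto simp: cell_def)
      then show "x \<in> {(real u - 1) / real n<..real u / real n}"
        using cell_bounds[OF n, of x] x by auto
    next
      fix x assume x: "x \<in> {(real u - 1) / real n<..real u / real n}"
      moreover have "real u / real n \<le> 1" "0 \<le> (real u - 1) / real n" using assms by auto
      ultimately have "x \<in> {0..1}" by auto
      then show "x \<in> cell_set n u" using cell_eqI[OF n, of u x] assms x by (auto simp: cell_set_def)
    qed
    then show ?thesis using n by (simp add: diff_divide_distrib[symmetric] field_simps)
  qed
  finally show ?thesis .
qed

lemma measurable_step [measurable]: "step n A \<in> borel_measurable unit_square"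
proof -
  have "(\<lambda>z. (cell n (fst z), cell n (snd z))) \<in> unit_square \<rightarrow>\<^sub>M count_space UNIV \<Otimes>\<^sub>M count_space UNIV"
    by measurable
  then have "(\<lambda>z. (cell n (fst z), cell n (snd z))) \<in> unit_square \<rightarrow>\<^sub>M count_space UNIV"
    by (simp add: pair_measure_countable)
  from measurable_compose[OF this, of "\<lambda>(u, v). A u v" borel]
  show ?thesis by (simp add: step_def case_prod_beta')
qed

lemma kernel_step: "n \<ge> 1 \<Longrightarrow> bounded_kernel (step n A)"
proof (rule kernelI)
  assume n: "n \<ge> 1"
  fix x y :: real assume "x \<in> {0..1}" "y \<in> {0..1}"
  then have "cell n x \<in> {1..n}" "cell n y \<in> {1..n}" using cell_in_range n by blast+
  then show "\<bar>step n A (x, y)\<bar> \<le> Max ((\<lambda>(u, v). \<bar>A u v\<bar>) ` ({1..n} \<times> {1..n}))"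
    unfolding step_def by (intro Max_ge) auto
qed (rule measurable_step)

lemma graphon_step:
  assumes "n \<ge> 1" "\<And>u v. u \<in> {1..n} \<Longrightarrow> v \<in> {1..n} \<Longrightarrow> A u v = A v u"
    "\<And>u v. u \<in> {1..n} \<Longrightarrow> v \<in> {1..n} \<Longrightarrow> A u v \<in> {0..1}"
  shows "graphon (step n A)"
  unfolding graphon_def using measurable_step assms cell_in_range[OF assms(1)]
  by (auto simp: step_def simp del: atLeastAtMost_iff)

lemma step_eq_sum:
  assumes "n \<ge> 1" "z \<in> {0..1} \<times> {0..1}"
  shows "step n A z = (\<Sum>u\<in>{1..n}. \<Sum>v\<in>{1..n}. A u v * indicator (cell_set n u \<times> cell_set n v) z)"
proof -
  obtain x y where z: "z = (x, y)" "x \<in> {0..1}" "y \<in> {0..1}" using assms(2) by auto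
  have c: "cell n x \<in> {1..n}" "cell n y \<in> {1..n}" using cell_in_range[OF assms(1)] z by blast+
  have "indicator (cell_set n u \<times> cell_set n v) z = (if u = cell n x then if v = cell n y then 1 else 0 else 0 :: real)"
    for u v using z by (auto simp: cell_set_def indicator_def)
  then have "(\<Sum>u\<in>{1..n}. \<Sum>v\<in>{1..n}. A u v * indicator (cell_set n u \<times> cell_set n v) z)
     = (\<Sum>u\<in>{1..n}. if u = cell n x then (\<Sum>v\<in>{1..n}. if v = cell n y then A u v else 0) else 0)"
    by (intro sum.cong refl) (auto simp del: sum.delta sum.delta' intro!: sum.cong)
  also have "\<dots> = A (cell n x) (cell n y)" using c by simp
  finally show ?thesis using z by (simp add: step_def)
qed

lemma integral_step_mult:
  assumes n: "n \<ge> 1" and w: "bounded_kernel w"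
  shows "(\<integral>z. step n A z * w z \<partial>unit_square)
    = (\<Sum>u\<in>{1..n}. \<Sum>v\<in>{1..n}. A u v * (LINT z:cell_set n u \<times> cell_set n v|unit_square. w z))"
proof -
  have i: "integrable unit_square (\<lambda>z. A u v * (indicator (cell_set n u \<times> cell_set n v) z *\<^sub>R w z))" for u v
    using kernel_integrable[OF w] by (intro integrable_mult_right integrable_mult_indicator) auto
  have "(\<integral>z. step n A z * w z \<partial>unit_square)
    = (\<integral>z. (\<Sum>u\<in>{1..n}. \<Sum>v\<in>{1..n}. A u v * (indicator (cell_set n u \<times> cell_set n v) z *\<^sub>R w z)) \<partial>unit_square)"
    by (intro Bochner_Integration.integral_cong refl)
      (simp only: space_unit_square step_eq_sum[OF n] sum_distrib_right mult.assoc real_scaleR_def)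
  also have "\<dots> = (\<Sum>u\<in>{1..n}. \<Sum>v\<in>{1..n}. A u v * (LINT z:cell_set n u \<times> cell_set n v|unit_square. w z))"
    unfolding set_lebesgue_integral_def using i
    by (subst Bochner_Integration.integral_sum, force)+ (simp add: Bochner_Integration.integral_sum)
  finally show ?thesis .
qed

lemma set_integral_rectangle:
  assumes "S \<in> sets unit_interval" "T \<in> sets unit_interval"
  shows "(LINT z:S \<times> T|unit_square. (1::real)) = measure unit_interval S * measure unit_interval T"
proof -
  have ST: "S \<times> T \<in> sets unit_square" using assms by auto
  have "(LINT z:S \<times> T|unit_square. (1::real)) = measure unit_square ((S \<times> T) \<inter> space unit_square)"
    unfolding set_lebesgue_integral_def by simp
  also have "(S \<times> T) \<inter> space unit_square = S \<times> T" using sets.sets_into_space[OF ST] by blast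
  also have "measure unit_square (S \<times> T) = measure unit_interval S * measure unit_interval T"
    using assms by (simp add: measure_def unit_interval.emeasure_pair_measure_Times enn2real_mult)
  finally show ?thesis .
qed

lemma integral_step:
  assumes n: "n \<ge> 1"
  shows "(\<integral>z. step n A z \<partial>unit_square) = (\<Sum>u\<in>{1..n}. \<Sum>v\<in>{1..n}. A u v) / (real n)\<^sup>2"
  using integral_step_mult[OF n, of "\<lambda>z. 1" A]
  by (simp add: set_integral_rectangle measure_cell_set sum_divide_distrib power2_eq_square)

lemma abs_linear_extreme:
  fixes b s :: "'a \<Rightarrow> real"
  assumes fin: "finite I" and "0 \<le> a" and s: "\<And>u. u \<in> I \<Longrightarrow> 0 \<le> s u \<and> s u \<le> a"
    and B: "\<And>U. U \<subseteq> I \<Longrightarrow> \<bar>\<Sum>u\<in>U. b u\<bar> \<le> B"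
  shows "\<bar>\<Sum>u\<in>I. b u * s u\<bar> \<le> a * B"
proof -
  have upper: "(\<Sum>u\<in>I. b u * s u) \<le> a * B" if B: "\<And>U. U \<subseteq> I \<Longrightarrow> \<bar>\<Sum>u\<in>U. b u\<bar> \<le> B" for b
  proof -
    have "(\<Sum>u\<in>I. b u * s u) \<le> (\<Sum>u\<in>I. if 0 \<le> b u then a * b u else 0)"
      using s by (intro sum_mono) (auto simp: mult.commute[of a] mult_left_mono mult_nonpos_nonneg)
    also have "\<dots> = a * (\<Sum>u\<in>{u \<in> I. 0 \<le> b u}. b u)"
      using fin by (auto simp: sum.inter_filter sum_distrib_left intro!: sum.cong)
    also have "\<dots> \<le> a * B" using B[of "{u \<in> I. 0 \<le> b u}"] \<open>0 \<le> a\<close> by (intro mult_left_mono) auto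
    finally show ?thesis .
  qed
  have "(\<Sum>u\<in>I. - b u * s u) \<le> a * B" using B by (intro upper) (simp add: sum_negf)
  then show ?thesis using upper[OF B] by (simp add: sum_negf)
qed

text \<open>With one argument fixed the form is linear, and a linear form on a cube is extremal at a vertex.\<close>

lemma abs_bilinear_extreme:
  fixes A :: "'a \<Rightarrow> 'b \<Rightarrow> real"
  assumes fin: "finite I" "finite J" and a: "0 \<le> a"
    and s: "\<And>u. u \<in> I \<Longrightarrow> 0 \<le> s u \<and> s u \<le> a" and t: "\<And>v. v \<in> J \<Longrightarrow> 0 \<le> t v \<and> t v \<le> a"
    and B: "\<And>U V. U \<subseteq> I \<Longrightarrow> V \<subseteq> J \<Longrightarrow> \<bar>\<Sum>u\<in>U. \<Sum>v\<in>V. A u v\<bar> \<le> B"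
  shows "\<bar>\<Sum>u\<in>I. \<Sum>v\<in>J. A u v * (s u * t v)\<bar> \<le> a\<^sup>2 * B"
proof -
  have "\<bar>\<Sum>u\<in>I. (\<Sum>v\<in>J. A u v * t v) * s u\<bar> \<le> a * (a * B)"
  proof (rule abs_linear_extreme[OF fin(1) a s])
    fix U assume U: "U \<subseteq> I"
    have "\<bar>\<Sum>v\<in>J. (\<Sum>u\<in>U. A u v) * t v\<bar> \<le> a * B"
    proof (rule abs_linear_extreme[OF fin(2) a t])
      fix V assume "V \<subseteq> J"
      with B[OF U this] show "\<bar>\<Sum>v\<in>V. \<Sum>u\<in>U. A u v\<bar> \<le> B" by (subst sum.swap)
    qed
    then show "\<bar>\<Sum>u\<in>U. \<Sum>v\<in>J. A u v * t v\<bar> \<le> a * B"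
      by (subst sum.swap) (simp add: sum_distrib_right)
  qed
  then show ?thesis by (simp add: sum_distrib_left power2_eq_square mult_ac)
qed

text \<open>The integral over \<open>S \<times> T\<close> is bilinear in the measures of the intersections of \<open>S\<close> and \<open>T\<close> with the
  cells, so unions of cells are the extreme case.\<close>

lemma cut_norm_step_le:
  assumes n: "n \<ge> 1"
    and B: "\<And>U V. U \<subseteq> {1..n} \<Longrightarrow> V \<subseteq> {1..n} \<Longrightarrow> \<bar>\<Sum>u\<in>U. \<Sum>v\<in>V. A u v\<bar> \<le> B * (real n)\<^sup>2"
  shows "cut_norm (step n A) \<le> B"
proof (rule cut_norm_least)
  fix S T assume ST [measurable]: "S \<in> sets unit_interval" "T \<in> sets unit_interval"
  have k: "bounded_kernel (indicator (S \<times> T) :: _ \<Rightarrow> real)"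
    by (rule kernelI[where B = 1]) (auto simp: indicator_def)
  have part: "(LINT z:cell_set n u \<times> cell_set n v|unit_square. indicator (S \<times> T) z)
      = measure unit_interval (cell_set n u \<inter> S) * measure unit_interval (cell_set n v \<inter> T)" for u v
    by (subst set_integral_rectangle[symmetric])
      (auto simp: set_lebesgue_integral_def indicator_def intro!: Bochner_Integration.integral_cong)
  have part_le: "measure unit_interval (cell_set n u \<inter> X) \<le> 1 / real n" if "u \<in> {1..n}" for u X
    unfolding measure_cell_set[OF that, symmetric] by (intro unit_interval.finite_measure_mono) auto
  have "(LINT z:S \<times> T|unit_square. step n A z) = (\<integral>z. step n A z * indicator (S \<times> T) z \<partial>unit_square)"
    by (simp add: set_lebesgue_integral_def mult.commute)
  also have "\<dots> = (\<Sum>u\<in>{1..n}. \<Sum>v\<in>{1..n}. A u v *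
      (measure unit_interval (cell_set n u \<inter> S) * measure unit_interval (cell_set n v \<inter> T)))"
    by (simp only: integral_step_mult[OF n k] part)
  also have "\<bar>\<dots>\<bar> \<le> (1 / real n)\<^sup>2 * (B * (real n)\<^sup>2)"
    using part_le by (intro abs_bilinear_extreme B) auto
  also have "\<dots> = B" using n by (simp add: power2_eq_square)
  finally show "\<bar>LINT z:S \<times> T|unit_square. step n A z\<bar> \<le> B" .
qed

text \<open>The integral over each rectangle of cells is bounded by the cut norm. The factor does not depend on
  \<open>w\<close>, so step functions can be used as test functions for convergence in the cut norm.\<close>

lemma integral_step_mult_le:
  assumes n: "n \<ge> 1" and w: "bounded_kernel w" and A: "\<And>u v. \<bar>A u v\<bar> \<le> C"
  shows "\<bar>\<integral>z. step n A z * w z \<partial>unit_square\<bar> \<le> (real n)\<^sup>2 * C * cut_norm w"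
proof -
  have "\<bar>\<integral>z. step n A z * w z \<partial>unit_square\<bar> \<le> (\<Sum>u\<in>{1..n}. \<Sum>v\<in>{1..n}. C * cut_norm w)"
    unfolding integral_step_mult[OF n w]
    by (intro order_trans[OF sum_abs] sum_mono order_trans[OF sum_abs])
      (auto simp: abs_mult intro!: mult_mono A cut_integral_le_cut_norm w order_trans[OF abs_ge_zero A])
  then show ?thesis by (simp add: power2_eq_square)
qed

section \<open>Approximation by step functions\<close>

lemma measure_unit_interval_space [simp]: "measure unit_interval {0..1} = 1"
  using unit_interval.prob_space by simp

lemma measure_unit_square_space [simp]: "measure unit_square ({0..1} \<times> {0..1}) = 1"
  using unit_square.prob_space by simp

text \<open>The approximations have to exist for all large \<open>n\<close>, not only for arbitrarily large ones: later the number
  of vertices itself is the number of cells.\<close>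

definition L1_approximable :: "'a measure \<Rightarrow> (nat \<Rightarrow> ('a \<Rightarrow> real) set) \<Rightarrow> ('a \<Rightarrow> real) \<Rightarrow> bool" where
  "L1_approximable M V f \<longleftrightarrow>
     (\<forall>e>0. \<forall>\<^sub>F n in sequentially. \<exists>s\<in>V n. integrable M s \<and> (\<integral>x. \<bar>f x - s x\<bar> \<partial>M) < e)"

lemma L1_approximable_add_scaled:
  assumes f: "integrable M f" "L1_approximable M V f" and g: "integrable M g" "L1_approximable M V g"
    and V: "\<And>n s t. s \<in> V n \<Longrightarrow> t \<in> V n \<Longrightarrow> (\<lambda>x. s x + c * t x) \<in> V n"
  shows "L1_approximable M V (\<lambda>x. f x + c * g x)"
  unfolding L1_approximable_def
proof (intro allI impI)
  fix e :: real assume e: "0 < e"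
  define d where "d = e / (1 + \<bar>c\<bar>)"
  have d: "0 < d" "(1 + \<bar>c\<bar>) * d = e" using e by (auto simp: d_def add_pos_nonneg)
  show "\<forall>\<^sub>F n in sequentially. \<exists>s\<in>V n. integrable M s \<and> (\<integral>x. \<bar>f x + c * g x - s x\<bar> \<partial>M) < e"
    using f(2)[unfolded L1_approximable_def, rule_format, OF d(1)]
      g(2)[unfolded L1_approximable_def, rule_format, OF d(1)]
  proof eventually_elim
    case (elim n)
    then obtain s t where st: "s \<in> V n" "integrable M s" "(\<integral>x. \<bar>f x - s x\<bar> \<partial>M) < d"
      "t \<in> V n" "integrable M t" "(\<integral>x. \<bar>g x - t x\<bar> \<partial>M) < d" by blast
    have "(\<integral>x. \<bar>f x + c * g x - (s x + c * t x)\<bar> \<partial>M) \<le> (\<integral>x. \<bar>f x - s x\<bar> + \<bar>c\<bar> * \<bar>g x - t x\<bar> \<partial>M)"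
    proof (rule integral_mono)
      fix x
      have "f x + c * g x - (s x + c * t x) = (f x - s x) + c * (g x - t x)" by (simp add: algebra_simps)
      then show "\<bar>f x + c * g x - (s x + c * t x)\<bar> \<le> \<bar>f x - s x\<bar> + \<bar>c\<bar> * \<bar>g x - t x\<bar>"
        using abs_triangle_ineq[of "f x - s x" "c * (g x - t x)"] by (simp add: abs_mult)
    qed (use f g st in auto)
    also have "\<dots> = (\<integral>x. \<bar>f x - s x\<bar> \<partial>M) + \<bar>c\<bar> * (\<integral>x. \<bar>g x - t x\<bar> \<partial>M)"
      using f g st by (subst Bochner_Integration.integral_add) auto
    also have "\<dots> < d + \<bar>c\<bar> * d"
      using st by (intro add_less_le_mono mult_left_mono) auto
    also have "\<dots> = e" using d by (simp add: algebra_simps)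
    finally show ?case using st V by (intro bexI[of _ "\<lambda>x. s x + c * t x"]) auto
  qed
qed

lemma L1_approximable_limit:
  assumes s: "\<And>k. integrable M (s k)" "\<And>k. L1_approximable M V (s k)"
    and f: "integrable M f" and w: "integrable M w"
    and lim: "\<And>x. x \<in> space M \<Longrightarrow> (\<lambda>k. s k x) \<longlonglongrightarrow> f x"
    and dom: "\<And>k x. x \<in> space M \<Longrightarrow> \<bar>s k x\<bar> \<le> w x"
  shows "L1_approximable M V f"
  unfolding L1_approximable_def
proof (intro allI impI)
  fix e :: real assume e: "0 < e"
  have "(\<lambda>k. \<integral>x. \<bar>f x - s k x\<bar> \<partial>M) \<longlonglongrightarrow> (\<integral>x. 0 \<partial>M)"
  proof (rule integral_dominated_convergence)
    show "integrable M (\<lambda>x. \<bar>f x\<bar> + w x)" using f w by auto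
    show "AE x in M. (\<lambda>k. \<bar>f x - s k x\<bar>) \<longlonglongrightarrow> 0"
    proof (rule AE_I2)
      fix x assume "x \<in> space M"
      from tendsto_rabs[OF tendsto_diff[OF tendsto_const lim[OF this], of "f x"]]
      show "(\<lambda>k. \<bar>f x - s k x\<bar>) \<longlonglongrightarrow> 0" by simp
    qed
    show "AE x in M. norm \<bar>f x - s k x\<bar> \<le> \<bar>f x\<bar> + w x" for k
    proof (rule AE_I2)
      fix x assume "x \<in> space M"
      from dom[OF this, of k] show "norm \<bar>f x - s k x\<bar> \<le> \<bar>f x\<bar> + w x" by simp
    qed
  qed (use f s(1) in auto)
  then have "\<forall>\<^sub>F k in sequentially. (\<integral>x. \<bar>f x - s k x\<bar> \<partial>M) < e / 2"
    using e by (intro order_tendstoD(2)) auto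
  then obtain k where k: "(\<integral>x. \<bar>f x - s k x\<bar> \<partial>M) < e / 2"
    by (auto simp: eventually_sequentially)
  have "0 < e / 2" using e by simp
  from s(2)[of k, unfolded L1_approximable_def, rule_format, OF this]
  show "\<forall>\<^sub>F n in sequentially. \<exists>t\<in>V n. integrable M t \<and> (\<integral>x. \<bar>f x - t x\<bar> \<partial>M) < e"
  proof eventually_elim
    case (elim n)
    then obtain t where t: "t \<in> V n" "integrable M t" "(\<integral>x. \<bar>s k x - t x\<bar> \<partial>M) < e / 2" by blast
    have "(\<integral>x. \<bar>f x - t x\<bar> \<partial>M) \<le> (\<integral>x. \<bar>f x - s k x\<bar> + \<bar>s k x - t x\<bar> \<partial>M)"
      using f s(1) t by (intro integral_mono) auto
    also have "\<dots> = (\<integral>x. \<bar>f x - s k x\<bar> \<partial>M) + (\<integral>x. \<bar>s k x - t x\<bar> \<partial>M)"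
      using f s(1) t by (intro Bochner_Integration.integral_add) auto
    also have "\<dots> < e" using k t by simp
    finally show ?case using t by blast
  qed
qed

text \<open>The sets whose indicators can be approximated form a Dynkin system.\<close>

lemma (in finite_measure) L1_approximable_indicator:
  assumes G: "Int_stable G" "G \<subseteq> Pow \<Omega>" and A: "A \<in> sigma_sets \<Omega> G"
    and \<Omega>: "space M \<subseteq> \<Omega>" "\<And>A. A \<in> sigma_sets \<Omega> G \<Longrightarrow> (indicator A :: 'a \<Rightarrow> real) \<in> borel_measurable M"
    and V: "\<And>n s t c. s \<in> V n \<Longrightarrow> t \<in> V n \<Longrightarrow> (\<lambda>x. s x + c * t x) \<in> V n"
    and one: "\<And>n. (\<lambda>x. 1) \<in> V n"
    and base: "\<And>A. A \<in> G \<Longrightarrow> L1_approximable M V (indicator A)"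
  shows "L1_approximable M V (indicator A)"
  using G A
proof (induction rule: sigma_sets_induct_disjoint)
  have cong: "L1_approximable M V g" if "L1_approximable M V f" "\<And>x. x \<in> space M \<Longrightarrow> f x = g x" for f g
    using that unfolding L1_approximable_def by (simp cong: Bochner_Integration.integral_cong)
  have int: "integrable M (indicator A :: _ \<Rightarrow> real)" if "A \<in> sigma_sets \<Omega> G" for A
    using \<Omega>(2)[OF that] by (intro integrable_const_bound[where B = 1]) (auto simp: indicator_def)
  have one': "L1_approximable M V (\<lambda>x. 1)"
    unfolding L1_approximable_def
  proof (intro allI impI always_eventually)
    fix e :: real and n assume "0 < e"
    then show "\<exists>s\<in>V n. integrable M s \<and> (\<integral>x. \<bar>1 - s x\<bar> \<partial>M) < e"
      using one[of n] by (intro bexI[of _ "\<lambda>x. 1"]) auto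
  qed
  have "L1_approximable M V (\<lambda>x. 1 + (- 1) * 1)"
    by (intro L1_approximable_add_scaled integrable_const one' V)
  then have zero: "L1_approximable M V (\<lambda>x. 0)" by simp
  {
    case (basic A)
    then show ?case by (rule base)
  next
    case empty
    show ?case using zero
      by (simp add: indicator_def[abs_def])
  next
    case (compl A)
    have "L1_approximable M V (\<lambda>x. 1 + (- 1) * indicator A x)"
      using int[OF compl(1)] by (intro L1_approximable_add_scaled one' compl V) auto
    then show ?case by (rule cong) (use \<Omega>(1) in \<open>auto simp: indicator_def\<close>)
  next
    case (union A)
    define s where "s = (\<lambda>k x. indicator (\<Union>i<k. A i) x :: real)"
    have A: "A i \<in> sigma_sets \<Omega> G" for i using union by auto
    have s_Suc: "s (Suc k) = (\<lambda>x. s k x + 1 * indicator (A k) x)" for k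
    proof
      fix x
      have "x \<notin> A k" if "x \<in> A i" "i < k" for i
        using disjoint_family_onD[OF union(1), of i k] that by auto
      then show "s (Suc k) x = s k x + 1 * indicator (A k) x"
        by (auto simp: s_def indicator_def lessThan_Suc)
    qed
    have s: "integrable M (s k) \<and> L1_approximable M V (s k)" for k
    proof (induction k)
      case 0
      show ?case using zero
        by (simp add: s_def indicator_def[abs_def])
    next
      case (Suc k)
      have "L1_approximable M V (\<lambda>x. s k x + 1 * indicator (A k) x)"
        using Suc int[OF A] union(3) by (intro L1_approximable_add_scaled V) auto
      moreover have "integrable M (\<lambda>x. s k x + 1 * indicator (A k) x)" using Suc int[OF A] by auto
      ultimately show ?case unfolding s_Suc by simp
    qed
    show ?case
    proof (rule L1_approximable_limit[where s = s and w = "\<lambda>x. 1"])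
      show "integrable M (indicator (\<Union>i. A i) :: _ \<Rightarrow> real)" using union by (intro int sigma_sets.Union A)
      show "(\<lambda>k. s k x) \<longlonglongrightarrow> indicator (\<Union>i. A i) x" for x
        unfolding s_def by (rule LIMSEQ_indicator_UN)
      show "\<bar>s k x\<bar> \<le> 1" for k x by (simp add: s_def indicator_def)
    qed (use s in auto)
  }
qed

definition step_line :: "nat \<Rightarrow> (nat \<Rightarrow> real) \<Rightarrow> real \<Rightarrow> real" where
  "step_line n a x = a (cell n x)"

lemma measurable_step_line [measurable]: "step_line n a \<in> borel_measurable unit_interval"
  unfolding step_line_def[abs_def] by (rule measurable_compose[OF measurable_cell]) simp

text \<open>The only cell on which a half line is not constant is the one that contains its end point.\<close>

lemma L1_approximable_line:
  assumes "A \<in> sets unit_interval"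
  shows "L1_approximable unit_interval (\<lambda>n. range (step_line n)) (indicator A)"
proof (rule unit_interval.L1_approximable_indicator[where G = "range (\<lambda>a::real. {..a})" and \<Omega> = UNIV])
  show "Int_stable (range (\<lambda>a::real. {..a}))" by (auto simp: Int_stable_def)
  have borel: "sigma_sets UNIV (range (\<lambda>a::real. {..a})) = sets borel" by (simp add: borel_eq_atMost)
  show "A \<in> sigma_sets UNIV (range (\<lambda>a::real. {..a}))"
    using assms unfolding borel by (auto simp: sets_restrict_space)
  show "indicator A \<in> borel_measurable unit_interval" if "A \<in> sigma_sets UNIV (range (\<lambda>a::real. {..a}))" for A
    using that unfolding borel by (intro measurable_restrict_space1) auto
  show "(\<lambda>x. s x + c * t x) \<in> range (step_line n)"
    if "s \<in> range (step_line n)" "t \<in> range (step_line n)" for n s t c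
  proof -
    from that obtain a b where "s = step_line n a" "t = step_line n b" by auto
    then have "(\<lambda>x. s x + c * t x) = step_line n (\<lambda>u. a u + c * b u)" by (auto simp: step_line_def)
    then show ?thesis by auto
  qed
  show "(\<lambda>x. 1) \<in> range (step_line n)" for n
  proof -
    have "(\<lambda>x. 1) = step_line n (\<lambda>u. 1)" by (auto simp: step_line_def)
    then show ?thesis by auto
  qed
  fix A assume "A \<in> range (\<lambda>a::real. {..a})"
  then obtain c where c: "A = {..c}" by auto
  show "L1_approximable unit_interval (\<lambda>n. range (step_line n)) (indicator A)"
    unfolding L1_approximable_def
  proof (intro allI impI)
    fix e :: real assume e: "0 < e"
    obtain N where N: "N \<ge> 1" "1 / real N < e"
      using reals_Archimedean[OF e] by (metis One_nat_def Suc_leI inverse_eq_divide zero_less_Suc)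
    have "\<exists>s\<in>range (step_line n). integrable unit_interval s \<and> (\<integral>x. \<bar>indicator A x - s x\<bar> \<partial>unit_interval) < e"
      if n: "n \<ge> N" for n
    proof
      let ?s = "step_line n (\<lambda>u. of_bool (real u \<le> real n * c))"
      have n0: "n \<ge> 1" using N n by simp
      show "?s \<in> range (step_line n)" by simp
      have int: "integrable unit_interval ?s"
        by (intro unit_interval.integrable_const_bound[where B = 1]) (auto simp: step_line_def)
      have Im: "indicator A \<in> borel_measurable unit_interval"
        unfolding c by (intro measurable_restrict_space1) auto
      have Am: "integrable unit_interval (indicator A :: _ \<Rightarrow> real)"
        using Im by (intro unit_interval.integrable_const_bound[where B = 1]) (auto simp: indicator_def)
      have X: "{c - 1 / real n<..c} \<inter> {0..1} \<in> sets unit_interval"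
        by (simp add: sets_restrict_space_iff)
      have "(\<integral>x. \<bar>indicator A x - ?s x\<bar> \<partial>unit_interval) \<le> (\<integral>x. indicator ({c - 1 / real n<..c} \<inter> {0..1}) x \<partial>unit_interval)"
      proof (rule integral_mono)
        show "integrable unit_interval (indicator ({c - 1 / real n<..c} \<inter> {0..1}) :: _ \<Rightarrow> real)"
          using X by (intro unit_interval.integrable_const_bound[where B = 1]) (auto simp: indicator_def)
        fix x assume x: "x \<in> space unit_interval"
        consider "x > c" | "x \<le> c - 1 / real n" | "x \<in> {c - 1 / real n<..c} \<inter> {0..1}"
          using x by fastforce
        then show "\<bar>indicator A x - ?s x\<bar> \<le> indicator ({c - 1 / real n<..c} \<inter> {0..1}) x"
        proof cases
          case 1
          have "real n * x \<le> real (cell n x)" using cell_le_iff[OF cell_ge_1] by blast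
          moreover have "real n * c < real n * x" using 1 n0 by simp
          ultimately show ?thesis using 1 by (simp add: c step_line_def)
        next
          case 2
          have "real (cell n x) - 1 \<le> real n * x"
          proof (cases "x = 0")
            case False
            then show ?thesis using cell_bounds(1)[OF n0, of x] x n0 by (simp add: field_simps)
          qed (simp add: cell_def)
          moreover have "real n * x \<le> real n * (c - 1 / real n)" using 2 by (intro mult_left_mono) auto
          moreover have "real n * (c - 1 / real n) = real n * c - 1" using n0 by (simp add: algebra_simps)
          ultimately have "real (cell n x) \<le> real n * c" by linarith
          moreover have "x \<le> c" using 2 n0 by (smt (verit) divide_nonneg_nonneg of_nat_0_le_iff)
          ultimately show ?thesis by (simp add: c step_line_def)
        next
          case 3
          then show ?thesis by (simp add: step_line_def c)
        qed
      qed (use int Am in auto)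
      also have "\<dots> = measure unit_interval ({c - 1 / real n<..c} \<inter> {0..1})" using X by simp
      also have "\<dots> = measure lborel ({c - 1 / real n<..c} \<inter> {0..1})"
        by (intro measure_restrict_space) auto
      also have "\<dots> \<le> measure lborel {c - 1 / real n<..c}"
        by (intro measure_mono_fmeasurable) (auto simp: fmeasurable_def)
      also have "\<dots> = 1 / real n" by simp
      also have "\<dots> \<le> 1 / real N" using n N by (simp add: frac_le)
      finally show "integrable unit_interval ?s \<and> (\<integral>x. \<bar>indicator A x - ?s x\<bar> \<partial>unit_interval) < e"
        using int N by simp
    qed
    then show "\<forall>\<^sub>F n in sequentially. \<exists>s\<in>range (step_line n). integrable unit_interval s \<and>
        (\<integral>x. \<bar>indicator A x - s x\<bar> \<partial>unit_interval) < e"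
      unfolding eventually_sequentially by blast
  qed
qed auto

text \<open>If \<open>1\<^sub>A\<close> and \<open>1\<^sub>B\<close> are approximated by functions with values in \<open>[0, 1]\<close>, then the errors add up in the
  product; clipping to \<open>[0, 1]\<close> only improves the approximation of an indicator.\<close>

lemma L1_approximable_rectangle:
  assumes A [measurable]: "A \<in> sets unit_interval" and B [measurable]: "B \<in> sets unit_interval"
  shows "L1_approximable unit_square (\<lambda>n. range (step n)) (indicator (A \<times> B))"
  unfolding L1_approximable_def
proof (intro allI impI)
  fix e :: real assume "0 < e"
  then have e: "0 < e / 2" by simp
  show "\<forall>\<^sub>F n in sequentially. \<exists>s\<in>range (step n). integrable unit_square s \<and>
      (\<integral>z. \<bar>indicator (A \<times> B) z - s z\<bar> \<partial>unit_square) < e"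
    using L1_approximable_line[OF A, unfolded L1_approximable_def, rule_format, OF e]
      L1_approximable_line[OF B, unfolded L1_approximable_def, rule_format, OF e] eventually_ge_at_top[of 1]
  proof eventually_elim
    case (elim n)
    then obtain a b where a: "integrable unit_interval (step_line n a)"
        "(\<integral>x. \<bar>indicator A x - step_line n a x\<bar> \<partial>unit_interval) < e / 2"
      and b: "integrable unit_interval (step_line n b)"
        "(\<integral>x. \<bar>indicator B x - step_line n b x\<bar> \<partial>unit_interval) < e / 2" by auto
    define c where "c = (\<lambda>u. max 0 (min 1 (a u)))"
    define d where "d = (\<lambda>u. max 0 (min 1 (b u)))"
    let ?s = "step n (\<lambda>u v. c u * d v)"
    have intA: "integrable unit_interval (indicator A :: _ \<Rightarrow> real)" "integrable unit_interval (indicator B :: _ \<Rightarrow> real)"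
      by (auto intro!: unit_interval.integrable_const_bound[where B = 1] simp: indicator_def)
    have kA: "integrable unit_square (\<lambda>z. \<bar>indicator A (fst z) - step_line n a (fst z)\<bar>)"
      "integrable unit_square (\<lambda>z. \<bar>indicator B (snd z) - step_line n b (snd z)\<bar>)"
      and iA: "(\<integral>z. \<bar>indicator A (fst z) - step_line n a (fst z)\<bar> \<partial>unit_square)
        = (\<integral>x. \<bar>indicator A x - step_line n a x\<bar> \<partial>unit_interval)"
      and iB: "(\<integral>z. \<bar>indicator B (snd z) - step_line n b (snd z)\<bar> \<partial>unit_square)
        = (\<integral>x. \<bar>indicator B x - step_line n b x\<bar> \<partial>unit_interval)"
    proof -
      have bnd: "\<bar>step_line n a x\<bar> \<le> Max ((\<lambda>u. \<bar>a u\<bar>) ` {1..n})" if "x \<in> {0..1}" for a x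
        unfolding step_line_def using cell_in_range[OF elim(3) that] by (intro Max_ge) auto
      have ind: "\<bar>indicator X x\<bar> \<le> (1 :: real)" for X and x :: real by (simp add: indicator_def)
      have kk: "bounded_kernel (\<lambda>z. indicator A (fst z))" "bounded_kernel (\<lambda>z. indicator B (snd z))"
        "bounded_kernel (\<lambda>z. step_line n a (fst z))" "bounded_kernel (\<lambda>z. step_line n b (snd z))"
        by (rule kernel_fst[OF _ ind] kernel_snd[OF _ ind] kernel_fst[OF _ bnd] kernel_snd[OF _ bnd];
            simp add: A B)+
      have k: "bounded_kernel (\<lambda>z. \<bar>indicator A (fst z) - step_line n a (fst z)\<bar>)"
        "bounded_kernel (\<lambda>z. \<bar>indicator B (snd z) - step_line n b (snd z)\<bar>)"
        using kk by (auto intro: kernel_abs kernel_diff)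
      show i: "integrable unit_square (\<lambda>z. \<bar>indicator A (fst z) - step_line n a (fst z)\<bar>)"
        "integrable unit_square (\<lambda>z. \<bar>indicator B (snd z) - step_line n b (snd z)\<bar>)"
        using k by (auto intro: kernel_integrable)
      show "(\<integral>z. \<bar>indicator A (fst z) - step_line n a (fst z)\<bar> \<partial>unit_square)
        = (\<integral>x. \<bar>indicator A x - step_line n a x\<bar> \<partial>unit_interval)"
        by (subst unit_square.integral_fst'[OF i(1), symmetric]) simp
      show "(\<integral>z. \<bar>indicator B (snd z) - step_line n b (snd z)\<bar> \<partial>unit_square)
        = (\<integral>x. \<bar>indicator B x - step_line n b x\<bar> \<partial>unit_interval)"
        by (subst unit_square.integral_fst'[OF i(2), symmetric]) simp
    qed
    have "(\<integral>z. \<bar>indicator (A \<times> B) z - ?s z\<bar> \<partial>unit_square)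
      \<le> (\<integral>z. \<bar>indicator A (fst z) - step_line n a (fst z)\<bar> + \<bar>indicator B (snd z) - step_line n b (snd z)\<bar> \<partial>unit_square)"
    proof (rule integral_mono)
      have "bounded_kernel (indicator (A \<times> B) :: _ \<Rightarrow> real)" by (rule kernelI[where B = 1]) (auto simp: indicator_def)
      then show "integrable unit_square (\<lambda>z. \<bar>indicator (A \<times> B) z - ?s z\<bar>)"
        using elim(3) by (intro kernel_integrable kernel_abs kernel_diff kernel_step)
      fix z
      have *: "\<bar>p * q - c' * d'\<bar> \<le> \<bar>p - c'\<bar> + \<bar>q - d'\<bar>"
        if "p \<in> {0, 1}" "q \<in> {0, 1}" "c' \<in> {0..1}" "d' \<in> {0..1}" for p q c' d' :: real
      proof -
        have "p * q - c' * d' = (p - c') * q + c' * (q - d')" by (simp add: algebra_simps)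
        also have "\<bar>\<dots>\<bar> \<le> \<bar>p - c'\<bar> * \<bar>q\<bar> + \<bar>c'\<bar> * \<bar>q - d'\<bar>" by (metis abs_mult abs_triangle_ineq)
        also have "\<dots> \<le> \<bar>p - c'\<bar> + \<bar>q - d'\<bar>" using that by (intro add_mono mult_left_le mult_left_le_one_le) auto
        finally show ?thesis .
      qed
      define p q :: real where "p = indicator A (fst z)" and "q = indicator B (snd z)"
      define r s where "r = cell n (fst z)" and "s = cell n (snd z)"
      have pq: "p \<in> {0, 1}" "q \<in> {0, 1}" by (auto simp: p_def q_def indicator_def)
      have "\<bar>p * q - c r * d s\<bar> \<le> \<bar>p - c r\<bar> + \<bar>q - d s\<bar>"
        using pq by (intro *) (auto simp: c_def d_def)
      also have "\<bar>p - c r\<bar> \<le> \<bar>p - a r\<bar>" using pq by (auto simp: c_def)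
      also have "\<bar>q - d s\<bar> \<le> \<bar>q - b s\<bar>" using pq by (auto simp: d_def)
      finally show "\<bar>indicator (A \<times> B) z - ?s z\<bar> \<le>
          \<bar>indicator A (fst z) - step_line n a (fst z)\<bar> + \<bar>indicator B (snd z) - step_line n b (snd z)\<bar>"
        unfolding p_def q_def r_def s_def by (cases z) (simp add: step_def step_line_def indicator_times)
    qed (use kA in auto)
    also have "\<dots> < e"
      using a b by (subst Bochner_Integration.integral_add[OF kA]) (simp add: iA iB)
    finally show ?case using kernel_integrable[OF kernel_step[OF elim(3)]] by blast
  qed
qed

lemma L1_approximable_square:
  assumes "integrable unit_square f"
  shows "L1_approximable unit_square (\<lambda>n. range (step n)) f"
proof -
  have V: "(\<lambda>x. s x + c * t x) \<in> range (step n)" if "s \<in> range (step n)" "t \<in> range (step n)" for n s t c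
  proof -
    from that obtain a b where "s = step n a" "t = step n b" by auto
    then have "(\<lambda>x. s x + c * t x) = step n (\<lambda>u v. a u v + c * b u v)" by (auto simp: step_def)
    then show ?thesis by auto
  qed
  have ind: "L1_approximable unit_square (\<lambda>n. range (step n)) (indicator A)" if "A \<in> sets unit_square" for A
  proof (rule unit_square.L1_approximable_indicator
      [where G = "{a \<times> b |a b. a \<in> sets unit_interval \<and> b \<in> sets unit_interval}" and \<Omega> = "{0..1} \<times> {0..1}"])
    have sets: "sigma_sets ({0..1} \<times> {0..1}) {a \<times> b |a b. a \<in> sets unit_interval \<and> b \<in> sets unit_interval}
        = sets unit_square" using sets_pair_measure[of unit_interval unit_interval] by simp
    show "A \<in> sigma_sets ({0..1} \<times> {0..1}) {a \<times> b |a b. a \<in> sets unit_interval \<and> b \<in> sets unit_interval}"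
      unfolding sets by fact
    show "indicator A \<in> borel_measurable unit_square"
      if "A \<in> sigma_sets ({0..1} \<times> {0..1}) {a \<times> b |a b. a \<in> sets unit_interval \<and> b \<in> sets unit_interval}" for A
      using that unfolding sets by auto
    show "{a \<times> b |a b. a \<in> sets unit_interval \<and> b \<in> sets unit_interval} \<subseteq> Pow ({0..1} \<times> {0..1})"
      using sets.sets_into_space[of _ unit_interval] by fastforce
    show "(\<lambda>x. 1) \<in> range (step n)" for n
    proof -
      have "(\<lambda>x. 1) = step n (\<lambda>u v. 1)" by (auto simp: step_def)
      then show ?thesis by auto
    qed
  qed (auto intro: Int_stable_pair_measure_generator V L1_approximable_rectangle)
  show ?thesis using assms
  proof (induction rule: integrable_induct)
    case (base A c)
    have i: "integrable unit_square (indicator A :: _ \<Rightarrow> real)"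
      using base by (intro integrable_real_indicator) auto
    have "L1_approximable unit_square (\<lambda>n. range (step n)) (\<lambda>z. indicator A z + (c - 1) * indicator A z)"
      by (intro L1_approximable_add_scaled i ind base V)
    then show ?case by (simp add: algebra_simps)
  next
    case (add f g)
    then have "L1_approximable unit_square (\<lambda>n. range (step n)) (\<lambda>z. f z + 1 * g z)"
      by (intro L1_approximable_add_scaled V)
    then show ?case by simp
  next
    case (lim f s)
    show ?case
    proof (rule L1_approximable_limit[where s = s and w = "\<lambda>z. 2 * \<bar>f z\<bar>"])
      show "integrable unit_square (\<lambda>z. 2 * \<bar>f z\<bar>)"
        by (intro integrable_mult_right integrable_abs lim)
    qed (rule lim[unfolded real_norm_def]; assumption)+
  qed
qed

text \<open>The approximation is first symmetrized, which does not move it away from a symmetric function,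
  and then clipped to \<open>[\<kappa>, 1 - \<kappa>]\<close>, which costs at most \<open>\<kappa>\<close>.\<close>

lemma graphon_step_approximation:
  assumes g: "graphon g" and \<kappa>: "0 \<le> \<kappa>" "\<kappa> \<le> 1 / 2" and e: "0 < e"
  shows "\<forall>\<^sub>F n in sequentially. \<exists>A. (\<forall>u v. A u v = A v u \<and> A u v \<in> {\<kappa>..1 - \<kappa>}) \<and>
    (\<integral>z. \<bar>g z - step n A z\<bar> \<partial>unit_square) < \<kappa> + e"
proof -
  have gk: "bounded_kernel g" by (rule kernel_graphon[OF g])
  have gm: "g \<in> borel_measurable unit_square" using gk by measurable
  show ?thesis
    using L1_approximable_square[OF kernel_integrable[OF gk], unfolded L1_approximable_def, rule_format, OF e]
      eventually_ge_at_top[of 1]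
  proof eventually_elim
    case (elim n)
    then obtain B where B: "(\<integral>z. \<bar>g z - step n B z\<bar> \<partial>unit_square) < e" by auto
    define A where "A = (\<lambda>u v. max \<kappa> (min (1 - \<kappa>) ((B u v + B v u) / 2)))"
    define F where "F = (\<lambda>z. \<bar>g z - step n B z\<bar>)"
    have kF: "bounded_kernel F"
      unfolding F_def using gk elim(2) by (intro kernel_abs kernel_diff kernel_step)
    have kF': "bounded_kernel (\<lambda>(x, y). F (y, x))"
    proof -
      have "F \<in> borel_measurable unit_square" using kF by measurable
      then have "(\<lambda>(x, y). F (y, x)) \<in> borel_measurable unit_square" by (rule measurable_pair_swap)
      then show ?thesis using kF unfolding bounded_kernel_def by fastforce
    qed
    have swap: "(\<integral>(x, y). F (y, x) \<partial>unit_square) = (\<integral>z. F z \<partial>unit_square)"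
      by (rule unit_square.integral_product_swap[OF kernel_measurable[OF kF]])
    have "(\<integral>z. \<bar>g z - step n A z\<bar> \<partial>unit_square)
        \<le> (\<integral>z. \<kappa> + (1 / 2) * (F z + (case z of (x, y) \<Rightarrow> F (y, x))) \<partial>unit_square)"
    proof (rule integral_mono)
      show "integrable unit_square (\<lambda>z. \<bar>g z - step n A z\<bar>)"
        using gk elim(2) by (intro kernel_integrable kernel_abs kernel_diff kernel_step)
      show "integrable unit_square (\<lambda>z. \<kappa> + (1 / 2) * (F z + (case z of (x, y) \<Rightarrow> F (y, x))))"
        using kF kF' by (intro kernel_integrable kernel_add kernel_mult kernel_const)
      fix z assume "z \<in> space unit_square"
      then obtain x y where z: "z = (x, y)" "x \<in> {0..1}" "y \<in> {0..1}" by auto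
      define a b where "a = B (cell n x) (cell n y)" and "b = B (cell n y) (cell n x)"
      have gz: "g (y, x) = g (x, y)" "0 \<le> g (x, y)" "g (x, y) \<le> 1" using g z by (auto simp: graphon_def)
      have "\<bar>g (x, y) - max \<kappa> (min (1 - \<kappa>) ((a + b) / 2))\<bar> \<le> \<kappa> + \<bar>g (x, y) - (a + b) / 2\<bar>"
        using gz \<kappa> by linarith
      also have "\<bar>g (x, y) - (a + b) / 2\<bar> \<le> (1 / 2) * (\<bar>g (x, y) - a\<bar> + \<bar>g (x, y) - b\<bar>)"
        by (simp add: abs_if field_simps)
      finally show "\<bar>g z - step n A z\<bar> \<le> \<kappa> + (1 / 2) * (F z + (case z of (x, y) \<Rightarrow> F (y, x)))"
        using z gz by (simp add: A_def F_def step_def a_def b_def)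
    qed
    also have "\<dots> = \<kappa> + (1 / 2) * ((\<integral>z. F z \<partial>unit_square) + (\<integral>(x, y). F (y, x) \<partial>unit_square))"
      using kernel_integrable[OF kF] kernel_integrable[OF kF']
      by (subst Bochner_Integration.integral_add) auto
    also have "\<dots> < \<kappa> + e" using B unfolding swap by (simp add: F_def)
    finally have "(\<integral>z. \<bar>g z - step n A z\<bar> \<partial>unit_square) < \<kappa> + e" .
    moreover have "A u v = A v u \<and> A u v \<in> {\<kappa>..1 - \<kappa>}" for u v
      using \<kappa> by (auto simp: A_def add.commute)
    ultimately show ?case by blast
  qed
qed

section \<open>Finite graphs as graphons\<close>

definition adjacency :: "sgraph \<Rightarrow> nat \<Rightarrow> nat \<Rightarrow> real" where
  "adjacency G u v = of_bool ({u, v} \<in> snd G)"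

lemma adjacency_commute: "adjacency G u v = adjacency G v u"
  by (simp add: adjacency_def insert_commute)

lemma adjacency_diag: "simple_graph G \<Longrightarrow> adjacency G u u = 0"
  by (auto simp: adjacency_def simple_graph_def)

lemma adjacency_01: "adjacency G u v \<in> {0..1}"
  by (simp add: adjacency_def)

lemma measurable_checkerboard: "checkerboard G \<in> borel_measurable unit_square"
proof -
  have "checkerboard G \<in> borel_measurable (borel \<Otimes>\<^sub>M borel)"
    unfolding checkerboard_def by measurable
  then have m: "checkerboard G \<in> borel_measurable (lborel \<Otimes>\<^sub>M lborel)" by simp
  have id: "(\<lambda>x. x) \<in> unit_interval \<rightarrow>\<^sub>M lborel" by (rule measurable_restrict_space1) simp
  have "(\<lambda>z. (fst z, snd z)) \<in> unit_square \<rightarrow>\<^sub>M lborel \<Otimes>\<^sub>M lborel"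
    by (intro measurable_Pair measurable_compose[OF measurable_fst id] measurable_compose[OF measurable_snd id])
  from measurable_compose[OF this m] show ?thesis by simp
qed

lemma graphon_checkerboard: "graphon (checkerboard G)"
proof -
  have "checkerboard G (x, y) = checkerboard G (y, x)" for x y
  proof -
    have "{i, j} \<in> snd G \<longleftrightarrow> {j, i} \<in> snd G" for i j by (simp add: insert_commute)
    then show ?thesis unfolding checkerboard_def by (simp only: case_prod_conv) metis
  qed
  moreover have "checkerboard G z \<in> {0..1}" for z
    by (auto simp: checkerboard_def split: prod.split)
  ultimately show ?thesis using measurable_checkerboard[of G] unfolding graphon_def by blast
qed

lemma AE_not_grid: "AE x in unit_interval. \<forall>i\<in>{0..n}. x \<noteq> real i / real n"
proof (rule AE_I')
  let ?F = "(\<lambda>i. real i / real n) ` {0..n} \<inter> {0..1}"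
  show "?F \<in> null_sets unit_interval"
    by (subst null_sets_restrict_space) (auto intro: finite_imp_null_set_lborel)
  show "{x \<in> space unit_interval. \<not> (\<forall>i\<in>{0..n}. x \<noteq> real i / real n)} \<subseteq> ?F" by auto
qed

lemma AE_unit_square_coordinates:
  assumes "{z \<in> space unit_square. Q z} \<in> sets unit_square"
    and ae: "AE x in unit_interval. P x"
    and Q: "\<And>x y. x \<in> {0..1} \<Longrightarrow> P x \<Longrightarrow> y \<in> {0..1} \<Longrightarrow> P y \<Longrightarrow> Q (x, y)"
  shows "AE z in unit_square. Q z"
proof (rule unit_square.AE_pair_measure[OF assms(1)])
  show "AE x in unit_interval. AE y in unit_interval. Q (x, y)"
    using ae AE_space
  proof eventually_elim
    case (elim x)
    show ?case using ae AE_space by eventually_elim (use elim in \<open>auto intro: Q\<close>)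
  qed
qed

text \<open>A checkerboard vanishes on the grid lines and a step function need not, so they agree only outside a null set.\<close>

lemma AE_checkerboard_eq_step:
  assumes G: "simple_graph G" and n: "fst G = n" "n \<ge> 1"
  shows "AE z in unit_square. checkerboard G z = step n (adjacency G) z"
proof (rule AE_unit_square_coordinates[OF _ AE_not_grid[of n]])
  have [measurable]: "checkerboard G \<in> borel_measurable unit_square" by (rule measurable_checkerboard)
  show "{z \<in> space unit_square. checkerboard G z = step n (adjacency G) z} \<in> sets unit_square"
    by measurable
  have open_cell: "x \<in> {(real i - 1) / real n<..<real i / real n} \<longleftrightarrow> i = cell n x"
    if x: "x \<in> {0..1}" "\<forall>i\<in>{0..n}. x \<noteq> real i / real n" and i: "i \<ge> 1" for x i
  proof
    assume "x \<in> {(real i - 1) / real n<..<real i / real n}"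
    then show "i = cell n x" using cell_eqI[of n i x] n i by auto
  next
    assume i: "i = cell n x"
    have "x \<noteq> 0" using bspec[OF x(2), of 0] by simp
    then have "0 < x" using x by auto
    moreover have "cell n x \<in> {0..n}" using cell_in_range[of n x] x n by auto
    ultimately show "x \<in> {(real i - 1) / real n<..<real i / real n}"
      using cell_bounds[of n x] x(2) n unfolding i by fastforce
  qed
  show "checkerboard G (x, y) = step n (adjacency G) (x, y)"
    if x: "x \<in> {0..1}" "\<forall>i\<in>{0..n}. x \<noteq> real i / real n"
      and y: "y \<in> {0..1}" "\<forall>i\<in>{0..n}. y \<noteq> real i / real n" for x y
  proof -
    have ge: "i \<ge> 1 \<and> j \<ge> 1" if "{i, j} \<in> snd G" for i j
      using G that by (auto simp: simple_graph_def)
    have "(\<exists>i j. {i, j} \<in> snd G \<and> x \<in> {(real i - 1) / real n<..<real i / real n} \<and>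
        y \<in> {(real j - 1) / real n<..<real j / real n}) \<longleftrightarrow> {cell n x, cell n y} \<in> snd G"
      using open_cell[OF x] open_cell[OF y] ge by metis
    then show ?thesis unfolding checkerboard_def step_def adjacency_def n(1) by simp
  qed
qed

lemma cut_norm_checkerboard_diff:
  assumes G: "simple_graph G" and n: "fst G = n" "n \<ge> 1"
  shows "cut_norm (\<lambda>z. checkerboard G z - step n W z) = cut_norm (step n (\<lambda>u v. adjacency G u v - W u v))"
proof (rule cut_norm_cong_AE)
  show "(\<lambda>z. checkerboard G z - step n W z) \<in> borel_measurable unit_square"
    using measurable_checkerboard[of G] by measurable
  show "AE z in unit_square. checkerboard G z - step n W z = step n (\<lambda>u v. adjacency G u v - W u v) z"
    using AE_checkerboard_eq_step[OF assms] by eventually_elim (auto simp: step_def)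
qed (rule measurable_step)

section \<open>Relabelling the vertices\<close>

definition half_open_cell :: "nat \<Rightarrow> nat \<Rightarrow> real set" where
  "half_open_cell n u = {(real u - 1) / real n<..real u / real n}"

lemma half_open_cell_mult:
  "n \<ge> 1 \<Longrightarrow> x \<in> half_open_cell n u \<longleftrightarrow> real u - 1 < real n * x \<and> real n * x \<le> real u"
  by (simp add: half_open_cell_def pos_divide_less_eq pos_le_divide_eq mult.commute)

lemma half_open_cell_iff:
  assumes "n \<ge> 1" "u \<in> {1..n}"
  shows "x \<in> half_open_cell n u \<longleftrightarrow> 0 < x \<and> x \<le> 1 \<and> cell n x = u"
proof
  assume x: "x \<in> half_open_cell n u"
  have "0 \<le> (real u - 1) / real n" "real u / real n \<le> 1" using assms by auto
  moreover have "cell n x = u" using x cell_eqI[of n u x] assms unfolding half_open_cell_def by auto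
  ultimately show "0 < x \<and> x \<le> 1 \<and> cell n x = u" using x unfolding half_open_cell_def by force
next
  assume "0 < x \<and> x \<le> 1 \<and> cell n x = u"
  then show "x \<in> half_open_cell n u" using cell_bounds[OF assms(1), of x] by (auto simp: half_open_cell_def)
qed

lemma emeasure_split_cells:
  assumes n: "n \<ge> 1" and X: "X \<in> sets borel" "X \<subseteq> {0..1}"
  shows "emeasure lborel X = (\<Sum>u\<in>{1..n}. emeasure lborel (X \<inter> half_open_cell n u))"
proof -
  have "(\<Sum>u\<in>{1..n}. emeasure lborel (X \<inter> half_open_cell n u)) = emeasure lborel (\<Union>u\<in>{1..n}. X \<inter> half_open_cell n u)"
  proof (rule sum_emeasure)
    show "(\<lambda>u. X \<inter> half_open_cell n u) ` {1..n} \<subseteq> sets lborel"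
      using X by (auto simp: half_open_cell_def)
    show "disjoint_family_on (\<lambda>u. X \<inter> half_open_cell n u) {1..n}"
      using half_open_cell_iff[OF n] by (auto simp: disjoint_family_on_def)
  qed simp
  also have "(\<Union>u\<in>{1..n}. X \<inter> half_open_cell n u) = X - {0}"
  proof (intro set_eqI iffI)
    fix x assume "x \<in> (\<Union>u\<in>{1..n}. X \<inter> half_open_cell n u)"
    then show "x \<in> X - {0}" using half_open_cell_iff[OF n] by auto
  next
    fix x assume x: "x \<in> X - {0}"
    then have "cell n x \<in> {1..n}" "0 < x" "x \<le> 1" using cell_in_range[OF n, of x] X by force+
    then show "x \<in> (\<Union>u\<in>{1..n}. X \<inter> half_open_cell n u)"
      using half_open_cell_iff[OF n, of "cell n x" x] x by blast
  qed
  also have "emeasure lborel (X - {0}) = emeasure lborel X"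
    using X by (intro emeasure_Diff_null_set) (auto intro: finite_imp_null_set_lborel)
  finally show ?thesis by simp
qed

text \<open>The cells are translated according to the permutation. The point \<open>0\<close> does not move with its cell, since the cells
  that are translates of each other are the half-open ones.\<close>

definition relabel :: "nat \<Rightarrow> (nat \<Rightarrow> nat) \<Rightarrow> real \<Rightarrow> real" where
  "relabel n \<pi> x = (if x \<le> 0 then x else x + (real (\<pi> (cell n x)) - real (cell n x)) / real n)"

lemma relabel_in_cell:
  assumes n: "n \<ge> 1" and \<pi>: "\<pi> permutes {1..n}" and x: "0 < x" "x \<le> 1"
  shows "relabel n \<pi> x \<in> half_open_cell n (\<pi> (cell n x))" "0 < relabel n \<pi> x" "relabel n \<pi> x \<le> 1"
    "cell n (relabel n \<pi> x) = \<pi> (cell n x)"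
proof -
  have c: "\<pi> (cell n x) \<in> {1..n}" using cell_in_range[OF n, of x] x permutes_in_image[OF \<pi>] by auto
  show "relabel n \<pi> x \<in> half_open_cell n (\<pi> (cell n x))"
  proof -
    have "x \<in> half_open_cell n (cell n x)" using cell_bounds[OF n, of x] x by (simp add: half_open_cell_def)
    moreover have "real n * relabel n \<pi> x = real n * x + (real (\<pi> (cell n x)) - real (cell n x))"
      using x n by (simp add: relabel_def distrib_left)
    ultimately show ?thesis unfolding half_open_cell_mult[OF n] by linarith
  qed
  then show "0 < relabel n \<pi> x" "relabel n \<pi> x \<le> 1" "cell n (relabel n \<pi> x) = \<pi> (cell n x)"
    using half_open_cell_iff[OF n c, of "relabel n \<pi> x"] by auto
qed

lemma measure_preserving_relabel:
  assumes n: "n \<ge> 1" and \<pi>: "\<pi> permutes {1..n}"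
  shows "measure_preserving (relabel n \<pi>)"
proof -
  have m: "relabel n \<pi> \<in> unit_interval \<rightarrow>\<^sub>M unit_interval"
  proof (rule measurable_restrict_space2)
    show "relabel n \<pi> \<in> space unit_interval \<rightarrow> {0..1}"
    proof
      fix x assume "x \<in> space unit_interval"
      then show "relabel n \<pi> x \<in> {0..1}"
        using relabel_in_cell(2,3)[OF n \<pi>, of x] by (cases "x = 0") (auto simp: relabel_def)
    qed
    have [measurable]: "(\<lambda>x. real (\<pi> (cell n x)) - real (cell n x)) \<in> borel_measurable unit_interval"
      by (rule measurable_compose[OF measurable_cell]) simp
    have [measurable]: "(\<lambda>x. x) \<in> borel_measurable unit_interval" by (rule measurable_restrict_space1) simp
    show "relabel n \<pi> \<in> unit_interval \<rightarrow>\<^sub>M lborel"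
      unfolding relabel_def[abs_def] by measurable
  qed
  moreover have "distr unit_interval unit_interval (relabel n \<pi>) = unit_interval"
  proof (rule measure_eqI)
    fix S assume "S \<in> sets (distr unit_interval unit_interval (relabel n \<pi>))"
    then have S: "S \<in> sets unit_interval" by simp
    then have S': "S \<in> sets borel" "S \<subseteq> {0..1}" by (auto simp: sets_restrict_space)
    define X where "X = relabel n \<pi> -` S \<inter> {0..1}"
    have X: "X \<in> sets unit_interval" using measurable_sets[OF m S] by (simp add: X_def)
    then have X': "X \<in> sets borel" "X \<subseteq> {0..1}" by (auto simp: sets_restrict_space)
    have shift: "emeasure lborel (X \<inter> half_open_cell n u) = emeasure lborel (S \<inter> half_open_cell n (\<pi> u))"
      if u: "u \<in> {1..n}" for u
    proof -
      define d where "d = (real (\<pi> u) - real u) / real n"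
      have \<pi>u: "\<pi> u \<in> {1..n}" using u permutes_in_image[OF \<pi>] by auto
      have hm: "half_open_cell n (\<pi> u) \<in> sets borel" by (simp add: half_open_cell_def)
      have "(d + x \<in> half_open_cell n (\<pi> u)) = (x \<in> half_open_cell n u)" for x
      proof -
        have "real n * (d + x) = real n * x + (real (\<pi> u) - real u)" using n by (simp add: d_def distrib_left)
        then show ?thesis unfolding half_open_cell_mult[OF n] by auto
      qed
      moreover have "relabel n \<pi> x = d + x" if "x \<in> half_open_cell n u" for x
        using that half_open_cell_iff[OF n u, of x] by (auto simp: relabel_def d_def)
      moreover have "x \<in> {0..1}" if "x \<in> half_open_cell n u" for x
        using that half_open_cell_iff[OF n u, of x] by auto
      ultimately have "X \<inter> half_open_cell n u = ((+) d) -` (S \<inter> half_open_cell n (\<pi> u)) \<inter> space lborel"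
        unfolding X_def by auto
      then have "emeasure lborel (X \<inter> half_open_cell n u)
          = emeasure (distr lborel borel ((+) d)) (S \<inter> half_open_cell n (\<pi> u))"
        using S' hm by (subst emeasure_distr) auto
      then show ?thesis by (simp add: lborel_distr_plus)
    qed
    have "emeasure (distr unit_interval unit_interval (relabel n \<pi>)) S = emeasure unit_interval X"
      using emeasure_distr[OF m S] by (simp add: X_def)
    also have "\<dots> = emeasure lborel X" using X' by (intro emeasure_restrict_space) auto
    also have "\<dots> = (\<Sum>u\<in>{1..n}. emeasure lborel (S \<inter> half_open_cell n (\<pi> u)))"
      unfolding emeasure_split_cells[OF n X'] using shift by (intro sum.cong) auto
    also have "\<dots> = (\<Sum>u\<in>{1..n}. emeasure lborel (S \<inter> half_open_cell n u))"
      using sum.permute[OF \<pi>, of "\<lambda>u. emeasure lborel (S \<inter> half_open_cell n u)"] by (simp add: comp_def)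
    also have "\<dots> = emeasure lborel S" by (rule emeasure_split_cells[OF n S', symmetric])
    also have "\<dots> = emeasure unit_interval S" using S' by (intro emeasure_restrict_space[symmetric]) auto
    finally show "emeasure (distr unit_interval unit_interval (relabel n \<pi>)) S = emeasure unit_interval S" .
  qed simp
  ultimately show ?thesis by (simp add: measure_preserving_def)
qed

lemma relabel_in_rearrangements:
  assumes n: "n \<ge> 1" and \<pi>: "\<pi> permutes {1..n}"
  shows "relabel n \<pi> \<in> rearrangements"
proof -
  note \<pi>' = permutes_inv[OF \<pi>]
  have inv: "relabel n \<sigma> (relabel n \<pi> x) = x"
    if x: "x \<in> {0..1}" and \<pi>: "\<pi> permutes {1..n}" and inv: "\<And>u. \<sigma> (\<pi> u) = u" for x \<sigma> \<pi>
  proof (cases "x = 0")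
    case False
    then have x: "0 < x" "x \<le> 1" using that by auto
    note r = relabel_in_cell[OF n \<pi> x]
    have "relabel n \<sigma> (relabel n \<pi> x) = relabel n \<pi> x + (real (cell n x) - real (\<pi> (cell n x))) / real n"
      using r by (simp add: relabel_def[of n \<sigma>] inv)
    also have "\<dots> = x" using x by (simp add: relabel_def diff_divide_distrib)
    finally show ?thesis .
  qed (simp add: relabel_def)
  have "\<forall>x\<in>{0..1}. relabel n (inv \<pi>) (relabel n \<pi> x) = x \<and> relabel n \<pi> (relabel n (inv \<pi>) x) = x"
    using inv[OF _ \<pi>, of _ "inv \<pi>"] inv[OF _ \<pi>', of _ \<pi>] permutes_inverses[OF \<pi>] by blast
  then show ?thesis unfolding rearrangements_def
    using measure_preserving_relabel[OF n \<pi>] measure_preserving_relabel[OF n \<pi>'] by blast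
qed

lemma cut_distance_relabel:
  assumes n: "n \<ge> 1" and \<pi>: "\<pi> permutes {1..n}"
  shows "cut_distance (step n (\<lambda>u v. A (\<pi> u) (\<pi> v))) (step n A) = 0"
proof -
  let ?B = "\<lambda>u v. A (\<pi> u) (\<pi> v)"
  note r = relabel_in_rearrangements[OF n \<pi>]
  note k = kernel_step[OF n, of ?B] kernel_step[OF n, of A]
    kernel_pull[OF measure_preserving_relabel[OF n \<pi>] kernel_step[OF n, of A]]
  have "cut_distance (step n ?B) (step n A) \<le> cut_norm (\<lambda>z. step n ?B z - pull (relabel n \<pi>) (step n A) z)"
    using k r by (intro cut_distance_le)
  also have "\<dots> = cut_norm (\<lambda>z. 0)"
  proof (rule cut_norm_cong_AE)
    show m: "(\<lambda>z. step n ?B z - pull (relabel n \<pi>) (step n A) z) \<in> borel_measurable unit_square"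
      using kernel_diff[OF k(1,3)] by measurable
    have pos: "AE x in unit_interval. x \<noteq> 0"
      using AE_not_grid[of n] by eventually_elim (auto dest: bspec[of _ _ 0])
    show "AE z in unit_square. step n ?B z - pull (relabel n \<pi>) (step n A) z = 0"
    proof (rule AE_unit_square_coordinates[OF _ pos])
      show "{z \<in> space unit_square. step n ?B z - pull (relabel n \<pi>) (step n A) z = 0} \<in> sets unit_square"
        using m by measurable
      show "step n ?B (x, y) - pull (relabel n \<pi>) (step n A) (x, y) = 0"
        if "x \<in> {0..1}" "x \<noteq> 0" "y \<in> {0..1}" "y \<noteq> 0" for x y
        using that relabel_in_cell(4)[OF n \<pi>] by (simp add: step_def pull_def)
    qed
  qed simp
  also have "\<dots> \<le> 0" using cut_norm_le_L1[of "\<lambda>z. 0"] by simp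
  finally show ?thesis using cut_distance_nonneg[OF k(1,2)] by simp
qed

section \<open>Entropy\<close>

lemma xlnx_bounds:
  fixes u :: real
  assumes "u \<in> {0..1}"
  shows "u * ln u \<le> 0" "u - 1 \<le> u * ln u"
proof -
  show "u * ln u \<le> 0" using assms by (cases "u = 0") (auto intro: mult_nonneg_nonpos)
  show "u - 1 \<le> u * ln u"
  proof (cases "u = 0")
    case False
    then have "0 < u" using assms by auto
    then have "ln (1 / u) \<le> 1 / u - 1" by (intro ln_le_minus_one) auto
    then have "u * ln (1 / u) \<le> u * (1 / u - 1)" using \<open>0 < u\<close> by (intro mult_left_mono) auto
    then show ?thesis using \<open>0 < u\<close> by (simp add: ln_div algebra_simps)
  qed simp
qed

lemma binary_entropy_bounds:
  assumes "u \<in> {0..1}"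
  shows "binary_entropy u \<in> {0..1}"
  using xlnx_bounds[OF assms] xlnx_bounds[of "1 - u"] assms by (auto simp: binary_entropy_def)

lemma measurable_binary_entropy [measurable]: "binary_entropy \<in> borel_measurable borel"
  unfolding binary_entropy_def[abs_def] by measurable

lemma continuous_on_binary_entropy: "continuous_on {0..1} binary_entropy"
proof -
  have c: "continuous_on {0..1} (\<lambda>u::real. u * ln u)"
    unfolding continuous_on
  proof
    fix x :: real assume x: "x \<in> {0..1}"
    show "((\<lambda>u. u * ln u) \<longlongrightarrow> x * ln x) (at x within {0..1})"
    proof (cases "x = 0")
      case True
      have "((\<lambda>u::real. u * ln u) \<longlongrightarrow> 0) (at_right 0)" by real_asymp
      then have "((\<lambda>u::real. u * ln u) \<longlongrightarrow> 0) (at 0 within {0..1})"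
        by (rule tendsto_mono[rotated]) (simp add: at_within_Icc_at_right)
      then show ?thesis using True by simp
    qed (use x in \<open>auto intro!: tendsto_intros\<close>)
  qed
  have "continuous_on {0..1} (\<lambda>u::real. (1 - u) * ln (1 - u))"
  proof -
    have "continuous_on {0..1} (\<lambda>u::real. 1 - u)" by (intro continuous_intros)
    from continuous_on_compose2[OF c this] show ?thesis by auto
  qed
  from continuous_on_mult[OF continuous_on_const continuous_on_add[OF c this]]
  show ?thesis unfolding binary_entropy_def[abs_def] .
qed

text \<open>The slope is infinite at \<open>0\<close> and \<open>1\<close>, so a Lipschitz bound needs the additive error. Unlike a modulus of
  continuity, this form can be integrated.\<close>

lemma binary_entropy_almost_Lipschitz:
  assumes "0 < \<eta>"
  obtains C where "C > 0" "\<And>u v. u \<in> {0..1} \<Longrightarrow> v \<in> {0..1} \<Longrightarrow>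
    \<bar>binary_entropy u - binary_entropy v\<bar> \<le> \<eta> + C * \<bar>u - v\<bar>"
proof -
  have "uniformly_continuous_on {0..1} binary_entropy"
    by (intro compact_uniformly_continuous continuous_on_binary_entropy) auto
  then obtain d where d: "d > 0" "\<And>u v. u \<in> {0..1} \<Longrightarrow> v \<in> {0..1} \<Longrightarrow> \<bar>v - u\<bar> < d \<Longrightarrow>
      \<bar>binary_entropy v - binary_entropy u\<bar> < \<eta>"
    unfolding uniformly_continuous_on_def dist_real_def using assms by metis
  have "\<bar>binary_entropy u - binary_entropy v\<bar> \<le> \<eta> + (1 / d) * \<bar>u - v\<bar>"
    if uv: "u \<in> {0..1}" "v \<in> {0..1}" for u v
  proof (cases "\<bar>u - v\<bar> < d")
    case True
    then show ?thesis using d(2)[OF uv(2,1) True] d(1) by (smt (verit) divide_nonneg_nonneg mult_nonneg_nonneg)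
  next
    case False
    then have "1 \<le> (1 / d) * \<bar>u - v\<bar>" using d(1) by (simp add: field_simps)
    moreover have "\<bar>binary_entropy u - binary_entropy v\<bar> \<le> 1"
      using binary_entropy_bounds[OF uv(1)] binary_entropy_bounds[OF uv(2)] by auto
    ultimately show ?thesis using assms by linarith
  qed
  then show thesis using d(1) that[of "1 / d"] by auto
qed

lemma kernel_binary_entropy:
  assumes "graphon g"
  shows "bounded_kernel (\<lambda>z. binary_entropy (g z))"
proof (rule kernelI[where B = 1])
  have [measurable]: "g \<in> borel_measurable unit_square" using assms by (simp add: graphon_def)
  show "(\<lambda>z. binary_entropy (g z)) \<in> borel_measurable unit_square" by measurable
  show "\<bar>binary_entropy (g (x, y))\<bar> \<le> 1" if "x \<in> {0..1}" "y \<in> {0..1}" for x y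
    using binary_entropy_bounds[of "g (x, y)"] assms that by (auto simp: graphon_def)
qed

lemma graphon_entropy_eq:
  assumes "graphon g"
  shows "graphon_entropy g = (\<integral>z. binary_entropy (g z) \<partial>unit_square)"
  unfolding graphon_entropy_def
  using unit_square.integral_fst'[OF kernel_integrable[OF kernel_binary_entropy[OF assms]]] by simp

lemma graphon_entropy_pull:
  assumes "graphon g" "measure_preserving \<phi>"
  shows "graphon_entropy (pull \<phi> g) = graphon_entropy g"
proof -
  have "(\<integral>z. pull \<phi> (\<lambda>z. binary_entropy (g z)) z \<partial>unit_square) = (\<integral>z. binary_entropy (g z) \<partial>unit_square)"
    by (rule integral_pull[OF assms(2) kernel_measurable[OF kernel_binary_entropy[OF assms(1)]]])
  then show ?thesis using assms
    by (simp add: graphon_entropy_eq graphon_pull) (simp add: pull_def case_prod_beta')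
qed

lemma graphon_entropy_step:
  assumes "n \<ge> 1" "graphon (step n A)"
  shows "graphon_entropy (step n A) = (\<Sum>u\<in>{1..n}. \<Sum>v\<in>{1..n}. binary_entropy (A u v)) / (real n)\<^sup>2"
proof -
  have "(\<lambda>z. binary_entropy (step n A z)) = step n (\<lambda>u v. binary_entropy (A u v))"
    by (auto simp: step_def)
  then show ?thesis using graphon_entropy_eq[OF assms(2)] integral_step[OF assms(1)] by simp
qed

lemma graphon_entropy_L1_continuous:
  assumes "0 < \<eta>"
  obtains d where "d > 0" "\<And>f h. graphon f \<Longrightarrow> graphon h \<Longrightarrow> (\<integral>z. \<bar>f z - h z\<bar> \<partial>unit_square) < d \<Longrightarrow>
    \<bar>graphon_entropy f - graphon_entropy h\<bar> < \<eta>"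
proof -
  obtain C where C: "C > 0" "\<And>u v. u \<in> {0..1} \<Longrightarrow> v \<in> {0..1} \<Longrightarrow>
    \<bar>binary_entropy u - binary_entropy v\<bar> \<le> \<eta> / 2 + C * \<bar>u - v\<bar>"
    using binary_entropy_almost_Lipschitz[of "\<eta> / 2"] assms by auto
  have "\<bar>graphon_entropy f - graphon_entropy h\<bar> < \<eta>"
    if f: "graphon f" and h: "graphon h" and less: "(\<integral>z. \<bar>f z - h z\<bar> \<partial>unit_square) < \<eta> / (2 * C)" for f h
  proof -
    have i: "integrable unit_square (\<lambda>z. binary_entropy (f z))" "integrable unit_square (\<lambda>z. binary_entropy (h z))"
      "integrable unit_square (\<lambda>z. \<bar>f z - h z\<bar>)"
      using f h by (auto intro!: kernel_abs kernel_integrable kernel_binary_entropy kernel_diff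
          kernel_graphon[OF f] kernel_graphon[OF h])
    have "\<bar>graphon_entropy f - graphon_entropy h\<bar>
        = \<bar>\<integral>z. binary_entropy (f z) - binary_entropy (h z) \<partial>unit_square\<bar>"
      using i by (simp add: graphon_entropy_eq f h)
    also have "\<dots> \<le> (\<integral>z. \<bar>binary_entropy (f z) - binary_entropy (h z)\<bar> \<partial>unit_square)"
      by (rule integral_abs_bound)
    also have "\<dots> \<le> (\<integral>z. \<eta> / 2 + C * \<bar>f z - h z\<bar> \<partial>unit_square)"
    proof (rule integral_mono)
      fix z assume "z \<in> space unit_square"
      then have "f z \<in> {0..1}" "h z \<in> {0..1}" using f h by (auto simp: graphon_def)
      then show "\<bar>binary_entropy (f z) - binary_entropy (h z)\<bar> \<le> \<eta> / 2 + C * \<bar>f z - h z\<bar>" by (rule C)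
    qed (use i in auto)
    also have "\<dots> = \<eta> / 2 + C * (\<integral>z. \<bar>f z - h z\<bar> \<partial>unit_square)"
      using i by (subst Bochner_Integration.integral_add) auto
    also have "\<dots> < \<eta>"
      using less C(1) by (simp add: field_simps)
    finally show ?thesis .
  qed
  moreover have "0 < \<eta> / (2 * C)" using assms C(1) by simp
  ultimately show thesis using that by blast
qed

definition binary_entropy_slope :: "real \<Rightarrow> real" where
  "binary_entropy_slope v = (ln (1 - v) - ln v) / 2"

text \<open>Gibbs' inequality, that is, \<open>ln x \<le> x - 1\<close> applied to both outcomes.\<close>

lemma binary_entropy_tangent:
  assumes u: "u \<in> {0..1}" and v: "0 < v" "v < 1"
  shows "binary_entropy u \<le> binary_entropy v + binary_entropy_slope v * (u - v)"
proof -
  have gibbs: "u * (ln v - ln u) \<le> v - u" if "0 \<le> u" "0 < v" for u v :: real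
  proof (cases "u = 0")
    case False
    then have "ln (v / u) \<le> v / u - 1" using that by (intro ln_le_minus_one) auto
    then have "u * ln (v / u) \<le> u * (v / u - 1)" using that by (intro mult_left_mono) auto
    then show ?thesis using that False by (simp add: ln_div algebra_simps)
  qed (use that in simp)
  have "u * (ln v - ln u) + (1 - u) * (ln (1 - v) - ln (1 - u)) \<le> 0"
    using gibbs[of u v] gibbs[of "1 - u" "1 - v"] u v by auto
  then show ?thesis
    unfolding binary_entropy_def binary_entropy_slope_def by (simp add: field_simps)
qed

lemma binary_entropy_slope_bound:
  assumes "v \<in> {\<kappa>..1 - \<kappa>}" "0 < \<kappa>"
  shows "\<bar>binary_entropy_slope v\<bar> \<le> - ln \<kappa>"
proof -
  have "ln \<kappa> \<le> ln v" "ln \<kappa> \<le> ln (1 - v)" "ln v \<le> 0" "ln (1 - v) \<le> 0" using assms by auto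
  then show ?thesis unfolding binary_entropy_slope_def by (simp add: abs_if)
qed

text \<open>A tangent of the entropy at a step function \<open>h\<close> near \<open>f\<close> is an upper bound that is linear with
  step function coefficients, hence continuous for the cut norm. Clipping \<open>h\<close> to \<open>[\<kappa>, 1 - \<kappa>]\<close> keeps
  the slopes below \<open>- ln \<kappa>\<close>, and moves \<open>h\<close> by only \<open>O(\<kappa>)\<close> while \<open>\<kappa> ln \<kappa> \<rightarrow> 0\<close>.\<close>

lemma graphon_entropy_cut_norm_upper_semicontinuous:
  assumes f: "graphon f" and \<eta>: "0 < \<eta>"
  obtains \<rho> where "\<rho> > 0"
    "\<And>f'. graphon f' \<Longrightarrow> cut_norm (\<lambda>z. f z - f' z) < \<rho> \<Longrightarrow> graphon_entropy f' < graphon_entropy f + \<eta>"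
proof -
  obtain d where d: "d > 0" "\<And>f h. graphon f \<Longrightarrow> graphon h \<Longrightarrow> (\<integral>z. \<bar>f z - h z\<bar> \<partial>unit_square) < d \<Longrightarrow>
    \<bar>graphon_entropy f - graphon_entropy h\<bar> < \<eta> / 3"
    using graphon_entropy_L1_continuous[of "\<eta> / 3"] \<eta> by auto
  have "((\<lambda>\<kappa>::real. - (2 * \<kappa> * ln \<kappa>)) \<longlongrightarrow> 0) (at_right 0)" by real_asymp
  then have "\<forall>\<^sub>F \<kappa> in at_right 0. - (2 * \<kappa> * ln \<kappa>) < \<eta> / 3"
    using \<eta> by (intro order_tendstoD(2)) auto
  moreover have "\<forall>\<^sub>F \<kappa> in at_right (0::real). \<kappa> < min (1 / 2) (d / 2)"
    using d(1) by (intro eventually_at_rightI[of 0 "min (1 / 2) (d / 2)"]) auto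
  moreover have "\<forall>\<^sub>F \<kappa> in at_right (0::real). 0 < \<kappa>" by (rule eventually_at_right_less)
  ultimately have "\<forall>\<^sub>F \<kappa> in at_right (0::real). - (2 * \<kappa> * ln \<kappa>) < \<eta> / 3 \<and> \<kappa> < min (1 / 2) (d / 2) \<and> 0 < \<kappa>"
    by eventually_elim auto
  then obtain \<kappa> :: real where \<kappa>: "- (2 * \<kappa> * ln \<kappa>) < \<eta> / 3" "\<kappa> < 1 / 2" "\<kappa> < d / 2" "0 < \<kappa>"
    by (metis (mono_tags, lifting) eventually_happens' min_less_iff_conj trivial_limit_at_right_real)
  define C where "C = - ln \<kappa>"
  have C: "0 < C" using \<kappa> by (simp add: C_def)
  have "\<forall>\<^sub>F n in sequentially. (\<exists>A. (\<forall>u v. A u v = A v u \<and> A u v \<in> {\<kappa>..1 - \<kappa>}) \<and>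
    (\<integral>z. \<bar>f z - step n A z\<bar> \<partial>unit_square) < \<kappa> + \<kappa>) \<and> n \<ge> 1"
    using \<kappa> by (intro eventually_conj graphon_step_approximation[OF f] eventually_ge_at_top) auto
  then obtain n A where n: "n \<ge> 1" and A: "\<And>u v. A u v = A v u" "\<And>u v. A u v \<in> {\<kappa>..1 - \<kappa>}"
    and fA: "(\<integral>z. \<bar>f z - step n A z\<bar> \<partial>unit_square) < \<kappa> + \<kappa>"
    unfolding eventually_sequentially by blast
  have A01: "A u v \<in> {0..1}" "0 < A u v" "A u v < 1" for u v using A(2)[of u v] \<kappa> by auto
  have h: "graphon (step n A)" using n A A01 by (intro graphon_step) auto
  define D where "D = step n (\<lambda>u v. binary_entropy_slope (A u v))"
  have kD: "bounded_kernel D" unfolding D_def by (rule kernel_step[OF n])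
  have D: "\<bar>binary_entropy_slope (A u v)\<bar> \<le> C" for u v
    unfolding C_def by (rule binary_entropy_slope_bound[OF A(2) \<kappa>(4)])
  define \<rho> where "\<rho> = \<eta> / (3 * ((real n)\<^sup>2 * C))"
  have \<rho>: "0 < \<rho>" using \<eta> n C by (simp add: \<rho>_def)
  have "graphon_entropy f' < graphon_entropy f + \<eta>"
    if f': "graphon f'" and less: "cut_norm (\<lambda>z. f z - f' z) < \<rho>" for f'
  proof -
    note k = kernel_graphon[OF f] kernel_graphon[OF f'] kernel_graphon[OF h] kD
      kernel_binary_entropy[OF f'] kernel_binary_entropy[OF h]
    have i: "integrable unit_square (\<lambda>z. binary_entropy (f' z))"
       "integrable unit_square (\<lambda>z. binary_entropy (step n A z))"
       "integrable unit_square (\<lambda>z. D z * (f' z - f z))" "integrable unit_square (\<lambda>z. D z * (f z - step n A z))"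
       "integrable unit_square (\<lambda>z. \<bar>D z * (f z - step n A z)\<bar>)" "integrable unit_square (\<lambda>z. C * \<bar>f z - step n A z\<bar>)"
      using k by (auto intro!: kernel_integrable kernel_mult kernel_diff integrable_abs)
    have "graphon_entropy f' \<le> (\<integral>z. binary_entropy (step n A z) + (D z * (f' z - f z) + D z * (f z - step n A z)) \<partial>unit_square)"
      unfolding graphon_entropy_eq[OF f']
    proof (rule integral_mono)
      fix z assume z: "z \<in> space unit_square"
      then have "f' z \<in> {0..1}" using f' by (auto simp: graphon_def)
      moreover have "0 < step n A z" "step n A z < 1" using A01 by (auto simp: step_def split: prod.split)
      ultimately have "binary_entropy (f' z) \<le> binary_entropy (step n A z) + binary_entropy_slope (step n A z) * (f' z - step n A z)"
        by (rule binary_entropy_tangent)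
      also have "binary_entropy_slope (step n A z) = D z" by (simp add: D_def step_def split: prod.split)
      finally show "binary_entropy (f' z) \<le> binary_entropy (step n A z) + (D z * (f' z - f z) + D z * (f z - step n A z))"
        by (simp add: algebra_simps)
    qed (use i in auto)
    also have "\<dots> = graphon_entropy (step n A) + ((\<integral>z. D z * (f' z - f z) \<partial>unit_square) + (\<integral>z. D z * (f z - step n A z) \<partial>unit_square))"
      unfolding graphon_entropy_eq[OF h] using i by simp
    also have "(\<integral>z. D z * (f' z - f z) \<partial>unit_square) \<le> (real n)\<^sup>2 * C * cut_norm (\<lambda>z. f' z - f z)"
      using integral_step_mult_le[OF n kernel_diff[OF k(2,1)], where A = "\<lambda>u v. binary_entropy_slope (A u v)", OF D]
      by (simp add: D_def)
    also have "\<dots> \<le> (real n)\<^sup>2 * C * \<rho>"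
      using less C cut_norm_minus_commute[of f f'] by (intro mult_left_mono) auto
    also have "\<dots> = \<eta> / 3" using n C by (simp add: \<rho>_def)
    also have "(\<integral>z. D z * (f z - step n A z) \<partial>unit_square) \<le> (\<integral>z. C * \<bar>f z - step n A z\<bar> \<partial>unit_square)"
    proof (rule integral_mono)
      fix z
      have "\<bar>D z\<bar> \<le> C" using D by (simp add: D_def step_def split: prod.split)
      then have "\<bar>D z\<bar> * \<bar>f z - step n A z\<bar> \<le> C * \<bar>f z - step n A z\<bar>" by (rule mult_right_mono) simp
      then show "D z * (f z - step n A z) \<le> C * \<bar>f z - step n A z\<bar>"
        by (metis abs_ge_self abs_mult order_trans)
    qed (use i in auto)
    also have "\<dots> \<le> C * (\<kappa> + \<kappa>)" using fA C by simp
    also have "\<dots> < \<eta> / 3" using \<kappa>(1) by (simp add: C_def algebra_simps)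
    also have "graphon_entropy (step n A) \<le> graphon_entropy f + \<eta> / 3"
    proof -
      have "(\<integral>z. \<bar>f z - step n A z\<bar> \<partial>unit_square) < d" using fA \<kappa> by linarith
      from d(2)[OF f h this] show ?thesis by linarith
    qed
    finally show ?thesis by simp
  qed
  then show thesis using \<rho> that by blast
qed

theorem graphon_entropy_upper_semicontinuous:
  assumes f: "graphon f" and \<eta>: "0 < \<eta>"
  obtains \<rho> where "\<rho> > 0"
    "\<And>f'. graphon f' \<Longrightarrow> cut_distance f f' < \<rho> \<Longrightarrow> graphon_entropy f' < graphon_entropy f + \<eta>"
proof -
  obtain \<rho> where \<rho>: "\<rho> > 0"
    "\<And>f'. graphon f' \<Longrightarrow> cut_norm (\<lambda>z. f z - f' z) < \<rho> \<Longrightarrow> graphon_entropy f' < graphon_entropy f + \<eta>"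
    using graphon_entropy_cut_norm_upper_semicontinuous[OF assms] by metis
  have "graphon_entropy f' < graphon_entropy f + \<eta>" if f': "graphon f'" and "cut_distance f f' < \<rho>" for f'
  proof -
    obtain \<phi> where "measure_preserving \<phi>" "cut_norm (\<lambda>z. f z - pull \<phi> f' z) < \<rho>"
      using cut_distance_less[OF \<open>cut_distance f f' < \<rho>\<close>] by blast
    then show ?thesis using \<rho>(2)[of "pull \<phi> f'"] f' by (simp add: graphon_pull graphon_entropy_pull)
  qed
  with \<rho>(1) show thesis using that by blast
qed

lemma graphon_entropy_cong:
  assumes f: "graphon f" and g: "graphon g" and 0: "cut_distance f g = 0"
  shows "graphon_entropy f = graphon_entropy g"
proof -
  have le: "graphon_entropy g \<le> graphon_entropy f" if "graphon f" "graphon g" "cut_distance f g = 0" for f g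
  proof (rule field_le_epsilon)
    fix e :: real assume "0 < e"
    from graphon_entropy_upper_semicontinuous[OF that(1) this] that
    show "graphon_entropy g \<le> graphon_entropy f + e" by (metis less_imp_le)
  qed
  show ?thesis using le[OF f g 0] le[OF g f] 0 cut_distance_commute[of f g] f g by (simp add: kernel_graphon)
qed

section \<open>Weak regularity\<close>

text \<open>A partition of the vertices \<open>1, \<dots>, n\<close> is given by a colouring \<open>c\<close>.\<close>

definition color_class :: "nat \<Rightarrow> (nat \<Rightarrow> nat) \<Rightarrow> nat \<Rightarrow> nat set" where
  "color_class n c p = {u \<in> {1..n}. c u = p}"

definition block_sum :: "nat \<Rightarrow> (nat \<Rightarrow> nat) \<Rightarrow> (nat \<Rightarrow> nat \<Rightarrow> real) \<Rightarrow> nat \<Rightarrow> nat \<Rightarrow> real" where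
  "block_sum n c W p q = (\<Sum>u\<in>color_class n c p. \<Sum>v\<in>color_class n c q. W u v)"

definition block_density :: "nat \<Rightarrow> (nat \<Rightarrow> nat) \<Rightarrow> (nat \<Rightarrow> nat \<Rightarrow> real) \<Rightarrow> nat \<Rightarrow> nat \<Rightarrow> real" where
  "block_density n c W p q =
     block_sum n c W p q / (real (card (color_class n c p)) * real (card (color_class n c q)))"

definition block_average :: "nat \<Rightarrow> (nat \<Rightarrow> nat) \<Rightarrow> (nat \<Rightarrow> nat \<Rightarrow> real) \<Rightarrow> nat \<Rightarrow> nat \<Rightarrow> real" where
  "block_average n c W u v = block_density n c W (c u) (c v)"

definition energy :: "nat \<Rightarrow> (nat \<Rightarrow> nat) \<Rightarrow> (nat \<Rightarrow> nat \<Rightarrow> real) \<Rightarrow> real" where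
  "energy n c W = (\<Sum>u\<in>{1..n}. \<Sum>v\<in>{1..n}. (block_average n c W u v)\<^sup>2)"

lemma finite_color_class [simp]: "finite (color_class n c p)"
  by (simp add: color_class_def)

lemma card_color_class_pos: "u \<in> {1..n} \<Longrightarrow> 0 < card (color_class n c (c u))"
  by (auto simp: card_gt_0_iff color_class_def)

lemma sum_over_blocks:
  "(\<Sum>u\<in>{1..n}. \<Sum>v\<in>{1..n}. F (c u) (c v) * X u v)
    = (\<Sum>p\<in>c ` {1..n}. \<Sum>q\<in>c ` {1..n}. F p q * block_sum n c X p q)"
proof -
  have group: "(\<Sum>u\<in>{1..n}. h u) = (\<Sum>p\<in>c ` {1..n}. \<Sum>u\<in>color_class n c p. h u)" for h :: "nat \<Rightarrow> real"
    unfolding color_class_def by (rule sum.image_gen) simp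
  have "(\<Sum>u\<in>{1..n}. \<Sum>v\<in>{1..n}. F (c u) (c v) * X u v)
      = (\<Sum>p\<in>c ` {1..n}. \<Sum>u\<in>color_class n c p. \<Sum>q\<in>c ` {1..n}. \<Sum>v\<in>color_class n c q. F (c u) (c v) * X u v)"
    by (simp only: group)
  also have "\<dots> = (\<Sum>p\<in>c ` {1..n}. \<Sum>q\<in>c ` {1..n}. \<Sum>u\<in>color_class n c p. \<Sum>v\<in>color_class n c q. F (c u) (c v) * X u v)"
    by (intro sum.cong refl sum.swap)
  also have "\<dots> = (\<Sum>p\<in>c ` {1..n}. \<Sum>q\<in>c ` {1..n}. F p q * block_sum n c X p q)"
    unfolding block_sum_def sum_distrib_left by (intro sum.cong refl) (auto simp: color_class_def)
  finally show ?thesis .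
qed

lemma sum_over_blocks_average:
  "(\<Sum>u\<in>{1..n}. \<Sum>v\<in>{1..n}. F (c u) (c v) * block_average n c W u v)
    = (\<Sum>u\<in>{1..n}. \<Sum>v\<in>{1..n}. F (c u) (c v) * W u v)"
  unfolding sum_over_blocks
proof (intro sum.cong refl arg_cong2[of _ _ _ _ "(*)"])
  fix p q assume "p \<in> c ` {1..n}" "q \<in> c ` {1..n}"
  then have pos: "0 < card (color_class n c p)" "0 < card (color_class n c q)"
    using card_color_class_pos by auto
  have "block_sum n c (block_average n c W) p q
      = (\<Sum>u\<in>color_class n c p. \<Sum>v\<in>color_class n c q. block_density n c W p q)"
    unfolding block_sum_def block_average_def by (intro sum.cong refl) (auto simp: color_class_def)
  also have "\<dots> = block_sum n c W p q" using pos by (auto simp: block_density_def card_gt_0_iff)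
  finally show "block_sum n c (block_average n c W) p q = block_sum n c W p q" .
qed

lemma block_density_bounds:
  assumes "\<And>u v. u \<in> {1..n} \<Longrightarrow> v \<in> {1..n} \<Longrightarrow> W u v \<in> {0..1}"
  shows "block_density n c W p q \<in> {0..1}"
proof -
  have W: "W u v \<in> {0..1}" if "u \<in> color_class n c p" "v \<in> color_class n c q" for u v
    using assms that by (simp add: color_class_def)
  have "0 \<le> block_sum n c W p q"
    unfolding block_sum_def using W by (intro sum_nonneg) auto
  moreover have "block_sum n c W p q \<le> (\<Sum>u\<in>color_class n c p. \<Sum>v\<in>color_class n c q. 1)"
    unfolding block_sum_def using W by (intro sum_mono) auto
  ultimately have "0 \<le> block_sum n c W p q" "block_sum n c W p q \<le> real (card (color_class n c p)) * real (card (color_class n c q))"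
    by simp_all
  moreover have "0 \<le> x / y \<and> x / y \<le> 1" if "0 \<le> x" "x \<le> y" for x y :: real
    using that by (cases "y = 0") auto
  ultimately show ?thesis unfolding block_density_def by simp
qed

lemma block_density_commute:
  assumes "\<And>u v. u \<in> {1..n} \<Longrightarrow> v \<in> {1..n} \<Longrightarrow> W u v = W v u"
  shows "block_density n c W p q = block_density n c W q p"
proof -
  have "block_sum n c W p q = (\<Sum>u\<in>color_class n c p. \<Sum>v\<in>color_class n c q. W v u)"
    unfolding block_sum_def using assms by (intro sum.cong refl) (auto simp: color_class_def)
  also have "\<dots> = block_sum n c W q p" unfolding block_sum_def by (rule sum.swap)
  finally show ?thesis by (simp add: block_density_def mult.commute)
qed

lemma energy_le:
  assumes "\<And>u v. u \<in> {1..n} \<Longrightarrow> v \<in> {1..n} \<Longrightarrow> W u v \<in> {0..1}"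
  shows "energy n c W \<le> (real n)\<^sup>2"
proof -
  have "energy n c W \<le> (\<Sum>u\<in>{1..n}. \<Sum>v\<in>{1..n}. 1)"
    unfolding energy_def block_average_def using block_density_bounds[of n W c, OF assms]
    by (intro sum_mono power_le_one) auto
  then show ?thesis by (simp add: power2_eq_square)
qed

lemma energy_nonneg: "0 \<le> energy n c W"
  unfolding energy_def by (intro sum_nonneg) auto

text \<open>Averaging over a partition is the orthogonal projection to the functions that are constant
  on its blocks, so a refinement increases the energy by the squared distance of the averages.\<close>

lemma energy_refinement:
  assumes c: "\<And>u. c u = r (c' u)"
  shows "(\<Sum>u\<in>{1..n}. \<Sum>v\<in>{1..n}. (block_average n c' W u v - block_average n c W u v)\<^sup>2)
    = energy n c' W - energy n c W"
proof -
  let ?a = "block_average n c W" and ?a' = "block_average n c' W"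
  have "(\<Sum>u\<in>{1..n}. \<Sum>v\<in>{1..n}. ?a u v * ?a' u v) = (\<Sum>u\<in>{1..n}. \<Sum>v\<in>{1..n}. ?a u v * W u v)"
    using sum_over_blocks_average[of "\<lambda>p q. block_density n c W (r p) (r q)" c' n W]
    by (simp add: block_average_def c)
  also have "\<dots> = energy n c W"
    using sum_over_blocks_average[of "\<lambda>p q. block_density n c W p q" c n W]
    by (simp add: block_average_def energy_def power2_eq_square)
  finally have cross: "(\<Sum>u\<in>{1..n}. \<Sum>v\<in>{1..n}. ?a u v * ?a' u v) = energy n c W" .
  have "(\<Sum>u\<in>{1..n}. \<Sum>v\<in>{1..n}. (?a' u v - ?a u v)\<^sup>2)
      = (\<Sum>u\<in>{1..n}. \<Sum>v\<in>{1..n}. (?a' u v)\<^sup>2 + (?a u v)\<^sup>2 - 2 * (?a u v * ?a' u v))"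
    by (intro sum.cong refl) (simp add: power2_eq_square algebra_simps)
  also have "\<dots> = energy n c' W + energy n c W - 2 * energy n c W"
    by (simp only: sum.distrib sum_subtractf sum_distrib_left[symmetric] cross) (simp add: energy_def)
  finally show ?thesis by simp
qed

lemma square_rectangle_sum_le:
  fixes x :: "nat \<Rightarrow> nat \<Rightarrow> real"
  assumes "U \<subseteq> {1..n}" "V \<subseteq> {1..n}"
  shows "(\<Sum>u\<in>U. \<Sum>v\<in>V. x u v)\<^sup>2 \<le> (real n)\<^sup>2 * (\<Sum>u\<in>{1..n}. \<Sum>v\<in>{1..n}. (x u v)\<^sup>2)"
proof -
  have "(\<Sum>u\<in>U. \<Sum>v\<in>V. x u v)\<^sup>2 = (\<Sum>(u, v)\<in>U \<times> V. x u v)\<^sup>2" by (simp add: sum.cartesian_product)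
  also have "\<dots> \<le> (\<Sum>(u, v)\<in>U \<times> V. (x u v)\<^sup>2) * real (card (U \<times> V))"
    using sum_squared_le_sum_of_squares[of "\<lambda>(u, v). x u v" "U \<times> V"] by (simp add: case_prod_beta')
  also have "\<dots> \<le> (\<Sum>(u, v)\<in>{1..n} \<times> {1..n}. (x u v)\<^sup>2) * real (card ({1..n} \<times> {1..n}))"
    using assms by (intro mult_mono sum_mono2 of_nat_mono card_mono) (auto intro!: sum_nonneg)
  finally show ?thesis by (simp add: sum.cartesian_product power2_eq_square mult.commute)
qed

text \<open>Splitting every class along a rectangle \<open>U \<times> V\<close> that maximizes the discrepancy gains its square in
  energy, since \<open>U\<close> and \<open>V\<close> are unions of classes of the refinement. The new colour encodes the old
  one and the membership in \<open>U\<close> and \<open>V\<close>, so that the old colour is its quotient by four.\<close>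

lemma refinement_step:
  "\<exists>c'. (\<forall>u. c u = c' u div 4) \<and>
    (\<forall>U V. U \<subseteq> {1..n} \<longrightarrow> V \<subseteq> {1..n} \<longrightarrow>
      (\<Sum>u\<in>U. \<Sum>v\<in>V. W u v - block_average n c W u v)\<^sup>2 \<le> (real n)\<^sup>2 * (energy n c' W - energy n c W))"
proof -
  define D where "D = (\<lambda>(U, V). (\<Sum>u\<in>U. \<Sum>v\<in>V. W u v - block_average n c W u v)\<^sup>2)"
  define R where "R = Pow {1..n} \<times> Pow {1..n}"
  have "finite (D ` R)" "D ` R \<noteq> {}" by (auto simp: R_def)
  then have "Max (D ` R) \<in> D ` R" by (rule Max_in)
  then obtain U V where UV: "(U, V) \<in> R" "D (U, V) = Max (D ` R)" by auto
  have max: "D UV' \<le> D (U, V)" if "UV' \<in> R" for UV'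
    unfolding UV(2) using that by (intro Max_ge) (auto simp: R_def)
  have sub: "U \<subseteq> {1..n}" "V \<subseteq> {1..n}" using UV by (auto simp: R_def)
  define c' where "c' = (\<lambda>u. 4 * c u + 2 * of_bool (u \<in> U) + of_bool (u \<in> V))"
  have c: "c u = c' u div 4" for u by (auto simp: c'_def)
  have U: "u \<in> U \<longleftrightarrow> c' u mod 4 \<in> {2, 3}" and V: "u \<in> V \<longleftrightarrow> c' u mod 4 \<in> {1, 3}" for u
    unfolding c'_def by (cases "u \<in> U"; cases "u \<in> V"; simp add: mod_simps; presburger)+
  define F where "F = (\<lambda>(p::nat) (q::nat). of_bool (p mod 4 \<in> {2, 3}) * of_bool (q mod 4 \<in> {1, 3}) :: real)"
  have rect: "(\<Sum>u\<in>U. \<Sum>v\<in>V. X u v) = (\<Sum>u\<in>{1..n}. \<Sum>v\<in>{1..n}. F (c' u) (c' v) * X u v)" for X :: "nat \<Rightarrow> nat \<Rightarrow> real"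
  proof -
    have "(\<Sum>u\<in>{1..n}. \<Sum>v\<in>{1..n}. F (c' u) (c' v) * X u v)
        = (\<Sum>u\<in>{1..n}. \<Sum>v\<in>{1..n}. if u \<in> U then if v \<in> V then X u v else 0 else 0)"
      by (intro sum.cong refl) (simp add: F_def U V)
    also have "\<dots> = (\<Sum>u\<in>{1..n}. if u \<in> U then (\<Sum>v\<in>{1..n}. if v \<in> V then X u v else 0) else 0)"
      by (intro sum.cong refl) simp
    also have "\<dots> = (\<Sum>u\<in>{1..n} \<inter> U. \<Sum>v\<in>{1..n} \<inter> V. X u v)"
      by (simp only: sum.inter_restrict finite_atLeastAtMost)
    finally show ?thesis using sub by (simp add: Int_absorb1)
  qed
  have "(\<Sum>u\<in>U. \<Sum>v\<in>V. W u v) = (\<Sum>u\<in>U. \<Sum>v\<in>V. block_average n c' W u v)"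
    unfolding rect by (rule sum_over_blocks_average[symmetric])
  then have "D (U, V) = (\<Sum>u\<in>U. \<Sum>v\<in>V. block_average n c' W u v - block_average n c W u v)\<^sup>2"
    by (simp add: D_def sum_subtractf)
  also have "\<dots> \<le> (real n)\<^sup>2 * (energy n c' W - energy n c W)"
    using square_rectangle_sum_le[OF sub, of "\<lambda>u v. block_average n c' W u v - block_average n c W u v"]
    unfolding energy_refinement[of c "\<lambda>p. p div 4" c', OF c] .
  finally have D: "D (U, V) \<le> (real n)\<^sup>2 * (energy n c' W - energy n c W)" .
  have "(\<Sum>u\<in>U'. \<Sum>v\<in>V'. W u v - block_average n c W u v)\<^sup>2 \<le> (real n)\<^sup>2 * (energy n c' W - energy n c W)"
    if "U' \<subseteq> {1..n}" "V' \<subseteq> {1..n}" for U' V'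
    using max[of "(U', V')"] D that by (simp add: R_def D_def)
  then show ?thesis using c by blast
qed

lemma regularity_sequence:
  obtains c :: "nat \<Rightarrow> nat \<Rightarrow> nat" where
    "\<And>m k u. c m u = c (m + k) u div 4 ^ k" "\<And>m u. c m u < 4 ^ m"
    "\<And>m U V. U \<subseteq> {1..n} \<Longrightarrow> V \<subseteq> {1..n} \<Longrightarrow>
      (\<Sum>u\<in>U. \<Sum>v\<in>V. W u v - block_average n (c m) W u v)\<^sup>2
        \<le> (real n)\<^sup>2 * (energy n (c (Suc m)) W - energy n (c m) W)"
proof -
  define Q where "Q = (\<lambda>c c'. (\<forall>u. c u = c' u div 4) \<and>
    (\<forall>U V. U \<subseteq> {1..n} \<longrightarrow> V \<subseteq> {1..n} \<longrightarrow>
      (\<Sum>u\<in>U. \<Sum>v\<in>V. W u v - block_average n c W u v)\<^sup>2 \<le> (real n)\<^sup>2 * (energy n c' W - energy n c W)))"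
  have "\<exists>c. \<forall>m. (m = 0 \<longrightarrow> c m = (\<lambda>u. 0)) \<and> Q (c m) (c (Suc m))"
  proof (rule dependent_nat_choice)
    show "\<exists>c'. (Suc m = 0 \<longrightarrow> c' = (\<lambda>u. 0)) \<and> Q c c'" for c m
      unfolding Q_def using refinement_step[of c n W] by simp
  qed blast
  then obtain c where c: "\<forall>m. (m = 0 \<longrightarrow> c m = (\<lambda>u. 0)) \<and> Q (c m) (c (Suc m))" by blast
  have c0: "c 0 = (\<lambda>u. 0)" and Q: "Q (c m) (c (Suc m))" for m using c by blast+
  have div: "c m u = c (m + k) u div 4 ^ k" for m k u
  proof (induction k)
    case (Suc k)
    have "c (m + k) u = c (m + Suc k) u div 4" using Q[of "m + k"] by (simp add: Q_def)
    then show ?case using Suc by (simp add: div_mult2_eq)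
  qed simp
  moreover have "c m u < 4 ^ m" for m u
  proof -
    have "c m u div 4 ^ m = 0" using div[of 0 u m] c0 by simp
    then show ?thesis by (simp add: div_eq_0_iff)
  qed
  moreover have "(\<Sum>u\<in>U. \<Sum>v\<in>V. W u v - block_average n (c m) W u v)\<^sup>2
      \<le> (real n)\<^sup>2 * (energy n (c (Suc m)) W - energy n (c m) W)"
    if "U \<subseteq> {1..n}" "V \<subseteq> {1..n}" for m U V
    using Q[of m] that unfolding Q_def by blast
  ultimately show thesis by (rule that)
qed

text \<open>The energies increase by at most \<open>n\<^sup>2\<close> in total, so one of the first \<open>L\<close> increments is at most \<open>n\<^sup>2 / L\<close>.\<close>

lemma weak_regularity:
  assumes W: "\<And>u v. u \<in> {1..n} \<Longrightarrow> v \<in> {1..n} \<Longrightarrow> W u v \<in> {0..1}" and L: "L \<ge> 1"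
  obtains c :: "nat \<Rightarrow> nat" where "\<And>u. c u < 4 ^ L"
    "\<And>U V. U \<subseteq> {1..n} \<Longrightarrow> V \<subseteq> {1..n} \<Longrightarrow>
      (\<Sum>u\<in>U. \<Sum>v\<in>V. W u v - block_average n c W u v)\<^sup>2 \<le> (real n) ^ 4 / real L"
proof -
  obtain c where c: "\<And>m u. c m u < 4 ^ m"
    "\<And>m U V. U \<subseteq> {1..n} \<Longrightarrow> V \<subseteq> {1..n} \<Longrightarrow>
      (\<Sum>u\<in>U. \<Sum>v\<in>V. W u v - block_average n (c m) W u v)\<^sup>2
        \<le> (real n)\<^sup>2 * (energy n (c (Suc m)) W - energy n (c m) W)"
    by (rule regularity_sequence[of n W]) blast
  have "\<exists>m<L. energy n (c (Suc m)) W - energy n (c m) W \<le> (real n)\<^sup>2 / real L"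
  proof (rule ccontr)
    assume "\<not> ?thesis"
    then have "(\<Sum>m<L. (real n)\<^sup>2 / real L) < (\<Sum>m<L. energy n (c (Suc m)) W - energy n (c m) W)"
      using L by (intro sum_strict_mono) (auto simp: not_le lessThan_empty_iff)
    also have "\<dots> = energy n (c L) W - energy n (c 0) W" by (rule sum_lessThan_telescope)
    also have "\<dots> \<le> (real n)\<^sup>2" using energy_le[of n W "c L", OF W] energy_nonneg[of n "c 0" W] by simp
    finally show False using L by simp
  qed
  then obtain m where m: "m < L" "energy n (c (Suc m)) W - energy n (c m) W \<le> (real n)\<^sup>2 / real L" by blast
  have "c m u < 4 ^ L" for u
    using c(1)[of m u] power_increasing[of m L "4::nat"] m(1) by linarith
  moreover have "(\<Sum>u\<in>U. \<Sum>v\<in>V. W u v - block_average n (c m) W u v)\<^sup>2 \<le> (real n) ^ 4 / real L"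
    if "U \<subseteq> {1..n}" "V \<subseteq> {1..n}" for U V
  proof -
    note c(2)[OF that, of m]
    also have "(real n)\<^sup>2 * (energy n (c (Suc m)) W - energy n (c m) W) \<le> (real n)\<^sup>2 * ((real n)\<^sup>2 / real L)"
      by (intro mult_left_mono m(2)) simp
    also have "\<dots> = (real n) ^ 4 / real L" by (simp add: power_add[symmetric])
    finally show ?thesis .
  qed
  ultimately show thesis by (rule that)
qed

section \<open>Compactness of the finite graphs\<close>

text \<open>The step function with the values \<open>D p q\<close> on the rectangles bounded by consecutive terms of \<open>a\<close>.
  Written in this way it depends continuously on \<open>a\<close> and \<open>D\<close> away from the break points. The clipping does not
  change it for an increasing \<open>a\<close>, and it spares a proof that limits of such \<open>a\<close> are increasing.\<close>

definition block_kernel :: "nat \<Rightarrow> (nat \<Rightarrow> real) \<Rightarrow> (nat \<Rightarrow> nat \<Rightarrow> real) \<Rightarrow> real \<times> real \<Rightarrow> real" where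
  "block_kernel K a D = (\<lambda>(x, y). max 0 (min 1 (\<Sum>p<K. \<Sum>q<K. D p q *
     ((of_bool (x \<le> a (Suc p)) - of_bool (x \<le> a p)) * (of_bool (y \<le> a (Suc q)) - of_bool (y \<le> a q))))))"

lemma measurable_block_kernel [measurable]: "block_kernel K a D \<in> borel_measurable unit_square"
proof -
  have [measurable]: "(\<lambda>z. indicator {..b} (fst z) :: real) \<in> borel_measurable unit_square"
    "(\<lambda>z. indicator {..b} (snd z) :: real) \<in> borel_measurable unit_square" for b :: real
  proof -
    have "(indicator {..b} :: real \<Rightarrow> real) \<in> borel_measurable unit_interval" by (rule measurable_restrict_space1) simp
    then show "(\<lambda>z. indicator {..b} (fst z) :: real) \<in> borel_measurable unit_square"
      "(\<lambda>z. indicator {..b} (snd z) :: real) \<in> borel_measurable unit_square" by measurable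
  qed
  have "block_kernel K a D = (\<lambda>z. max 0 (min 1 (\<Sum>p<K. \<Sum>q<K. D p q *
     ((indicator {..a (Suc p)} (fst z) - indicator {..a p} (fst z)) *
      (indicator {..a (Suc q)} (snd z) - indicator {..a q} (snd z))))))"
    by (auto simp: block_kernel_def indicator_def of_bool_def)
  then show ?thesis by simp
qed

lemma block_kernel_01: "block_kernel K a D z \<in> {0..1}"
  by (auto simp: block_kernel_def split: prod.split)

lemma block_kernel_commute:
  assumes "\<And>p q. D p q = D q p"
  shows "block_kernel K a D (x, y) = block_kernel K a D (y, x)"
proof -
  have swap: "(\<Sum>p<K. \<Sum>q<K. D p q * (f p * g q)) = (\<Sum>p<K. \<Sum>q<K. D p q * (g p * f q))" for f g :: "nat \<Rightarrow> real"
    by (subst sum.swap) (simp add: assms mult_ac)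
  show ?thesis
    using swap[of "\<lambda>p. of_bool (x \<le> a (Suc p)) - of_bool (x \<le> a p)" "\<lambda>q. of_bool (y \<le> a (Suc q)) - of_bool (y \<le> a q)"]
    by (simp add: block_kernel_def)
qed

lemma graphon_block_kernel:
  assumes "\<And>p q. D p q = D q p"
  shows "graphon (block_kernel K a D)"
  unfolding graphon_def using measurable_block_kernel block_kernel_01 block_kernel_commute[of D, OF assms] by blast

lemma AE_unit_square_both:
  assumes "{x \<in> space unit_interval. P x} \<in> sets unit_interval" "AE x in unit_interval. P x"
  shows "AE z in unit_square. P (fst z) \<and> P (snd z)"
proof (rule AE_unit_square_coordinates[OF _ assms(2)])
  have "{z \<in> space unit_square. P (fst z) \<and> P (snd z)}
      = {x \<in> space unit_interval. P x} \<times> {x \<in> space unit_interval. P x}" by auto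
  then show "{z \<in> space unit_square. P (fst z) \<and> P (snd z)} \<in> sets unit_square" using assms(1) by simp
qed auto

lemma AE_unit_square_avoid:
  assumes "finite F"
  shows "AE z in unit_square. fst z \<notin> F \<and> snd z \<notin> F"
proof (rule AE_unit_square_both)
  have "F \<in> sets borel" using assms by (rule borel_closed[OF finite_imp_closed])
  then have "{0..1} - F \<in> sets unit_interval" by (simp add: sets_restrict_space_iff)
  moreover have "{x \<in> space unit_interval. x \<notin> F} = {0..1} - F" by auto
  ultimately show "{x \<in> space unit_interval. x \<notin> F} \<in> sets unit_interval" by simp
  show "AE x in unit_interval. x \<notin> F"
  proof (rule AE_I')
    show "F \<inter> {0..1} \<in> null_sets unit_interval"
      using assms by (subst null_sets_restrict_space) (auto intro: finite_imp_null_set_lborel)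
  qed auto
qed

text \<open>The step function \<open>of_bool (x \<le> a)\<close> is continuous in \<open>a\<close> except at \<open>a = x\<close>, and only finitely many lines
  carry such exceptions.\<close>

lemma block_kernel_L1_limit:
  assumes a: "\<And>p. (\<lambda>j. a j p) \<longlonglongrightarrow> a' p" and D: "\<And>p q. (\<lambda>j. D j p q) \<longlonglongrightarrow> D' p q"
  shows "(\<lambda>j. \<integral>z. \<bar>block_kernel K (a j) (D j) z - block_kernel K a' D' z\<bar> \<partial>unit_square) \<longlonglongrightarrow> 0"
proof -
  have ind: "(\<lambda>j. of_bool (x \<le> a j p) :: real) \<longlonglongrightarrow> of_bool (x \<le> a' p)" if "x \<noteq> a' p" for x p
  proof (rule tendsto_eventually)
    show "\<forall>\<^sub>F j in sequentially. (of_bool (x \<le> a j p) :: real) = of_bool (x \<le> a' p)"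
    proof (cases "x < a' p")
      case True
      show ?thesis using order_tendstoD(1)[OF a True] by eventually_elim (use True in auto)
    next
      case False
      then have "a' p < x" using that by simp
      show ?thesis using order_tendstoD(2)[OF a \<open>a' p < x\<close>] by eventually_elim (use \<open>a' p < x\<close> in auto)
    qed
  qed
  have "AE z in unit_square. fst z \<notin> a' ` {..K} \<and> snd z \<notin> a' ` {..K}"
    by (rule AE_unit_square_avoid) simp
  then have "AE z in unit_square. (\<lambda>j. \<bar>block_kernel K (a j) (D j) z - block_kernel K a' D' z\<bar>) \<longlonglongrightarrow> 0"
  proof eventually_elim
    case (elim z)
    then have "(\<lambda>j. block_kernel K (a j) (D j) z) \<longlonglongrightarrow> block_kernel K a' D' z"
      unfolding block_kernel_def case_prod_beta'
      by (intro tendsto_intros tendsto_max tendsto_min tendsto_sum D ind) auto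
    from tendsto_rabs[OF tendsto_diff[OF this tendsto_const[of "block_kernel K a' D' z"]]] show ?case by simp
  qed
  then have "(\<lambda>j. \<integral>z. \<bar>block_kernel K (a j) (D j) z - block_kernel K a' D' z\<bar> \<partial>unit_square) \<longlonglongrightarrow> (\<integral>z. 0 \<partial>unit_square)"
  proof (rule integral_dominated_convergence[where w = "\<lambda>z. 1", rotated 3])
    show "AE z in unit_square. norm \<bar>block_kernel K (a j) (D j) z - block_kernel K a' D' z\<bar> \<le> 1" for j
    proof (rule AE_I2)
      fix z
      show "norm \<bar>block_kernel K (a j) (D j) z - block_kernel K a' D' z\<bar> \<le> 1"
        using block_kernel_01[of K "a j" "D j" z] block_kernel_01[of K a' D' z] by (simp add: abs_le_iff)
    qed
  qed auto
  then show ?thesis by simp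
qed

lemma down_closed_iff:
  assumes S: "S \<subseteq> {1..n}" "\<And>u v. v \<in> S \<Longrightarrow> 1 \<le> u \<Longrightarrow> u \<le> v \<Longrightarrow> u \<in> S" and u: "u \<in> {1..n::nat}"
  shows "u \<in> S \<longleftrightarrow> u \<le> card S"
proof
  have fin: "finite S" using S(1) by (rule finite_subset) simp
  show "u \<le> card S" if "u \<in> S"
  proof -
    have "{1..u} \<subseteq> S" using S(2)[OF that] by auto
    from card_mono[OF fin this] show ?thesis by simp
  qed
  show "u \<in> S" if "u \<le> card S"
  proof (rule ccontr)
    assume "u \<notin> S"
    have "v < u" if "v \<in> S" for v
      using S(2)[OF that, of u] \<open>u \<notin> S\<close> u by force
    then have "S \<subseteq> {1..<u}" using S(1) by auto
    from card_mono[OF _ this] show False using that u by auto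
  qed
qed

text \<open>For an increasing colouring the colours below \<open>p\<close> occupy an initial segment of the vertices.\<close>

lemma block_kernel_eq_step:
  assumes n: "n \<ge> 1" and c: "\<And>u v. u \<in> {1..n} \<Longrightarrow> v \<in> {1..n} \<Longrightarrow> u \<le> v \<Longrightarrow> c u \<le> c v"
    and K: "\<And>u. c u < K" and a: "\<And>p. a p = real (card {u \<in> {1..n}. c u < p}) / real n"
    and D: "\<And>p q. D p q \<in> {0..1}"
  shows "AE z in unit_square. block_kernel K a D z = step n (\<lambda>u v. D (c u) (c v)) z"
proof -
  have break: "x \<le> a p \<longleftrightarrow> c (cell n x) < p" if x: "x \<in> {0..1}" "x \<noteq> 0" for x p
  proof -
    let ?S = "{u \<in> {1..n}. c u < p}"
    have cell: "cell n x \<in> {1..n}" using cell_in_range[OF n x(1)] .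
    define N where "N = card ?S"
    have "x \<le> a p \<longleftrightarrow> real n * x \<le> real N" unfolding a N_def[symmetric] using n by (simp add: field_simps)
    also have "\<dots> \<longleftrightarrow> cell n x \<le> N"
    proof (cases "N \<ge> 1")
      case False
      moreover have "0 < real n * x" using x n by simp
      ultimately show ?thesis using cell by simp
    qed (rule cell_le_iff[symmetric])
    also have "\<dots> \<longleftrightarrow> cell n x \<le> card ?S" by (simp only: N_def)
    also have "\<dots> \<longleftrightarrow> cell n x \<in> ?S"
    proof (rule down_closed_iff[symmetric])
      show "u \<in> ?S" if "v \<in> ?S" "1 \<le> u" "u \<le> v" for u v
        using that c[of u v] by auto
    qed (use cell in auto)
    finally show ?thesis using cell by simp
  qed
  have "AE z in unit_square. fst z \<notin> {0} \<and> snd z \<notin> {0}" by (rule AE_unit_square_avoid) simp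
  then show ?thesis using AE_space
  proof eventually_elim
    case (elim z)
    then obtain x y where z: "z = (x, y)" "x \<in> {0..1}" "x \<noteq> 0" "y \<in> {0..1}" "y \<noteq> 0" by (cases z) auto
    define k l where "k = c (cell n x)" and "l = c (cell n y)"
    have kl: "k < K" "l < K" using K by (auto simp: k_def l_def)
    have "(\<Sum>p<K. \<Sum>q<K. D p q * ((of_bool (x \<le> a (Suc p)) - of_bool (x \<le> a p)) * (of_bool (y \<le> a (Suc q)) - of_bool (y \<le> a q))))
      = (\<Sum>p<K. \<Sum>q<K. if p = k then if q = l then D p q else 0 else 0)"
      unfolding break[OF z(2,3)] break[OF z(4,5)] k_def[symmetric] l_def[symmetric]
      by (intro sum.cong refl) auto
    also have "\<dots> = (\<Sum>p<K. if p = k then (\<Sum>q<K. if q = l then D p q else 0) else 0)"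
      by (intro sum.cong refl) simp
    also have "\<dots> = D k l" using kl by simp
    finally show ?case using D[of k l] by (simp add: block_kernel_def step_def z k_def l_def)
  qed
qed

lemma sorting_permutation:
  fixes c :: "nat \<Rightarrow> nat"
  obtains \<pi> where "\<pi> permutes {1..n}" "\<And>u v. u \<in> {1..n} \<Longrightarrow> v \<in> {1..n} \<Longrightarrow> u \<le> v \<Longrightarrow> c (\<pi> u) \<le> c (\<pi> v)"
proof -
  define xs where "xs = sort_key c [1..<Suc n]"
  have xs: "length xs = n" "distinct xs" "set xs = {1..n}" "sorted (map c xs)"
    by (auto simp: xs_def)
  define \<pi> where "\<pi> = (\<lambda>u. if u \<in> {1..n} then xs ! (u - 1) else u)"
  have "bij_betw \<pi> {1..n} {1..n}"
  proof -
    have "bij_betw (\<lambda>i. xs ! i) {..<n} {1..n}" using xs by (intro bij_betw_nth) auto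
    moreover have "bij_betw (\<lambda>u. u - 1) {1..n} {..<n}"
      by (rule bij_betw_byWitness[where f' = Suc]) auto
    ultimately have "bij_betw ((\<lambda>i. xs ! i) \<circ> (\<lambda>u. u - 1)) {1..n} {1..n}" by (rule bij_betw_trans[rotated])
    then show ?thesis by (rule bij_betw_cong[THEN iffD1, rotated]) (simp add: \<pi>_def)
  qed
  then have "\<pi> permutes {1..n}" by (rule bij_imp_permutes) (auto simp: \<pi>_def)
  moreover have "c (\<pi> u) \<le> c (\<pi> v)" if "u \<in> {1..n}" "v \<in> {1..n}" "u \<le> v" for u v
    using sorted_nth_mono[OF xs(4), of "u - 1" "v - 1"] that xs(1) by (simp add: \<pi>_def)
  ultimately show thesis by (rule that)
qed

text \<open>Sorting the vertices by a fine colour makes the classes of all coarser colours intervals.\<close>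

lemma sorted_regularity:
  assumes n: "n \<ge> 1" and W: "\<And>u v. u \<in> {1..n} \<Longrightarrow> v \<in> {1..n} \<Longrightarrow> W u v = W v u \<and> W u v \<in> {0..1}"
  shows "\<exists>\<pi> a D e. \<pi> permutes {1..n} \<and> (\<forall>m p. a m p \<in> {0..1}) \<and>
    (\<forall>m p q. D m p q \<in> {0..1} \<and> D m p q = D m q p) \<and> (\<forall>m. e m \<in> {0..1}) \<and>
    (\<forall>m\<le>J. cut_norm (\<lambda>z. step n (\<lambda>u v. W (\<pi> u) (\<pi> v)) z - block_kernel (4 ^ m) (a m) (D m) z) \<le> sqrt (e (Suc m) - e m)) \<and>
    (\<forall>m m'. m \<le> m' \<longrightarrow> m' \<le> J \<longrightarrow>
      (\<integral>z. \<bar>block_kernel (4 ^ m) (a m) (D m) z - block_kernel (4 ^ m') (a m') (D m') z\<bar> \<partial>unit_square) \<le> sqrt (e m' - e m))"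
proof -
  obtain c :: "nat \<Rightarrow> nat \<Rightarrow> nat" where c: "\<And>m k u. c m u = c (m + k) u div 4 ^ k" "\<And>m u. c m u < 4 ^ m"
    "\<And>m U V. U \<subseteq> {1..n} \<Longrightarrow> V \<subseteq> {1..n} \<Longrightarrow>
      (\<Sum>u\<in>U. \<Sum>v\<in>V. W u v - block_average n (c m) W u v)\<^sup>2
        \<le> (real n)\<^sup>2 * (energy n (c (Suc m)) W - energy n (c m) W)"
    by (rule regularity_sequence[of n W]) blast
  obtain \<pi> where \<pi>: "\<pi> permutes {1..n}"
    "\<And>u v. u \<in> {1..n} \<Longrightarrow> v \<in> {1..n} \<Longrightarrow> u \<le> v \<Longrightarrow> c J (\<pi> u) \<le> c J (\<pi> v)"
    by (rule sorting_permutation[of n "c J"]) blast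
  define a where "a = (\<lambda>m p. real (card {u \<in> {1..n}. c m (\<pi> u) < p}) / real n)"
  define D where "D = (\<lambda>m. block_density n (c m) W)"
  define e where "e = (\<lambda>m. energy n (c m) W / (real n)\<^sup>2)"
  let ?W = "\<lambda>u v. W (\<pi> u) (\<pi> v)"
  let ?A = "\<lambda>m u v. block_average n (c m) W (\<pi> u) (\<pi> v)"
  have a01: "a m p \<in> {0..1}" for m p
  proof -
    have "card {u \<in> {1..n}. c m (\<pi> u) < p} \<le> card {1..n}" by (intro card_mono) auto
    then show ?thesis using n by (simp add: a_def)
  qed
  have D01: "D m p q \<in> {0..1}" for m p q
    unfolding D_def using W by (intro block_density_bounds) blast
  have e01: "e m \<in> {0..1}" for m
    using energy_le[of n W "c m"] energy_nonneg[of n "c m" W] W n by (auto simp: e_def)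
  have eq: "AE z in unit_square. block_kernel (4 ^ m) (a m) (D m) z = step n (?A m) z" if "m \<le> J" for m
  proof -
    have "c m (\<pi> u) \<le> c m (\<pi> v)" if "u \<in> {1..n}" "v \<in> {1..n}" "u \<le> v" for u v
      using c(1)[of m _ "J - m"] \<open>m \<le> J\<close> \<pi>(2)[OF that] by (simp add: div_le_mono)
    then have "AE z in unit_square. block_kernel (4 ^ m) (a m) (D m) z
        = step n (\<lambda>u v. D m (c m (\<pi> u)) (c m (\<pi> v))) z"
      by (intro block_kernel_eq_step n c(2) D01) (auto simp: a_def)
    then show ?thesis by (simp add: D_def block_average_def)
  qed
  have reindex: "(\<Sum>u\<in>U. \<Sum>v\<in>V. f (\<pi> u) (\<pi> v)) = (\<Sum>u\<in>\<pi> ` U. \<Sum>v\<in>\<pi> ` V. f u v)" for U V and f :: "nat \<Rightarrow> nat \<Rightarrow> real"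
    using permutes_inj_on[OF \<pi>(1)] by (simp add: sum.reindex)
  have img: "\<pi> ` U \<subseteq> {1..n}" if "U \<subseteq> {1..n}" for U
    using that permutes_image[OF \<pi>(1)] by blast
  have e_scale: "(real n)\<^sup>2 * (energy n (c m') W - energy n (c m) W) = (sqrt (e m' - e m) * (real n)\<^sup>2)\<^sup>2"
    if "0 \<le> e m' - e m" for m m'
  proof -
    have E: "energy n (c m) W = e m * (real n)\<^sup>2" for m using n by (simp add: e_def)
    show ?thesis unfolding E using that
      by (simp add: power_mult_distrib) (simp add: power2_eq_square power4_eq_xxxx algebra_simps)
  qed
  have e_mono: "0 \<le> e m' - e m" if "m \<le> m'" for m m'
  proof -
    have "0 \<le> (\<Sum>u\<in>{1..n}. \<Sum>v\<in>{1..n}. (block_average n (c m') W u v - block_average n (c m) W u v)\<^sup>2)"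
      by (intro sum_nonneg) auto
    also have "\<dots> = energy n (c m') W - energy n (c m) W"
      using c(1)[of m _ "m' - m"] that by (intro energy_refinement[where r = "\<lambda>p. p div 4 ^ (m' - m)"]) simp
    finally show ?thesis by (simp add: e_def diff_divide_distrib[symmetric])
  qed
  have cut: "cut_norm (\<lambda>z. step n ?W z - block_kernel (4 ^ m) (a m) (D m) z) \<le> sqrt (e (Suc m) - e m)"
    if m: "m \<le> J" for m
  proof -
    have "cut_norm (\<lambda>z. step n ?W z - block_kernel (4 ^ m) (a m) (D m) z) = cut_norm (step n (\<lambda>u v. ?W u v - ?A m u v))"
      using eq[OF m] by (intro cut_norm_cong_AE) (auto elim!: eventually_mono simp: step_def)
    also have "\<dots> \<le> sqrt (e (Suc m) - e m)"
    proof (rule cut_norm_step_le[OF n])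
      fix U V assume UV: "U \<subseteq> {1..n}" "V \<subseteq> {1..n}"
      have "(\<Sum>u\<in>U. \<Sum>v\<in>V. ?W u v - ?A m u v)\<^sup>2 \<le> (sqrt (e (Suc m) - e m) * (real n)\<^sup>2)\<^sup>2"
        unfolding reindex[of "\<lambda>u v. W u v - block_average n (c m) W u v"]
        using c(3)[OF img[OF UV(1)] img[OF UV(2)], of m] by (simp only: e_scale[OF e_mono[of m "Suc m"]] le_SucI[OF order_refl])
      then show "\<bar>\<Sum>u\<in>U. \<Sum>v\<in>V. ?W u v - ?A m u v\<bar> \<le> sqrt (e (Suc m) - e m) * (real n)\<^sup>2"
        using e_mono[of m "Suc m"] unfolding abs_le_square_iff[symmetric] by simp
    qed
    finally show ?thesis .
  qed
  have L1: "(\<integral>z. \<bar>block_kernel (4 ^ m) (a m) (D m) z - block_kernel (4 ^ m') (a m') (D m') z\<bar> \<partial>unit_square) \<le> sqrt (e m' - e m)"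
    if m: "m \<le> m'" "m' \<le> J" for m m'
  proof -
    let ?d = "\<lambda>u v. \<bar>block_average n (c m) W u v - block_average n (c m') W u v\<bar>"
    have "(\<integral>z. \<bar>block_kernel (4 ^ m) (a m) (D m) z - block_kernel (4 ^ m') (a m') (D m') z\<bar> \<partial>unit_square)
      = (\<integral>z. step n (\<lambda>u v. ?d (\<pi> u) (\<pi> v)) z \<partial>unit_square)"
    proof (rule integral_cong_AE)
      have "m \<le> J" using m by simp
      show "AE z in unit_square. \<bar>block_kernel (4 ^ m) (a m) (D m) z - block_kernel (4 ^ m') (a m') (D m') z\<bar>
          = step n (\<lambda>u v. ?d (\<pi> u) (\<pi> v)) z"
        using eq[OF \<open>m \<le> J\<close>] eq[OF m(2)] by eventually_elim (simp add: step_def case_prod_beta')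
    qed auto
    also have "\<dots> = (\<Sum>u\<in>{1..n}. \<Sum>v\<in>{1..n}. ?d u v) / (real n)\<^sup>2"
      unfolding integral_step[OF n] reindex[of ?d] permutes_image[OF \<pi>(1)] ..
    also have "\<dots> \<le> sqrt (e m' - e m)"
    proof -
      have "(\<Sum>u\<in>{1..n}. \<Sum>v\<in>{1..n}. ?d u v)\<^sup>2 \<le> (real n)\<^sup>2 * (\<Sum>u\<in>{1..n}. \<Sum>v\<in>{1..n}. (?d u v)\<^sup>2)"
        by (intro square_rectangle_sum_le) auto
      also have "(\<Sum>u\<in>{1..n}. \<Sum>v\<in>{1..n}. (?d u v)\<^sup>2) = energy n (c m') W - energy n (c m) W"
      proof -
        have "energy n (c m') W - energy n (c m) W
            = (\<Sum>u\<in>{1..n}. \<Sum>v\<in>{1..n}. (block_average n (c m') W u v - block_average n (c m) W u v)\<^sup>2)"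
          using c(1)[of m _ "m' - m"] m
          by (intro energy_refinement[where r = "\<lambda>p. p div 4 ^ (m' - m)", symmetric]) simp
        also have "\<dots> = (\<Sum>u\<in>{1..n}. \<Sum>v\<in>{1..n}. (?d u v)\<^sup>2)"
          unfolding power2_abs by (intro sum.cong refl power2_commute)
        finally show ?thesis by simp
      qed
      also have "(real n)\<^sup>2 * \<dots> = (sqrt (e m' - e m) * (real n)\<^sup>2)\<^sup>2" by (rule e_scale[OF e_mono[OF m(1)]])
      finally have "(\<Sum>u\<in>{1..n}. \<Sum>v\<in>{1..n}. ?d u v) \<le> sqrt (e m' - e m) * (real n)\<^sup>2"
        by (rule power2_le_imp_le) (use e_mono[OF m(1)] in simp)
      then show ?thesis using n by (simp add: field_simps)
    qed
    finally show ?thesis .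
  qed
  have Dsym: "D m p q = D m q p" for m p q
    unfolding D_def using W by (intro block_density_commute) blast
  have all: "\<forall>m p. a m p \<in> {0..1}" "\<forall>m p q. D m p q \<in> {0..1} \<and> D m p q = D m q p" "\<forall>m. e m \<in> {0..1}"
    using a01 D01 Dsym e01 by blast+
  have bounds: "\<forall>m\<le>J. cut_norm (\<lambda>z. step n ?W z - block_kernel (4 ^ m) (a m) (D m) z) \<le> sqrt (e (Suc m) - e m)"
    "\<forall>m m'. m \<le> m' \<longrightarrow> m' \<le> J \<longrightarrow>
      (\<integral>z. \<bar>block_kernel (4 ^ m) (a m) (D m) z - block_kernel (4 ^ m') (a m') (D m') z\<bar> \<partial>unit_square) \<le> sqrt (e m' - e m)"
    using cut L1 by simp_all
  show ?thesis
    by (rule exI[of _ \<pi>], rule exI[of _ a], rule exI[of _ D], rule exI[of _ e], intro conjI \<pi>(1) all bounds)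
qed

lemma integral_abs_triangle:
  assumes "bounded_kernel f" "bounded_kernel g" "bounded_kernel h"
  shows "(\<integral>z. \<bar>f z - h z\<bar> \<partial>unit_square) \<le> (\<integral>z. \<bar>f z - g z\<bar> \<partial>unit_square) + (\<integral>z. \<bar>g z - h z\<bar> \<partial>unit_square)"
proof -
  have i: "integrable unit_square (\<lambda>z. \<bar>f z - g z\<bar>)" "integrable unit_square (\<lambda>z. \<bar>g z - h z\<bar>)"
    "integrable unit_square (\<lambda>z. \<bar>f z - h z\<bar>)"
    using assms by (auto intro!: kernel_integrable kernel_abs kernel_diff)
  have "(\<integral>z. \<bar>f z - h z\<bar> \<partial>unit_square) \<le> (\<integral>z. \<bar>f z - g z\<bar> + \<bar>g z - h z\<bar> \<partial>unit_square)"
    using i by (intro integral_mono) auto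
  then show ?thesis using i by simp
qed

text \<open>Completeness of \<open>L\<^sup>1\<close>. The pointwise limit of a subsequence exists only almost everywhere; clipping whatever
  \<open>lim\<close> returns elsewhere makes it a graphon everywhere, and the symmetry is inherited term by term.\<close>

lemma graphon_L1_Cauchy_limit:
  fixes g :: "nat \<Rightarrow> real \<times> real \<Rightarrow> real"
  assumes g: "\<And>m. graphon (g m)"
    and Cauchy: "\<And>e. e > 0 \<Longrightarrow> \<exists>N. \<forall>i\<ge>N. \<forall>j\<ge>N. (\<integral>z. \<bar>g i z - g j z\<bar> \<partial>unit_square) < e"
  obtains u s where "graphon u" "strict_mono s" "(\<lambda>i. \<integral>z. \<bar>g (s i) z - u z\<bar> \<partial>unit_square) \<longlonglongrightarrow> 0"
proof -
  have gm [measurable]: "g m \<in> borel_measurable unit_square" for m using g by (auto simp: graphon_def)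
  have g01: "g m z \<in> {0..1}" if "z \<in> space unit_square" for m z
    using g[of m] that by (cases z) (auto simp: graphon_def)
  obtain s where s: "strict_mono s" "AE z in unit_square. Cauchy (\<lambda>i. g (s i) z)"
  proof (rule cauchy_L1_AE_cauchy_subseq[of unit_square g])
    show "integrable unit_square (g m)" for m by (intro kernel_integrable kernel_graphon g)
    show "\<exists>N. \<forall>i\<ge>N. \<forall>j\<ge>N. (\<integral>z. norm (g i z - g j z) \<partial>unit_square) < e" if "e > 0" for e
      using Cauchy[OF that] by simp
  qed blast
  define u where "u = (\<lambda>z. max 0 (min 1 (lim (\<lambda>i. g (s i) z))))"
  have um: "u \<in> borel_measurable unit_square" unfolding u_def by measurable
  have "u (x, y) = u (y, x)" if "x \<in> {0..1}" "y \<in> {0..1}" for x y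
    using g that by (simp add: u_def graphon_def)
  moreover have "u z \<in> {0..1}" for z by (auto simp: u_def)
  ultimately have u: "graphon u" unfolding graphon_def using um by blast
  have "AE z in unit_square. (\<lambda>i. \<bar>g (s i) z - u z\<bar>) \<longlonglongrightarrow> 0"
    using s(2) AE_space
  proof eventually_elim
    case (elim z)
    then have lim: "(\<lambda>i. g (s i) z) \<longlonglongrightarrow> lim (\<lambda>i. g (s i) z)"
      by (simp add: Cauchy_convergent_iff convergent_LIMSEQ_iff)
    then have "lim (\<lambda>i. g (s i) z) \<in> {0..1}"
      by (rule closed_sequentially[rotated 2]) (use g01[OF elim(2)] in simp_all)
    then have "u z = lim (\<lambda>i. g (s i) z)" by (simp add: u_def)
    then show ?case using tendsto_rabs[OF tendsto_diff[OF lim tendsto_const[of "u z"]]] by simp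
  qed
  then have "(\<lambda>i. \<integral>z. \<bar>g (s i) z - u z\<bar> \<partial>unit_square) \<longlonglongrightarrow> (\<integral>z. 0 \<partial>unit_square)"
  proof (rule integral_dominated_convergence[where w = "\<lambda>z. 1", rotated 3])
    show "AE z in unit_square. norm \<bar>g (s i) z - u z\<bar> \<le> 1" for i
    proof (rule AE_I2)
      fix z assume "z \<in> space unit_square"
      then have "g (s i) z \<in> {0..1}" "u z \<in> {0..1}" using g01 by (auto simp: u_def)
      then show "norm \<bar>g (s i) z - u z\<bar> \<le> 1" by (simp add: abs_le_iff)
    qed
  qed (use um in auto)
  then show thesis using u s(1) that by simp
qed

text \<open>After sorting, the averages of the \<open>j\<close>-th graph over its partition of level \<open>m\<close> are described by finitely
  many break points and densities, so along a subsequence they converge for every \<open>m\<close> as \<open>j \<rightarrow> \<infinity>\<close>. The limits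
  form a Cauchy sequence in \<open>m\<close> since the distances are controlled by increments of a bounded increasing
  sequence, the limits of the energies; the same increments control how well level \<open>m\<close> approximates the graphs.\<close>

theorem finite_graphons_precompact:
  assumes n: "\<And>j. n j \<ge> 1"
    and W: "\<And>j u v. u \<in> {1..n j} \<Longrightarrow> v \<in> {1..n j} \<Longrightarrow> W j u v = W j v u \<and> W j u v \<in> {0..1}"
  obtains r u where "strict_mono (r :: nat \<Rightarrow> nat)" "graphon u"
    "(\<lambda>j. cut_distance (step (n (r j)) (W (r j))) u) \<longlonglongrightarrow> 0"
proof -
  define Q where "Q = (\<lambda>j \<pi> a D e. \<pi> permutes {1..n j} \<and> (\<forall>m p. a m p \<in> {0..1}) \<and>
    (\<forall>m p q. D m p q \<in> {0..1} \<and> D m p q = D m q p) \<and> (\<forall>m. e m \<in> {0..1}) \<and>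
    (\<forall>m\<le>j. cut_norm (\<lambda>z. step (n j) (\<lambda>u v. W j (\<pi> u) (\<pi> v)) z - block_kernel (4 ^ m) (a m) (D m) z) \<le> sqrt (e (Suc m) - e m)) \<and>
    (\<forall>m m'. m \<le> m' \<longrightarrow> m' \<le> j \<longrightarrow>
      (\<integral>z. \<bar>block_kernel (4 ^ m) (a m) (D m) z - block_kernel (4 ^ m') (a m') (D m') z\<bar> \<partial>unit_square) \<le> sqrt (e m' - e m)))"
  have "\<exists>\<pi> a D e. Q j \<pi> a D e" for j
    unfolding Q_def by (intro sorted_regularity n W)
  then obtain \<pi> a D e where Q: "\<And>j. Q j (\<pi> j) (a j) (D j) (e j)" by metis
  note q = Q[unfolded Q_def]
  have \<pi>: "\<pi> j permutes {1..n j}" for j using q[of j] by (elim conjE)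
  have a01: "a j m p \<in> {0..1}" for j m p using q[of j] by (elim conjE) (erule spec2)
  have D01: "D j m p q \<in> {0..1}" and Dsym: "D j m p q = D j m q p" for j m p q
    using q[of j] by (elim conjE; blast)+
  have e01: "e j m \<in> {0..1}" for j m using q[of j] by (elim conjE) (erule spec)
  have cut: "cut_norm (\<lambda>z. step (n j) (\<lambda>u v. W j (\<pi> j u) (\<pi> j v)) z
      - block_kernel (4 ^ m) (a j m) (D j m) z) \<le> sqrt (e j (Suc m) - e j m)" if "m \<le> j" for j m
    using q[of j] that by (elim conjE) (drule spec, erule (1) mp)
  have L1: "(\<integral>z. \<bar>block_kernel (4 ^ m) (a j m) (D j m) z - block_kernel (4 ^ m') (a j m') (D j m') z\<bar> \<partial>unit_square)
        \<le> sqrt (e j m' - e j m)" if "m \<le> m'" "m' \<le> j" for j m m'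
    using q[of j] that by (elim conjE) simp
  define T where "T = (\<lambda>j m. block_kernel (4 ^ m) (a j m) (D j m))"
  (* All break points, densities and energies of the j-th graph in one countable family. *)
  define f where "f = (\<lambda>j (i :: nat, m, p, q). if i = 0 then a j m p else if i = 1 then D j m p q else e j m)"
  have f01: "norm (f j x) \<le> 1" for j and x :: "nat \<times> nat \<times> nat \<times> nat"
  proof -
    obtain i m p q where "x = (i, m, p, q)" by (metis surj_pair)
    then show ?thesis using a01[of j m p] D01[of j m p q] e01[of j m] by (simp add: f_def)
  qed
  obtain r where r: "strict_mono r" "\<And>x. \<exists>l. (\<lambda>j. f (r j) x) \<longlonglongrightarrow> l"
  proof (rule function_convergent_subsequence[of "UNIV :: (nat \<times> nat \<times> nat \<times> nat) set" f 1])
    show "norm (f j x) \<le> 1" for j x by (rule f01)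
  qed (blast intro: countableI_type)+
  have "\<exists>l. \<forall>x. (\<lambda>j. f (r j) x) \<longlonglongrightarrow> l x" using r(2) by metis
  then obtain l where l: "\<And>x. (\<lambda>j. f (r j) x) \<longlonglongrightarrow> l x" by blast
  define a' where "a' = (\<lambda>m p. l (0, m, p, 0))"
  define D' where "D' = (\<lambda>m p q. l (1, m, p, q))"
  define e' where "e' = (\<lambda>m. l (2, m, 0, 0))"
  have a': "(\<lambda>j. a (r j) m p) \<longlonglongrightarrow> a' m p" for m p using l[of "(0, m, p, 0)"] by (simp add: f_def a'_def)
  have D': "(\<lambda>j. D (r j) m p q) \<longlonglongrightarrow> D' m p q" for m p q using l[of "(1, m, p, q)"] by (simp add: f_def D'_def)
  have e': "(\<lambda>j. e (r j) m) \<longlonglongrightarrow> e' m" for m using l[of "(2, m, 0, 0)"] by (simp add: f_def e'_def)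
  have D'sym: "D' m p q = D' m q p" for m p q
  proof (rule LIMSEQ_unique[OF D'])
    have "(\<lambda>j. D (r j) m p q) = (\<lambda>j. D (r j) m q p)" by (rule ext) (rule Dsym)
    then show "(\<lambda>j. D (r j) m p q) \<longlonglongrightarrow> D' m q p" using D'[of m q p] by simp
  qed
  define T' where "T' = (\<lambda>m. block_kernel (4 ^ m) (a' m) (D' m))"
  have T: "graphon (T j m)" for j m unfolding T_def by (intro graphon_block_kernel Dsym)
  have T': "graphon (T' m)" for m unfolding T'_def by (intro graphon_block_kernel D'sym)
  have TT': "(\<lambda>j. \<integral>z. \<bar>T (r j) m z - T' m z\<bar> \<partial>unit_square) \<longlonglongrightarrow> 0" for m
    unfolding T_def T'_def by (intro block_kernel_L1_limit a' D')
  have large: "\<forall>\<^sub>F j in sequentially. m \<le> r j" for m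
    using eventually_ge_at_top[of m] by eventually_elim (use seq_suble[OF r(1)] in \<open>auto intro: order_trans\<close>)
  have L1': "(\<integral>z. \<bar>T' m z - T' m' z\<bar> \<partial>unit_square) \<le> sqrt (e' m' - e' m)" if "m \<le> m'" for m m'
  proof (rule tendsto_lowerbound)
    show "(\<lambda>j. (\<integral>z. \<bar>T (r j) m z - T' m z\<bar> \<partial>unit_square) + sqrt (e (r j) m' - e (r j) m)
        + (\<integral>z. \<bar>T (r j) m' z - T' m' z\<bar> \<partial>unit_square)) \<longlonglongrightarrow> sqrt (e' m' - e' m)"
      using tendsto_add[OF tendsto_add[OF TT' tendsto_real_sqrt[OF tendsto_diff[OF e' e']]] TT'] by simp
    show "\<forall>\<^sub>F j in sequentially. (\<integral>z. \<bar>T' m z - T' m' z\<bar> \<partial>unit_square) \<le>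
        (\<integral>z. \<bar>T (r j) m z - T' m z\<bar> \<partial>unit_square) + sqrt (e (r j) m' - e (r j) m)
        + (\<integral>z. \<bar>T (r j) m' z - T' m' z\<bar> \<partial>unit_square)"
      using large[of m']
    proof eventually_elim
      case (elim j)
      note k = kernel_graphon[OF T] kernel_graphon[OF T']
      have "(\<integral>z. \<bar>T' m z - T' m' z\<bar> \<partial>unit_square) \<le> (\<integral>z. \<bar>T' m z - T (r j) m z\<bar> \<partial>unit_square)
          + (\<integral>z. \<bar>T (r j) m z - T' m' z\<bar> \<partial>unit_square)"
        by (intro integral_abs_triangle k)
      also have "(\<integral>z. \<bar>T (r j) m z - T' m' z\<bar> \<partial>unit_square) \<le> (\<integral>z. \<bar>T (r j) m z - T (r j) m' z\<bar> \<partial>unit_square)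
          + (\<integral>z. \<bar>T (r j) m' z - T' m' z\<bar> \<partial>unit_square)"
        by (intro integral_abs_triangle k)
      also have "(\<integral>z. \<bar>T (r j) m z - T (r j) m' z\<bar> \<partial>unit_square) \<le> sqrt (e (r j) m' - e (r j) m)"
        unfolding T_def by (rule L1[OF that elim])
      finally show ?case by (simp add: abs_minus_commute)
    qed
  qed simp
  have inc: "incseq e'"
  proof (rule monoI)
    fix m m' :: nat assume "m \<le> m'"
    have "0 \<le> (\<integral>z. \<bar>T' m z - T' m' z\<bar> \<partial>unit_square)" by (intro integral_nonneg_AE) simp
    also have "\<dots> \<le> sqrt (e' m' - e' m)" by (rule L1'[OF \<open>m \<le> m'\<close>])
    finally show "e' m \<le> e' m'" by simp
  qed
  have bdd: "\<forall>m. e' m \<le> 1"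
    using e01 by (intro allI LIMSEQ_le_const2[OF e']) auto
  obtain E where E: "e' \<longlonglongrightarrow> E" by (rule incseq_convergent[OF inc bdd]) blast
  have "\<exists>N. \<forall>i\<ge>N. \<forall>j\<ge>N. (\<integral>z. \<bar>T' i z - T' j z\<bar> \<partial>unit_square) < \<epsilon>" if "\<epsilon> > 0" for \<epsilon>
  proof -
    have "0 < \<epsilon>\<^sup>2" using that by simp
    from CauchyD[OF LIMSEQ_imp_Cauchy[OF E] this]
    obtain N where N: "\<And>i j. i \<ge> N \<Longrightarrow> j \<ge> N \<Longrightarrow> norm (e' i - e' j) < \<epsilon>\<^sup>2" by blast
    have less: "(\<integral>z. \<bar>T' i z - T' j z\<bar> \<partial>unit_square) < \<epsilon>" if "i \<ge> N" "j \<ge> i" for i j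
    proof -
      have "e' j - e' i < \<epsilon>\<^sup>2" using N[of j i] that by simp
      then have "sqrt (e' j - e' i) < \<epsilon>" using \<open>\<epsilon> > 0\<close> by (intro real_less_lsqrt) auto
      then show ?thesis using L1'[OF that(2)] by simp
    qed
    have "(\<integral>z. \<bar>T' i z - T' j z\<bar> \<partial>unit_square) < \<epsilon>" if "i \<ge> N" "j \<ge> N" for i j
      using less[of i j] less[of j i] that by (cases "i \<le> j") (auto simp: abs_minus_commute)
    then show ?thesis by blast
  qed
  then obtain u s where u: "graphon u" and s: "strict_mono s"
    and us: "(\<lambda>i. \<integral>z. \<bar>T' (s i) z - u z\<bar> \<partial>unit_square) \<longlonglongrightarrow> 0"
    using graphon_L1_Cauchy_limit[of T', OF T'] by blast
  let ?d = "\<lambda>j. cut_distance (step (n (r j)) (W (r j))) u"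
  have bound: "?d j \<le> sqrt (e (r j) (Suc m) - e (r j) m) + (\<integral>z. \<bar>T (r j) m z - T' m z\<bar> \<partial>unit_square)
      + (\<integral>z. \<bar>T' m z - u z\<bar> \<partial>unit_square)" if m: "m \<le> r j" for j m
  proof -
    let ?W = "step (n (r j)) (W (r j))" and ?V = "step (n (r j)) (\<lambda>u v. W (r j) (\<pi> (r j) u) (\<pi> (r j) v))"
    note k = kernel_step[OF n] kernel_graphon[OF T] kernel_graphon[OF T'] kernel_graphon[OF u]
    have "?d j \<le> cut_distance ?W ?V + cut_distance ?V u" by (intro cut_distance_triangle k)
    also have "cut_distance ?W ?V = 0"
      using cut_distance_relabel[OF n \<pi>] cut_distance_commute[of ?V ?W] k by simp
    also have "cut_distance ?V u \<le> cut_norm (\<lambda>z. ?V z - u z)" by (intro cut_distance_le_cut_norm k)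
    also have "\<dots> \<le> cut_norm (\<lambda>z. ?V z - T (r j) m z) + cut_norm (\<lambda>z. T (r j) m z - u z)"
      by (intro cut_norm_triangle k)
    also have "cut_norm (\<lambda>z. T (r j) m z - u z) \<le> (\<integral>z. \<bar>T (r j) m z - u z\<bar> \<partial>unit_square)"
      by (intro cut_norm_le_L1 kernel_diff k)
    also have "\<dots> \<le> (\<integral>z. \<bar>T (r j) m z - T' m z\<bar> \<partial>unit_square) + (\<integral>z. \<bar>T' m z - u z\<bar> \<partial>unit_square)"
      by (intro integral_abs_triangle k)
    also have "cut_norm (\<lambda>z. ?V z - T (r j) m z) \<le> sqrt (e (r j) (Suc m) - e (r j) m)"
      unfolding T_def by (rule cut[OF m])
    finally show ?thesis by simp
  qed
  have "?d \<longlonglongrightarrow> 0"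
  proof (rule LIMSEQ_I)
    fix \<epsilon> :: real assume \<epsilon>: "0 < \<epsilon>"
    have gap: "(\<lambda>m. sqrt (e' (Suc m) - e' m)) \<longlonglongrightarrow> 0"
      using tendsto_real_sqrt[OF tendsto_diff[OF LIMSEQ_Suc[OF E] E]] by simp
    have "\<forall>\<^sub>F i in sequentially. sqrt (e' (Suc (s i)) - e' (s i)) < \<epsilon> / 3"
      using order_tendstoD(2)[OF LIMSEQ_subseq_LIMSEQ[OF gap s], of "\<epsilon> / 3"] \<epsilon> by (simp add: comp_def)
    moreover have "\<forall>\<^sub>F i in sequentially. (\<integral>z. \<bar>T' (s i) z - u z\<bar> \<partial>unit_square) < \<epsilon> / 3"
      using order_tendstoD(2)[OF us, of "\<epsilon> / 3"] \<epsilon> by simp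
    ultimately have "\<forall>\<^sub>F i in sequentially. sqrt (e' (Suc (s i)) - e' (s i)) < \<epsilon> / 3 \<and>
        (\<integral>z. \<bar>T' (s i) z - u z\<bar> \<partial>unit_square) < \<epsilon> / 3" by eventually_elim simp
    then obtain i where i: "sqrt (e' (Suc (s i)) - e' (s i)) < \<epsilon> / 3" "(\<integral>z. \<bar>T' (s i) z - u z\<bar> \<partial>unit_square) < \<epsilon> / 3"
      unfolding eventually_sequentially by blast
    define m where "m = s i"
    have "\<forall>\<^sub>F j in sequentially. sqrt (e (r j) (Suc m) - e (r j) m) < \<epsilon> / 3"
      using i(1) by (intro order_tendstoD(2)[OF tendsto_real_sqrt[OF tendsto_diff[OF e' e']]]) (simp add: m_def)
    moreover have "\<forall>\<^sub>F j in sequentially. (\<integral>z. \<bar>T (r j) m z - T' m z\<bar> \<partial>unit_square) < \<epsilon> / 3"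
      using \<epsilon> by (intro order_tendstoD(2)[OF TT']) simp
    ultimately have "\<forall>\<^sub>F j in sequentially. norm (?d j - 0) < \<epsilon>"
      using large[of m]
    proof eventually_elim
      case (elim j)
      have "0 \<le> ?d j" by (intro cut_distance_nonneg kernel_step n kernel_graphon u)
      then show ?case using bound[OF elim(3)] elim i(2) by (simp add: m_def)
    qed
    then show "\<exists>no. \<forall>j\<ge>no. norm (?d j - 0) < \<epsilon>" by (simp add: eventually_sequentially)
  qed
  then show thesis using r(1) u that by blast
qed

section \<open>Counting graphs from above\<close>

definition vertex_pairs :: "nat \<Rightarrow> nat set set" where
  "vertex_pairs n = {e. e \<subseteq> {1..n} \<and> card e = 2}"

lemma finite_vertex_pairs [simp]: "finite (vertex_pairs n)"
  by (rule finite_subset[of _ "Pow {1..n}"]) (auto simp: vertex_pairs_def)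

lemma labeled_graphs_eq: "labeled_graphs n = Pair n ` Pow (vertex_pairs n)"
proof -
  have "G \<in> labeled_graphs n \<longleftrightarrow> fst G = n \<and> snd G \<subseteq> vertex_pairs n" for G
    by (auto simp: labeled_graphs_def simple_graph_def vertex_pairs_def)
  then show ?thesis by (force simp: image_iff)
qed

lemma finite_labeled_graphs [simp]: "finite (labeled_graphs n)"
  by (simp add: labeled_graphs_eq)

lemma vertex_pairs_Min_Max:
  assumes "e \<in> vertex_pairs n"
  shows "Min e \<in> {1..n}" "Max e \<in> {1..n}" "Min e < Max e" "{Min e, Max e} = e"
proof -
  from assms obtain u v where e: "e = {u, v}" "u \<noteq> v" by (auto simp: vertex_pairs_def card_2_iff)
  with assms have "u \<in> {1..n}" "v \<in> {1..n}" by (auto simp: vertex_pairs_def)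
  then show "Min e \<in> {1..n}" "Max e \<in> {1..n}" "Min e < Max e" "{Min e, Max e} = e"
    using e by (auto simp: min_def max_def)
qed

lemma sum_vertex_pairs:
  "(\<Sum>u\<in>{1..n}. \<Sum>v\<in>{1..n}. F u v) =
    (\<Sum>u\<in>{1..n}. F u u) + (\<Sum>e\<in>vertex_pairs n. F (Min e) (Max e) + F (Max e) (Min e) :: real)"
proof -
  let ?L = "{(u, v). u \<in> {1..n} \<and> v \<in> {1..n} \<and> u < v}"
  have fin: "finite ?L" by (rule finite_subset[of _ "{1..n} \<times> {1..n}"]) auto
  have pairs: "(\<Sum>(u, v)\<in>?L. G u v) = (\<Sum>e\<in>vertex_pairs n. G (Min e) (Max e))" for G :: "nat \<Rightarrow> nat \<Rightarrow> real"
  proof (rule sum.reindex_bij_witness[where i = "\<lambda>e. (Min e, Max e)" and j = "\<lambda>(u, v). {u, v}"])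
    fix e assume e: "e \<in> vertex_pairs n"
    show "(case (Min e, Max e) of (u, v) \<Rightarrow> {u, v}) = e" using vertex_pairs_Min_Max(4)[OF e] by simp
    show "(Min e, Max e) \<in> ?L" using vertex_pairs_Min_Max(1-3)[OF e] by simp
  qed (auto simp: vertex_pairs_def card_2_iff)
  have square: "{1..n} \<times> {1..n} = (\<lambda>u. (u, u)) ` {1..n} \<union> (?L \<union> prod.swap ` ?L)"
  proof (intro set_eqI iffI)
    fix z assume "z \<in> {1..n} \<times> {1..n}"
    then obtain u v where z: "z = (u, v)" "u \<in> {1..n}" "v \<in> {1..n}" by auto
    consider "u = v" | "u < v" | "v < u" by linarith
    then show "z \<in> (\<lambda>u. (u, u)) ` {1..n} \<union> (?L \<union> prod.swap ` ?L)"
    proof cases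
      case 3
      then have "z = prod.swap (v, u)" "(v, u) \<in> ?L" using z by auto
      then show ?thesis by blast
    qed (use z in auto)
  qed auto
  have "(\<Sum>(u, v)\<in>{1..n} \<times> {1..n}. F u v)
      = (\<Sum>(u, v)\<in>(\<lambda>u. (u, u)) ` {1..n}. F u v) + (\<Sum>(u, v)\<in>?L \<union> prod.swap ` ?L. F u v)"
    unfolding square using fin by (intro sum.union_disjoint) auto
  also have "(\<Sum>(u, v)\<in>?L \<union> prod.swap ` ?L. F u v) = (\<Sum>(u, v)\<in>?L. F u v) + (\<Sum>(u, v)\<in>prod.swap ` ?L. F u v)"
    using fin by (intro sum.union_disjoint) auto
  also have "(\<Sum>(u, v)\<in>prod.swap ` ?L. F u v) = (\<Sum>(u, v)\<in>?L. F v u)"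
    by (subst sum.reindex) (auto simp: case_prod_beta' intro: sum.cong)
  also have "(\<Sum>(u, v)\<in>(\<lambda>u. (u, u)) ` {1..n}. F u v) = (\<Sum>u\<in>{1..n}. F u u)"
    by (subst sum.reindex) (auto simp: inj_on_def)
  finally show ?thesis
    unfolding pairs[of F] pairs[of "\<lambda>u v. F v u"] by (simp add: sum.cartesian_product sum.distrib)
qed

text \<open>The law of a random graph with independent edges, \<open>p e\<close> being the probability of the edge \<open>e\<close>.\<close>

definition edge_law :: "'e set \<Rightarrow> ('e \<Rightarrow> real) \<Rightarrow> 'e set \<Rightarrow> real" where
  "edge_law S p E = (\<Prod>e\<in>S. if e \<in> E then p e else 1 - p e)"

lemma sum_Pow_prod_if:
  fixes a b :: "'e \<Rightarrow> real"
  assumes "finite S"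
  shows "(\<Sum>E\<in>Pow S. \<Prod>e\<in>S. if e \<in> E then a e else b e) = (\<Prod>e\<in>S. a e + b e)"
proof -
  have "(\<Prod>e\<in>S. if e \<in> E then a e else b e) = (\<Prod>e\<in>E. a e) * (\<Prod>e\<in>S - E. b e)" if "E \<in> Pow S" for E
  proof -
    have E: "E \<union> (S - E) = S" "finite E" using that assms by (auto intro: finite_subset)
    have "(\<Prod>e\<in>E \<union> (S - E). if e \<in> E then a e else b e)
        = (\<Prod>e\<in>E. if e \<in> E then a e else b e) * (\<Prod>e\<in>S - E. if e \<in> E then a e else b e)"
      using assms E(2) by (intro prod.union_disjoint) auto
    then have "(\<Prod>e\<in>S. if e \<in> E then a e else b e)
        = (\<Prod>e\<in>E. if e \<in> E then a e else b e) * (\<Prod>e\<in>S - E. if e \<in> E then a e else b e)"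
      unfolding E(1) .
    then show ?thesis by simp
  qed
  then show ?thesis by (simp add: prod_add[OF assms])
qed

lemma edge_law_sum: "finite S \<Longrightarrow> (\<Sum>E\<in>Pow S. edge_law S p E) = 1"
  unfolding edge_law_def by (simp add: sum_Pow_prod_if)

lemma edge_law_nonneg: "(\<And>e. e \<in> S \<Longrightarrow> p e \<in> {0..1}) \<Longrightarrow> 0 \<le> edge_law S p E"
  unfolding edge_law_def by (intro prod_nonneg) auto

text \<open>Under the law whose edge probabilities are the block averages of \<open>G\<close> itself, every graph with
  the same block averages has probability at least \<open>exp (- n\<^sup>2 S)\<close>: the logarithm of the probability is a
  linear function of the adjacency matrix with coefficients that are constant on blocks.\<close>

lemma edge_law_block_average:
  assumes G: "G \<in> labeled_graphs n" and n: "n \<ge> 1"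
    and W: "\<And>u v. u \<in> {1..n} \<Longrightarrow> v \<in> {1..n} \<Longrightarrow> block_average n c (adjacency G) u v = W u v"
  shows "exp (- (\<Sum>u\<in>{1..n}. \<Sum>v\<in>{1..n}. binary_entropy (W u v)))
    \<le> edge_law (vertex_pairs n) (\<lambda>e. W (Min e) (Max e)) (snd G)"
proof -
  let ?A = "adjacency G"
  define \<phi> where "\<phi> = (\<lambda>u v. ?A u v * ln (W u v) + (1 - ?A u v) * ln (1 - W u v))"
  have A01: "?A u v = 0 \<or> ?A u v = 1" for u v by (auto simp: adjacency_def)
  have card_pos: "0 < card (color_class n c (c u))" if "u \<in> {1..n}" for u by (rule card_color_class_pos[OF that])
  have sg: "simple_graph G" using G by (simp add: labeled_graphs_def)
  have pos: "0 < W u v" if uv: "u \<in> {1..n}" "v \<in> {1..n}" and 1: "?A u v = 1" for u v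
  proof -
    have "1 \<le> (\<Sum>v'\<in>color_class n c (c v). ?A u v')"
      using member_le_sum[of v "color_class n c (c v)" "?A u"] uv 1 adjacency_01[of G]
      by (auto simp: color_class_def)
    also have "\<dots> \<le> (\<Sum>u'\<in>color_class n c (c u). \<Sum>v'\<in>color_class n c (c v). ?A u' v')"
      using uv adjacency_01[of G]
      by (intro member_le_sum[of u _ "\<lambda>u'. \<Sum>v'\<in>color_class n c (c v). ?A u' v'"])
        (auto simp: color_class_def intro!: sum_nonneg)
    finally have "0 < block_sum n c ?A (c u) (c v)" by (simp add: block_sum_def)
    then show ?thesis using card_pos uv
      unfolding W[OF uv, symmetric] block_average_def block_density_def by simp
  qed
  have less: "W u v < 1" if uv: "u \<in> {1..n}" "v \<in> {1..n}" and 0: "?A u v = 0" for u v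
  proof -
    have "1 \<le> (\<Sum>v'\<in>color_class n c (c v). 1 - ?A u v')"
      using member_le_sum[of v "color_class n c (c v)" "\<lambda>v'. 1 - ?A u v'"] uv 0 adjacency_01[of G]
      by (auto simp: color_class_def)
    also have "\<dots> \<le> (\<Sum>u'\<in>color_class n c (c u). \<Sum>v'\<in>color_class n c (c v). 1 - ?A u' v')"
      using uv adjacency_01[of G]
      by (intro member_le_sum[of u _ "\<lambda>u'. \<Sum>v'\<in>color_class n c (c v). 1 - ?A u' v'"])
        (auto simp: color_class_def intro!: sum_nonneg)
    also have "\<dots> = real (card (color_class n c (c u))) * real (card (color_class n c (c v))) - block_sum n c ?A (c u) (c v)"
      by (simp add: block_sum_def sum_subtractf)
    finally have "block_sum n c ?A (c u) (c v) < real (card (color_class n c (c u))) * real (card (color_class n c (c v)))"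
      by simp
    then show ?thesis using card_pos uv
      unfolding W[OF uv, symmetric] block_average_def block_density_def by simp
  qed
  have "(\<Sum>u\<in>{1..n}. \<Sum>v\<in>{1..n}. \<phi> u v) =
      (\<Sum>u\<in>{1..n}. \<Sum>v\<in>{1..n}. (ln (W u v) - ln (1 - W u v)) * ?A u v) + (\<Sum>u\<in>{1..n}. \<Sum>v\<in>{1..n}. ln (1 - W u v))"
    by (simp only: sum.distrib[symmetric]) (simp add: \<phi>_def algebra_simps)
  also have "(\<Sum>u\<in>{1..n}. \<Sum>v\<in>{1..n}. (ln (W u v) - ln (1 - W u v)) * ?A u v)
      = (\<Sum>u\<in>{1..n}. \<Sum>v\<in>{1..n}. (ln (W u v) - ln (1 - W u v)) * W u v)"
  proof -
    let ?F = "\<lambda>p q. ln (block_density n c ?A p q) - ln (1 - block_density n c ?A p q)"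
    have F: "?F (c u) (c v) = ln (W u v) - ln (1 - W u v)" if "u \<in> {1..n}" "v \<in> {1..n}" for u v
      using W[OF that] by (simp add: block_average_def)
    have "(\<Sum>u\<in>{1..n}. \<Sum>v\<in>{1..n}. (ln (W u v) - ln (1 - W u v)) * ?A u v)
        = (\<Sum>u\<in>{1..n}. \<Sum>v\<in>{1..n}. ?F (c u) (c v) * ?A u v)"
      by (intro sum.cong refl) (simp only: F)
    also have "\<dots> = (\<Sum>u\<in>{1..n}. \<Sum>v\<in>{1..n}. ?F (c u) (c v) * block_average n c ?A u v)"
      by (rule sum_over_blocks_average[symmetric])
    also have "\<dots> = (\<Sum>u\<in>{1..n}. \<Sum>v\<in>{1..n}. (ln (W u v) - ln (1 - W u v)) * W u v)"
      by (intro sum.cong refl) (simp only: F W)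
    finally show ?thesis .
  qed
  also have "\<dots> + (\<Sum>u\<in>{1..n}. \<Sum>v\<in>{1..n}. ln (1 - W u v)) = - 2 * (\<Sum>u\<in>{1..n}. \<Sum>v\<in>{1..n}. binary_entropy (W u v))"
    by (simp only: sum.distrib[symmetric] sum_distrib_left) (simp add: binary_entropy_def algebra_simps)
  finally have total: "(\<Sum>u\<in>{1..n}. \<Sum>v\<in>{1..n}. \<phi> u v) = - 2 * (\<Sum>u\<in>{1..n}. \<Sum>v\<in>{1..n}. binary_entropy (W u v))" .
  have W01: "W u v \<in> {0..1}" if "u \<in> {1..n}" "v \<in> {1..n}" for u v
    unfolding W[OF that, symmetric] block_average_def by (intro block_density_bounds adjacency_01)
  have diag: "(\<Sum>u\<in>{1..n}. \<phi> u u) \<le> 0"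
  proof (rule sum_nonpos)
    fix u assume u: "u \<in> {1..n}"
    then show "\<phi> u u \<le> 0"
      using less[OF u u] W01[OF u u] adjacency_diag[OF sg, of u] by (simp add: \<phi>_def)
  qed
  have sym: "\<phi> u v = \<phi> v u" if "u \<in> {1..n}" "v \<in> {1..n}" for u v
  proof -
    have "W u v = W v u"
      unfolding W[OF that, symmetric] W[OF that(2,1), symmetric] block_average_def
      by (intro block_density_commute adjacency_commute)
    then show ?thesis by (simp add: \<phi>_def adjacency_commute[of G u v])
  qed
  have "(\<Sum>e\<in>vertex_pairs n. \<phi> (Min e) (Max e) + \<phi> (Max e) (Min e)) = 2 * (\<Sum>e\<in>vertex_pairs n. \<phi> (Min e) (Max e))"
    unfolding sum_distrib_left using sym vertex_pairs_Min_Max(1,2) by (intro sum.cong refl) force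
  with sum_vertex_pairs[of \<phi> n] total diag
  have "- (\<Sum>u\<in>{1..n}. \<Sum>v\<in>{1..n}. binary_entropy (W u v)) \<le> (\<Sum>e\<in>vertex_pairs n. \<phi> (Min e) (Max e))" by linarith
  then have "exp (- (\<Sum>u\<in>{1..n}. \<Sum>v\<in>{1..n}. binary_entropy (W u v))) \<le> exp (\<Sum>e\<in>vertex_pairs n. \<phi> (Min e) (Max e))" by simp
  also have "\<dots> = (\<Prod>e\<in>vertex_pairs n. exp (\<phi> (Min e) (Max e)))" by (simp add: exp_sum)
  also have "\<dots> = edge_law (vertex_pairs n) (\<lambda>e. W (Min e) (Max e)) (snd G)"
    unfolding edge_law_def
  proof (intro prod.cong refl)
    fix e assume e: "e \<in> vertex_pairs n"
    note m = vertex_pairs_Min_Max[OF e]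
    have "?A (Min e) (Max e) = of_bool (e \<in> snd G)" using m(4) by (simp add: adjacency_def)
    then show "exp (\<phi> (Min e) (Max e)) = (if e \<in> snd G then W (Min e) (Max e) else 1 - W (Min e) (Max e))"
      using pos[OF m(1,2)] less[OF m(1,2)] by (simp add: \<phi>_def)
  qed
  finally show ?thesis .
qed

lemma card_graphs_with_block_averages:
  assumes n: "n \<ge> 1"
  shows "real (card {G \<in> labeled_graphs n. \<forall>u\<in>{1..n}. \<forall>v\<in>{1..n}. block_average n c (adjacency G) u v = W u v})
    \<le> exp (\<Sum>u\<in>{1..n}. \<Sum>v\<in>{1..n}. binary_entropy (W u v))"
proof (cases "{G \<in> labeled_graphs n. \<forall>u\<in>{1..n}. \<forall>v\<in>{1..n}. block_average n c (adjacency G) u v = W u v} = {}")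
  case False
  let ?X = "{G \<in> labeled_graphs n. \<forall>u\<in>{1..n}. \<forall>v\<in>{1..n}. block_average n c (adjacency G) u v = W u v}"
  let ?h = "\<Sum>u\<in>{1..n}. \<Sum>v\<in>{1..n}. binary_entropy (W u v)"
  let ?p = "\<lambda>e. W (Min e) (Max e)"
  obtain G0 where G0: "G0 \<in> ?X" using False by blast
  have p01: "?p e \<in> {0..1}" if "e \<in> vertex_pairs n" for e
  proof -
    have "block_average n c (adjacency G0) (Min e) (Max e) \<in> {0..1}"
      unfolding block_average_def by (intro block_density_bounds adjacency_01)
    then show ?thesis using G0 vertex_pairs_Min_Max(1,2)[OF that] by force
  qed
  have "real (card ?X) * exp (- ?h) = (\<Sum>G\<in>?X. exp (- ?h))" by simp
  also have "\<dots> \<le> (\<Sum>G\<in>?X. edge_law (vertex_pairs n) ?p (snd G))"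
    by (intro sum_mono edge_law_block_average[where c = c] n) auto
  also have "\<dots> \<le> (\<Sum>G\<in>labeled_graphs n. edge_law (vertex_pairs n) ?p (snd G))"
    using p01 by (intro sum_mono2 edge_law_nonneg) auto
  also have "\<dots> = (\<Sum>E\<in>Pow (vertex_pairs n). edge_law (vertex_pairs n) ?p E)"
    unfolding labeled_graphs_eq by (subst sum.reindex) (auto simp: inj_on_def)
  also have "\<dots> = 1" by (rule edge_law_sum) simp
  finally show ?thesis by (simp add: exp_minus field_simps)
next
  case True
  show ?thesis unfolding True by simp
qed

text \<open>A graph is determined by a colouring, the numbers of edges between the colour classes, and its
  place among the graphs that share them; only the third choice is of exponential order \<open>n\<^sup>2\<close>.\<close>

lemma card_graphs_with_low_entropy_coloring:
  assumes n: "n \<ge> 1" and B: "B \<subseteq> labeled_graphs n"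
    and c: "\<And>G u. G \<in> B \<Longrightarrow> c G u < R"
    and s: "\<And>G. G \<in> B \<Longrightarrow>
      (\<Sum>u\<in>{1..n}. \<Sum>v\<in>{1..n}. binary_entropy (block_average n (c G) (adjacency G) u v)) \<le> s"
  shows "real (card B) \<le> real R ^ n * real (n\<^sup>2 + 1) ^ R\<^sup>2 * exp s"
proof -
  define key where "key = (\<lambda>G. (restrict (c G) {1..n},
    restrict (\<lambda>(p, q). block_sum n (c G) (adjacency G) p q) ({..<R} \<times> {..<R})))"
  define K where "K = ({1..n} \<rightarrow>\<^sub>E {..<R}) \<times> (({..<R} \<times> {..<R}) \<rightarrow>\<^sub>E real ` {..n\<^sup>2})"
  have finB: "finite B" using B finite_labeled_graphs by (rule finite_subset)
  have card_K: "card K = R ^ n * (n\<^sup>2 + 1) ^ R\<^sup>2"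
    by (simp add: K_def card_cartesian_product card_PiE card_image power2_eq_square)
  have finK: "finite K" by (simp add: K_def finite_PiE)
  have block_sum_values: "block_sum n (c G) (adjacency G) p q \<in> real ` {..n\<^sup>2}" for G p q
  proof -
    define k where "k = (\<Sum>u\<in>color_class n (c G) p. \<Sum>v\<in>color_class n (c G) q. of_bool ({u, v} \<in> snd G) :: nat)"
    have "k \<le> (\<Sum>u\<in>color_class n (c G) p. \<Sum>v\<in>color_class n (c G) q. 1)" unfolding k_def by (intro sum_mono) auto
    also have "\<dots> = card (color_class n (c G) p) * card (color_class n (c G) q)" by simp
    also have "\<dots> \<le> card {1..n} * card {1..n}" by (intro mult_mono card_mono) (auto simp: color_class_def)
    finally have "k \<le> n\<^sup>2" by (simp add: power2_eq_square)
    moreover have "block_sum n (c G) (adjacency G) p q = real k"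
      by (simp add: block_sum_def k_def adjacency_def)
    ultimately show ?thesis by blast
  qed
  have key_K: "key ` B \<subseteq> K"
  proof (rule image_subsetI)
    fix G assume "G \<in> B"
    then show "key G \<in> K"
      unfolding key_def K_def mem_Times_iff fst_conv snd_conv restrict_PiE_iff case_prod_beta'
      by (intro conjI ballI block_sum_values) (simp add: c)
  qed
  have fiber: "real (card {G \<in> B. key G = k}) \<le> exp s" if k: "k \<in> key ` B" for k
  proof -
    from k obtain G0 where G0: "G0 \<in> B" "key G0 = k" by auto
    have "{G \<in> B. key G = k} \<subseteq> {G \<in> labeled_graphs n. \<forall>u\<in>{1..n}. \<forall>v\<in>{1..n}.
        block_average n (c G0) (adjacency G) u v = block_average n (c G0) (adjacency G0) u v}"
    proof (intro subsetI CollectI conjI ballI)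
      fix G assume "G \<in> {G \<in> B. key G = k}"
      then have G: "G \<in> B" "key G = k" by auto
      show "G \<in> labeled_graphs n" using G B by auto
      fix u v assume uv: "u \<in> {1..n}" "v \<in> {1..n}"
      have colors: "restrict (c G) {1..n} = restrict (c G0) {1..n}"
        and sums: "restrict (\<lambda>(p, q). block_sum n (c G) (adjacency G) p q) ({..<R} \<times> {..<R})
          = restrict (\<lambda>(p, q). block_sum n (c G0) (adjacency G0) p q) ({..<R} \<times> {..<R})"
        using G(2)[folded G0(2)] unfolding key_def by simp_all
      have "c G w = c G0 w" if "w \<in> {1..n}" for w using fun_cong[OF colors, of w] that by simp
      then have classes: "color_class n (c G) = color_class n (c G0)"
        unfolding color_class_def by (intro ext Collect_cong) auto
      have "block_sum n (c G) (adjacency G) (c G0 u) (c G0 v) = block_sum n (c G0) (adjacency G0) (c G0 u) (c G0 v)"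
        using fun_cong[OF sums, of "(c G0 u, c G0 v)"] c[OF G0(1)] by simp
      then show "block_average n (c G0) (adjacency G) u v = block_average n (c G0) (adjacency G0) u v"
        by (simp add: block_average_def block_density_def block_sum_def classes)
    qed
    then have "card {G \<in> B. key G = k} \<le> card {G \<in> labeled_graphs n. \<forall>u\<in>{1..n}. \<forall>v\<in>{1..n}.
        block_average n (c G0) (adjacency G) u v = block_average n (c G0) (adjacency G0) u v}"
      by (intro card_mono) auto
    also have "real \<dots> \<le> exp (\<Sum>u\<in>{1..n}. \<Sum>v\<in>{1..n}. binary_entropy (block_average n (c G0) (adjacency G0) u v))"
      by (rule card_graphs_with_block_averages[OF n])
    also have "\<dots> \<le> exp s" using s[OF G0(1)] by simp
    finally show ?thesis by simp
  qed
  have "real (card B) = (\<Sum>k\<in>key ` B. real (card {G \<in> B. key G = k}))"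
    using sum.image_gen[OF finB, of "\<lambda>_. 1 :: nat" key] by simp
  also have "\<dots> \<le> (\<Sum>k\<in>key ` B. exp s)" by (intro sum_mono fiber)
  also have "\<dots> \<le> real (card K) * exp s" using card_mono[OF finK key_K] by simp
  finally show ?thesis by (simp add: card_K)
qed

section \<open>Counting graphs from below\<close>

lemma exp_le_quadratic:
  fixes x :: real
  assumes "\<bar>x\<bar> \<le> 1"
  shows "exp x \<le> 1 + x + x\<^sup>2"
proof (cases "0 \<le> x")
  case True
  then show ?thesis using assms by (intro exp_bound) auto
next
  case False
  define y where "y = - x"
  have y: "0 < y" "y \<le> 1" using False assms by (auto simp: y_def)
  have "1 \<le> 1 + y ^ 3" using y by simp
  also have "\<dots> = (1 + y) * (1 - y + y\<^sup>2)" by (simp add: algebra_simps power2_eq_square power3_eq_cube)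
  also have "\<dots> \<le> exp y * (1 - y + y\<^sup>2)"
  proof (rule mult_right_mono)
    show "0 \<le> 1 - y + y\<^sup>2" using y by (simp add: add_nonneg_nonneg)
  qed (rule exp_ge_add_one_self)
  finally have "exp (- y) \<le> 1 - y + y\<^sup>2" by (simp add: exp_minus field_simps)
  then show ?thesis by (simp add: y_def)
qed

lemma bernoulli_exponential_moment:
  fixes p t :: real
  assumes p: "p \<in> {0..1}" and t: "\<bar>t\<bar> \<le> 1"
  shows "p * exp (t * (1 - p)) + (1 - p) * exp (t * (0 - p)) \<le> exp (t\<^sup>2)"
proof -
  have *: "exp (t * q) \<le> 1 + t * q + (t * q)\<^sup>2" if "\<bar>q\<bar> \<le> 1" for q
    using t that by (intro exp_le_quadratic) (simp add: abs_mult mult_le_one)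
  have "p * exp (t * (1 - p)) + (1 - p) * exp (t * (0 - p))
      \<le> p * (1 + t * (1 - p) + (t * (1 - p))\<^sup>2) + (1 - p) * (1 + t * (0 - p) + (t * (0 - p))\<^sup>2)"
    using p by (intro add_mono mult_left_mono *) auto
  also have "\<dots> = 1 + t\<^sup>2 * (p * (1 - p))" by (simp add: power2_eq_square algebra_simps)
  also have "\<dots> \<le> 1 + t\<^sup>2 * 1" using p by (intro add_left_mono mult_left_mono mult_le_one) auto
  also have "\<dots> \<le> exp (t\<^sup>2)" using exp_ge_add_one_self[of "t\<^sup>2"] by simp
  finally show ?thesis .
qed

text \<open>The centred value of a linear statistic of the edges.\<close>

definition deviation :: "'e set \<Rightarrow> ('e \<Rightarrow> real) \<Rightarrow> ('e \<Rightarrow> real) \<Rightarrow> 'e set \<Rightarrow> real" where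
  "deviation S p t E = (\<Sum>e\<in>S. t e * (of_bool (e \<in> E) - p e))"

lemma edge_law_exponential_moment:
  assumes S: "finite S" and p: "\<And>e. e \<in> S \<Longrightarrow> p e \<in> {0..1}" and t: "\<And>e. e \<in> S \<Longrightarrow> \<bar>t e\<bar> \<le> 1"
  shows "(\<Sum>E\<in>Pow S. edge_law S p E * exp (deviation S p t E)) \<le> exp (\<Sum>e\<in>S. (t e)\<^sup>2)"
proof -
  have "(\<Sum>E\<in>Pow S. edge_law S p E * exp (deviation S p t E))
      = (\<Sum>E\<in>Pow S. \<Prod>e\<in>S. if e \<in> E then p e * exp (t e * (1 - p e)) else (1 - p e) * exp (t e * (0 - p e)))"
    unfolding edge_law_def deviation_def exp_sum[OF S] prod.distrib[symmetric]
    by (intro sum.cong prod.cong refl) auto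
  also have "\<dots> = (\<Prod>e\<in>S. p e * exp (t e * (1 - p e)) + (1 - p e) * exp (t e * (0 - p e)))"
    by (rule sum_Pow_prod_if[OF S])
  also have "\<dots> \<le> (\<Prod>e\<in>S. exp ((t e)\<^sup>2))"
    using p t by (intro prod_mono conjI bernoulli_exponential_moment) (auto intro!: add_nonneg_nonneg mult_nonneg_nonneg)
  finally show ?thesis by (simp add: exp_sum[OF S])
qed

text \<open>The exponential Markov inequality for \<open>\<theta> t\<close> with the optimal \<open>\<theta> = a / (2 C\<^sup>2)\<close>.\<close>

lemma edge_law_large_deviation:
  assumes S: "finite S" "real (card S) \<le> m" and p: "\<And>e. e \<in> S \<Longrightarrow> p e \<in> {0..1}"
    and t: "\<And>e. e \<in> S \<Longrightarrow> \<bar>t e\<bar> \<le> C" and C: "0 < C" and a: "0 < a" "a \<le> 2 * C"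
  shows "(\<Sum>E\<in>{E \<in> Pow S. a * m \<le> deviation S p t E}. edge_law S p E) \<le> exp (- (a\<^sup>2 / (4 * C\<^sup>2)) * m)"
proof -
  define \<theta> where "\<theta> = a / (2 * C\<^sup>2)"
  have \<theta>: "0 < \<theta>" using a C by (simp add: \<theta>_def)
  have \<theta>C: "\<theta> * C \<le> 1" using a C by (simp add: \<theta>_def power2_eq_square)
  have small: "\<bar>\<theta> * t e\<bar> \<le> \<theta> * C" if "e \<in> S" for e
    using t[OF that] \<theta> by (simp add: abs_mult)
  have scale: "deviation S p (\<lambda>e. \<theta> * t e) E = \<theta> * deviation S p t E" for E
    by (simp add: deviation_def sum_distrib_left mult.assoc)
  have law: "0 \<le> edge_law S p E" for E using p by (rule edge_law_nonneg)
  have "(\<Sum>E\<in>{E \<in> Pow S. a * m \<le> deviation S p t E}. edge_law S p E)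
      \<le> (\<Sum>E\<in>{E \<in> Pow S. a * m \<le> deviation S p t E}. edge_law S p E * exp (deviation S p (\<lambda>e. \<theta> * t e) E) * exp (- \<theta> * (a * m)))"
  proof (rule sum_mono)
    fix E assume "E \<in> {E \<in> Pow S. a * m \<le> deviation S p t E}"
    then have "0 \<le> \<theta> * (deviation S p t E - a * m)" using \<theta> by simp
    then have "1 \<le> exp (\<theta> * (deviation S p t E - a * m))" by simp
    also have "\<dots> = exp (deviation S p (\<lambda>e. \<theta> * t e) E) * exp (- \<theta> * (a * m))"
      by (simp add: scale exp_add[symmetric] algebra_simps)
    finally have "edge_law S p E * 1 \<le> edge_law S p E * (exp (deviation S p (\<lambda>e. \<theta> * t e) E) * exp (- \<theta> * (a * m)))"
      using law by (intro mult_left_mono)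
    then show "edge_law S p E \<le> edge_law S p E * exp (deviation S p (\<lambda>e. \<theta> * t e) E) * exp (- \<theta> * (a * m))"
      by (simp add: mult.assoc)
  qed
  also have "\<dots> \<le> (\<Sum>E\<in>Pow S. edge_law S p E * exp (deviation S p (\<lambda>e. \<theta> * t e) E) * exp (- \<theta> * (a * m)))"
    using S law by (intro sum_mono2) auto
  also have "\<dots> \<le> exp (\<Sum>e\<in>S. (\<theta> * t e)\<^sup>2) * exp (- \<theta> * (a * m))"
    unfolding sum_distrib_right[symmetric] using p small \<theta>C
    by (intro mult_right_mono edge_law_exponential_moment S) (auto intro: order_trans)
  also have "(\<Sum>e\<in>S. (\<theta> * t e)\<^sup>2) \<le> (\<Sum>e\<in>S. (\<theta> * C)\<^sup>2)"
    using small \<theta> C by (intro sum_mono power2_le_iff_abs_le[THEN iffD2]) auto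
  also have "\<dots> \<le> (\<theta> * C)\<^sup>2 * m" using mult_right_mono[OF S(2), of "(\<theta> * C)\<^sup>2"] by (simp add: mult.commute)
  also have "exp ((\<theta> * C)\<^sup>2 * m) * exp (- \<theta> * (a * m)) = exp (- (a\<^sup>2 / (4 * C\<^sup>2)) * m)"
  proof -
    have "(\<theta> * C)\<^sup>2 - \<theta> * a = - (a\<^sup>2 / (4 * C\<^sup>2))" using C by (simp add: \<theta>_def field_simps power2_eq_square)
    moreover have "(\<theta> * C)\<^sup>2 * m + - \<theta> * (a * m) = ((\<theta> * C)\<^sup>2 - \<theta> * a) * m" by (simp add: algebra_simps)
    ultimately have "(\<theta> * C)\<^sup>2 * m + - \<theta> * (a * m) = - (a\<^sup>2 / (4 * C\<^sup>2)) * m" by simp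
    then show ?thesis by (simp add: exp_add[symmetric])
  qed
  finally show ?thesis by simp
qed

lemma card_vertex_pairs_le: "card (vertex_pairs n) \<le> n\<^sup>2"
proof -
  have "inj_on (\<lambda>e. (Min e, Max e)) (vertex_pairs n)"
    by (rule inj_on_inverseI[where g = "\<lambda>(u, v). {u, v}"]) (simp add: vertex_pairs_Min_Max(4))
  moreover have "(\<lambda>e. (Min e, Max e)) ` vertex_pairs n \<subseteq> {1..n} \<times> {1..n}"
    using vertex_pairs_Min_Max(1,2) by blast
  ultimately have "card (vertex_pairs n) \<le> card ({1..n} \<times> {1..n})" by (rule card_inj_on_le) simp
  then show ?thesis by (simp add: power2_eq_square)
qed

text \<open>An unordered pair of vertices enters the sum once for each of its orientations that lies in \<open>U \<times> V\<close>; the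
  diagonal contributes at most \<open>n\<close>.\<close>

lemma rectangle_sum_deviation:
  assumes w: "\<And>u v. w u v = w v u \<and> w u v \<in> {0..1}" and G: "G = (n, E)" "E \<subseteq> vertex_pairs n"
    and UV: "U \<subseteq> {1..n}" "V \<subseteq> {1..n}"
  defines "t \<equiv> \<lambda>e. of_bool (Min e \<in> U \<and> Max e \<in> V) + of_bool (Max e \<in> U \<and> Min e \<in> V) :: real"
  shows "\<bar>\<Sum>u\<in>U. \<Sum>v\<in>V. adjacency G u v - w u v\<bar> \<le> real n + \<bar>deviation (vertex_pairs n) (\<lambda>e. w (Min e) (Max e)) t E\<bar>"
proof -
  define F where "F = (\<lambda>u v. of_bool (u \<in> U \<and> v \<in> V) * (adjacency G u v - w u v))"
  have "simple_graph G" using G by (auto simp: simple_graph_def vertex_pairs_def)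
  have "(\<Sum>u\<in>U. \<Sum>v\<in>V. adjacency G u v - w u v) = (\<Sum>u\<in>{1..n}. \<Sum>v\<in>{1..n}. F u v)"
  proof -
    have "(\<Sum>u\<in>{1..n}. \<Sum>v\<in>{1..n}. F u v) = (\<Sum>u\<in>{1..n}. if u \<in> U then (\<Sum>v\<in>{1..n}. if v \<in> V then adjacency G u v - w u v else 0) else 0)"
    proof (intro sum.cong refl)
      fix u
      show "(\<Sum>v\<in>{1..n}. F u v) = (if u \<in> U then (\<Sum>v\<in>{1..n}. if v \<in> V then adjacency G u v - w u v else 0) else 0)"
      proof (cases "u \<in> U")
        case True
        then show ?thesis by (simp only: if_True) (intro sum.cong refl, simp add: F_def)
      qed (simp add: F_def)
    qed
    also have "\<dots> = (\<Sum>u\<in>{1..n} \<inter> U. \<Sum>v\<in>{1..n} \<inter> V. adjacency G u v - w u v)"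
      by (simp only: sum.inter_restrict finite_atLeastAtMost)
    finally show ?thesis using UV by (simp add: Int_absorb1)
  qed
  also have "\<dots> = (\<Sum>u\<in>{1..n}. F u u) + (\<Sum>e\<in>vertex_pairs n. F (Min e) (Max e) + F (Max e) (Min e))"
    by (rule sum_vertex_pairs)
  also have "(\<Sum>e\<in>vertex_pairs n. F (Min e) (Max e) + F (Max e) (Min e))
      = deviation (vertex_pairs n) (\<lambda>e. w (Min e) (Max e)) t E"
    unfolding deviation_def
  proof (intro sum.cong refl)
    fix e assume e: "e \<in> vertex_pairs n"
    have "adjacency G (Min e) (Max e) = of_bool (e \<in> E)" "adjacency G (Max e) (Min e) = of_bool (e \<in> E)"
      using vertex_pairs_Min_Max(4)[OF e] G by (simp_all add: adjacency_def insert_commute)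
    then show "F (Min e) (Max e) + F (Max e) (Min e) = t e * (of_bool (e \<in> E) - w (Min e) (Max e))"
      using w[of "Max e" "Min e"] unfolding F_def t_def by (simp add: algebra_simps)
  qed
  finally have eq: "(\<Sum>u\<in>U. \<Sum>v\<in>V. adjacency G u v - w u v)
     = (\<Sum>u\<in>{1..n}. F u u) + deviation (vertex_pairs n) (\<lambda>e. w (Min e) (Max e)) t E" .
  have "\<bar>\<Sum>u\<in>{1..n}. F u u\<bar> \<le> (\<Sum>u\<in>{1..n}. \<bar>F u u\<bar>)" by (rule sum_abs)
  also have "\<dots> \<le> (\<Sum>u\<in>{1..n}. 1)"
    using w adjacency_diag[OF \<open>simple_graph G\<close>] by (intro sum_mono) (auto simp: F_def)
  finally show ?thesis unfolding eq by simp
qed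

text \<open>The expected logarithm of the probability is minus the entropy, and its fluctuation is a linear statistic of the
  edges with the slopes of the entropy as coefficients.\<close>

lemma edge_law_eq_exp:
  assumes w: "\<And>u v. w u v = w v u \<and> 0 < w u v \<and> w u v < 1" and E: "E \<subseteq> vertex_pairs n"
  shows "edge_law (vertex_pairs n) (\<lambda>e. w (Min e) (Max e)) E =
    exp (deviation (vertex_pairs n) (\<lambda>e. w (Min e) (Max e)) (\<lambda>e. - 2 * binary_entropy_slope (w (Min e) (Max e))) E
      - (\<Sum>u\<in>{1..n}. \<Sum>v\<in>{1..n}. binary_entropy (w u v)) + (\<Sum>u\<in>{1..n}. binary_entropy (w u u)))"
proof -
  let ?p = "\<lambda>e. w (Min e) (Max e)"
  have "edge_law (vertex_pairs n) ?p E = (\<Prod>e\<in>vertex_pairs n. exp (- 2 * binary_entropy_slope (?p e) * (of_bool (e \<in> E) - ?p e)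
      - 2 * binary_entropy (?p e)))"
    unfolding edge_law_def
  proof (intro prod.cong refl)
    fix e
    have p: "0 < ?p e" "?p e < 1" using w by auto
    have "- 2 * binary_entropy_slope (?p e) * (of_bool (e \<in> E) - ?p e) - 2 * binary_entropy (?p e)
        = (if e \<in> E then ln (?p e) else ln (1 - ?p e))"
      unfolding binary_entropy_slope_def binary_entropy_def by (simp add: field_simps)
    then show "(if e \<in> E then ?p e else 1 - ?p e) = exp (- 2 * binary_entropy_slope (?p e) * (of_bool (e \<in> E) - ?p e)
      - 2 * binary_entropy (?p e))" using p by simp
  qed
  also have "\<dots> = exp (deviation (vertex_pairs n) ?p (\<lambda>e. - 2 * binary_entropy_slope (?p e)) E - (\<Sum>e\<in>vertex_pairs n. 2 * binary_entropy (?p e)))"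
    unfolding deviation_def by (subst exp_sum[symmetric]) (simp_all add: sum_subtractf)
  also have "(\<Sum>e\<in>vertex_pairs n. 2 * binary_entropy (?p e))
      = (\<Sum>u\<in>{1..n}. \<Sum>v\<in>{1..n}. binary_entropy (w u v)) - (\<Sum>u\<in>{1..n}. binary_entropy (w u u))"
  proof -
    have "2 * binary_entropy (?p e) = binary_entropy (w (Min e) (Max e)) + binary_entropy (w (Max e) (Min e))" for e
      using w[of "Max e" "Min e"] by simp
    then show ?thesis using sum_vertex_pairs[of "\<lambda>u v. binary_entropy (w u v)" n] by simp
  qed
  finally show ?thesis by (simp add: algebra_simps)
qed

lemma sum_UNION_le:
  fixes f :: "'a \<Rightarrow> real"
  assumes "finite I" "\<And>i. i \<in> I \<Longrightarrow> finite (A i)" "\<And>x. 0 \<le> f x"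
  shows "sum f (\<Union>i\<in>I. A i) \<le> (\<Sum>i\<in>I. sum f (A i))"
  using assms
proof (induction I rule: finite_induct)
  case (insert i I)
  then have "sum f (A i \<union> (\<Union>i\<in>I. A i)) \<le> sum f (A i) + sum f (\<Union>i\<in>I. A i)"
    by (simp add: sum_Un sum_nonneg)
  then show ?case using insert by simp
qed simp

text \<open>A random graph with edge probabilities \<open>w\<close> is close to \<open>w\<close> on all \<open>4\<^sup>n\<close> rectangles with probability
  near one, and with probability near one its likelihood is not much larger than \<open>exp (- n\<^sup>2 S)\<close>. Hence the number of graphs
  that are close to \<open>w\<close> cannot be much smaller than \<open>exp (n\<^sup>2 S)\<close>.\<close>

lemma many_graphs_near_matrix:
  assumes \<kappa>: "0 < \<kappa>" and a: "0 < a" "a \<le> 1"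
  shows "\<forall>\<^sub>F n in sequentially. \<forall>w. (\<forall>u v. w u v = w v u \<and> w u v \<in> {\<kappa>..1 - \<kappa>}) \<longrightarrow>
    1 / 2 * exp ((\<Sum>u\<in>{1..n}. \<Sum>v\<in>{1..n}. binary_entropy (w u v)) - 2 * a * (real n)\<^sup>2)
    \<le> real (card {G \<in> labeled_graphs n. \<forall>U V. U \<subseteq> {1..n} \<longrightarrow> V \<subseteq> {1..n} \<longrightarrow>
        \<bar>\<Sum>u\<in>U. \<Sum>v\<in>V. adjacency G u v - w u v\<bar> \<le> 2 * a * (real n)\<^sup>2})"
proof -
  define C where "C = 1 + \<bar>2 * ln \<kappa>\<bar>"
  have C: "0 < C" "1 \<le> C" by (auto simp: C_def)
  have lim: "(\<lambda>n. 2 * (2 ^ n * 2 ^ n) * exp (- b * (real n)\<^sup>2)) \<longlonglongrightarrow> 0" if "0 < b" for b :: real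
    using that by real_asymp
  have lim': "(\<lambda>n. exp (- b * (real n)\<^sup>2)) \<longlonglongrightarrow> 0" if "0 < b" for b :: real
    using that by real_asymp
  have "0 < a\<^sup>2 / (4 * 2\<^sup>2)" "0 < a\<^sup>2 / (4 * C\<^sup>2)" using a C by simp_all
  from tendsto_add[OF lim[OF this(1)] lim'[OF this(2)]]
  have "\<forall>\<^sub>F n in sequentially. 2 * (2 ^ n * 2 ^ n) * exp (- (a\<^sup>2 / (4 * 2\<^sup>2)) * (real n)\<^sup>2)
      + exp (- (a\<^sup>2 / (4 * C\<^sup>2)) * (real n)\<^sup>2) < 1 / 2"
    by (rule order_tendstoD(2)) simp
  (* The diagonal terms, at most n, account for the second a n^2 in the bounds. *)
  moreover have "\<forall>\<^sub>F n in sequentially. real n \<le> a * (real n)\<^sup>2" using a(1) by real_asymp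
  ultimately show ?thesis
  proof eventually_elim
    case (elim n)
    show ?case
    proof (intro allI impI)
      fix w :: "nat \<Rightarrow> nat \<Rightarrow> real"
      assume w: "\<forall>u v. w u v = w v u \<and> w u v \<in> {\<kappa>..1 - \<kappa>}"
      define X where "X = {G \<in> labeled_graphs n. \<forall>U V. U \<subseteq> {1..n} \<longrightarrow> V \<subseteq> {1..n} \<longrightarrow>
        \<bar>\<Sum>u\<in>U. \<Sum>v\<in>V. adjacency G u v - w u v\<bar> \<le> 2 * a * (real n)\<^sup>2}"
      define h where "h = (\<Sum>u\<in>{1..n}. \<Sum>v\<in>{1..n}. binary_entropy (w u v))"
      define S where "S = vertex_pairs n"
      define p where "p = (\<lambda>e. w (Min e) (Max e))"
      (* The rectangle sums with both signs, up to the diagonal; l below is for the logarithmic likelihood. *)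
      define t where "t = (\<lambda>(U, V, \<sigma>) (e :: nat set). \<sigma> * (of_bool (Min e \<in> U \<and> Max e \<in> V) + of_bool (Max e \<in> U \<and> Min e \<in> V)) :: real)"
      define l where "l = (\<lambda>e. - 2 * binary_entropy_slope (p e))"
      define I where "I = Pow {1..n} \<times> Pow {1..n} \<times> {1, - 1 :: real}"
      define bad where "bad = (\<lambda>t. {E \<in> Pow S. a * (real n)\<^sup>2 \<le> deviation S p t E})"
      define good where "good = Pow S - ((\<Union>i\<in>I. bad (t i)) \<union> bad l)"
      have S: "finite S" "real (card S) \<le> (real n)\<^sup>2"
        using card_vertex_pairs_le[of n] unfolding S_def by (simp_all flip: of_nat_power)
      have w01: "0 < w u v" "w u v < 1" "w u v \<in> {0..1}" for u v
        using w[rule_format, of u v] \<kappa> by auto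
      have p01: "p e \<in> {0..1}" for e using w01 by (auto simp: p_def)
      have law: "0 \<le> edge_law S p E" for E using p01 by (rule edge_law_nonneg)
      have "\<bar>t i e\<bar> \<le> 2" if "i \<in> I" for i e using that by (auto simp: t_def I_def)
      then have bad_t: "(\<Sum>E\<in>bad (t i). edge_law S p E) \<le> exp (- (a\<^sup>2 / (4 * 2\<^sup>2)) * (real n)\<^sup>2)" if "i \<in> I" for i
        unfolding bad_def using that a by (intro edge_law_large_deviation S p01) auto
      have "\<bar>l e\<bar> \<le> C" for e
        using binary_entropy_slope_bound[of "p e" \<kappa>] w \<kappa> by (auto simp: l_def C_def p_def abs_mult)
      then have bad_l: "(\<Sum>E\<in>bad l. edge_law S p E) \<le> exp (- (a\<^sup>2 / (4 * C\<^sup>2)) * (real n)\<^sup>2)"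
        unfolding bad_def using a C by (intro edge_law_large_deviation S p01) auto
      have finI: "finite I" and card_I: "real (card I) = 2 * (2 ^ n * 2 ^ n)"
        by (simp_all add: I_def card_cartesian_product card_Pow)
      have fin_bad: "finite (bad t)" for t unfolding bad_def using S by simp
      have sub: "(\<Union>i\<in>I. bad (t i)) \<union> bad l \<subseteq> Pow S" by (auto simp: bad_def)
      have "(\<Sum>E\<in>(\<Union>i\<in>I. bad (t i)) \<union> bad l. edge_law S p E)
          \<le> (\<Sum>E\<in>(\<Union>i\<in>I. bad (t i)). edge_law S p E) + (\<Sum>E\<in>bad l. edge_law S p E)"
        using finI fin_bad law by (simp add: sum_Un sum_nonneg)
      also have "(\<Sum>E\<in>(\<Union>i\<in>I. bad (t i)). edge_law S p E) \<le> (\<Sum>i\<in>I. \<Sum>E\<in>bad (t i). edge_law S p E)"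
        by (intro sum_UNION_le finI fin_bad law)
      also have "\<dots> \<le> (\<Sum>i\<in>I. exp (- (a\<^sup>2 / (4 * 2\<^sup>2)) * (real n)\<^sup>2))" by (intro sum_mono bad_t)
      also have "\<dots> = 2 * (2 ^ n * 2 ^ n) * exp (- (a\<^sup>2 / (4 * 2\<^sup>2)) * (real n)\<^sup>2)"
        by (simp only: sum_constant card_I)
      finally have "(\<Sum>E\<in>(\<Union>i\<in>I. bad (t i)) \<union> bad l. edge_law S p E) < 1 / 2"
        using elim(1) bad_l by linarith
      moreover have "(\<Sum>E\<in>good. edge_law S p E) = 1 - (\<Sum>E\<in>(\<Union>i\<in>I. bad (t i)) \<union> bad l. edge_law S p E)"
        unfolding good_def using S sub by (subst sum_diff) (auto simp: edge_law_sum)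
      ultimately have half: "1 / 2 \<le> (\<Sum>E\<in>good. edge_law S p E)" by simp
      have law_le: "edge_law S p E \<le> exp (2 * a * (real n)\<^sup>2 - h)" if "E \<in> good" for E
      proof -
        have E: "E \<subseteq> vertex_pairs n" and dev: "deviation S p l E < a * (real n)\<^sup>2"
          using that by (auto simp: good_def bad_def S_def)
        have "(\<Sum>u\<in>{1..n}. binary_entropy (w u u)) \<le> (\<Sum>u\<in>{1..n}. 1)"
          using binary_entropy_bounds[OF w01(3)] by (intro sum_mono) auto
        then have "deviation S p l E - h + (\<Sum>u\<in>{1..n}. binary_entropy (w u u)) \<le> 2 * a * (real n)\<^sup>2 - h"
          using dev elim(2) by simp
        moreover have "edge_law S p E = exp (deviation S p l E - h + (\<Sum>u\<in>{1..n}. binary_entropy (w u u)))"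
          unfolding S_def p_def l_def h_def by (rule edge_law_eq_exp[OF _ E]) (use w w01 in blast)
        ultimately show ?thesis by simp
      qed
      have "1 / 2 \<le> (\<Sum>E\<in>good. exp (2 * a * (real n)\<^sup>2 - h))"
        by (rule order_trans[OF half]) (rule sum_mono[OF law_le])
      then have "1 / 2 * exp (h - 2 * a * (real n)\<^sup>2) \<le> real (card good)"
        by (simp add: exp_diff field_simps)
      also have "card good \<le> card X"
      proof (rule card_inj_on_le[of "Pair n"])
        show "finite X" unfolding X_def by simp
        show "Pair n ` good \<subseteq> X"
        proof (rule image_subsetI)
          fix E assume E: "E \<in> good"
          then have sub: "E \<subseteq> vertex_pairs n" by (auto simp: good_def S_def)
          have "\<bar>\<Sum>u\<in>U. \<Sum>v\<in>V. adjacency (n, E) u v - w u v\<bar> \<le> 2 * a * (real n)\<^sup>2"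
            if UV: "U \<subseteq> {1..n}" "V \<subseteq> {1..n}" for U V
          proof -
            have "deviation S p (t (U, V, 1)) E < a * (real n)\<^sup>2" "deviation S p (t (U, V, - 1)) E < a * (real n)\<^sup>2"
              using E UV by (auto simp: good_def bad_def I_def not_le)
            moreover have "deviation S p (t (U, V, - 1)) E = - deviation S p (t (U, V, 1)) E"
            proof -
              have "t (U, V, - 1) e = - t (U, V, 1) e" for e by (simp add: t_def)
              then show ?thesis by (simp add: deviation_def sum_negf)
            qed
            ultimately have "\<bar>deviation S p (t (U, V, 1)) E\<bar> < a * (real n)\<^sup>2" by linarith
            moreover have "\<bar>\<Sum>u\<in>U. \<Sum>v\<in>V. adjacency (n, E) u v - w u v\<bar> \<le> real n + \<bar>deviation S p (t (U, V, 1)) E\<bar>"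
              using rectangle_sum_deviation[of w "(n, E)" n E U V] w w01(3) sub UV
              by (simp add: S_def p_def t_def)
            ultimately show ?thesis using elim(2) by linarith
          qed
          moreover have "(n, E) \<in> labeled_graphs n" using sub by (simp add: labeled_graphs_eq)
          ultimately show "(n, E) \<in> X" by (simp add: X_def)
        qed
      qed (simp add: inj_on_def)
      finally show "1 / 2 * exp (h - 2 * a * (real n)\<^sup>2) \<le> real (card X)" by simp
    qed
  qed
qed

text \<open>The loss \<open>\<eta>\<close> in the exponent is divided between the entropy of the step function, the fluctuations, and the
  factor \<open>1 / 2\<close>.\<close>

theorem many_graphs_near_graphon:
  assumes g: "graphon g" and \<rho>: "0 < \<rho>" and \<eta>: "0 < \<eta>"
  shows "\<forall>\<^sub>F n in sequentially. exp ((real n)\<^sup>2 * (graphon_entropy g - \<eta>))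
    \<le> real (card {G \<in> labeled_graphs n. cut_norm (\<lambda>z. checkerboard G z - g z) \<le> \<rho>})"
proof -
  obtain d where d: "d > 0" "\<And>f h. graphon f \<Longrightarrow> graphon h \<Longrightarrow> (\<integral>z. \<bar>f z - h z\<bar> \<partial>unit_square) < d \<Longrightarrow>
    \<bar>graphon_entropy f - graphon_entropy h\<bar> < \<eta> / 3"
    using graphon_entropy_L1_continuous[of "\<eta> / 3"] \<eta> by auto
  define \<kappa> where "\<kappa> = min (1 / 2) (min (\<rho> / 4) (d / 2))"
  have \<kappa>: "0 < \<kappa>" "\<kappa> \<le> 1 / 2" "\<kappa> + \<kappa> \<le> \<rho> / 2" "\<kappa> + \<kappa> \<le> d" using \<rho> d(1) by (auto simp: \<kappa>_def)
  define a where "a = min 1 (min (\<rho> / 4) (\<eta> / 6))"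
  have a: "0 < a" "a \<le> 1" "2 * a \<le> \<rho> / 2" "2 * a \<le> \<eta> / 3" using \<rho> \<eta> by (auto simp: a_def)
  have "(\<lambda>n. exp (- (\<eta> / 3) * (real n)\<^sup>2)) \<longlonglongrightarrow> 0" using \<eta> by real_asymp
  then have "\<forall>\<^sub>F n in sequentially. exp (- (\<eta> / 3) * (real n)\<^sup>2) < 1 / 2" by (rule order_tendstoD(2)) simp
  then show ?thesis
    using graphon_step_approximation[OF g less_imp_le[OF \<kappa>(1)] \<kappa>(2) \<kappa>(1)]
      many_graphs_near_matrix[OF \<kappa>(1) a(1,2)] eventually_ge_at_top[of 1]
  proof eventually_elim
    case (elim n)
    then obtain w where w: "\<And>u v. w u v = w v u" "\<And>u v. w u v \<in> {\<kappa>..1 - \<kappa>}"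
      and gw: "(\<integral>z. \<bar>g z - step n w z\<bar> \<partial>unit_square) < \<kappa> + \<kappa>" by blast
    have n: "n \<ge> 1" by fact
    have w01: "w u v \<in> {0..1}" for u v using w(2)[of u v] \<kappa> by auto
    have gs: "graphon (step n w)" using n w(1) w01 by (rule graphon_step)
    let ?Y = "{G \<in> labeled_graphs n. \<forall>U V. U \<subseteq> {1..n} \<longrightarrow> V \<subseteq> {1..n} \<longrightarrow>
        \<bar>\<Sum>u\<in>U. \<Sum>v\<in>V. adjacency G u v - w u v\<bar> \<le> 2 * a * (real n)\<^sup>2}"
    let ?X = "{G \<in> labeled_graphs n. cut_norm (\<lambda>z. checkerboard G z - g z) \<le> \<rho>}"
    have "?Y \<subseteq> ?X"
    proof (intro subsetI CollectI conjI)
      fix G assume G: "G \<in> ?Y"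
      then show "G \<in> labeled_graphs n" by simp
      then have sg: "simple_graph G" "fst G = n" by (simp_all add: labeled_graphs_def)
      note k = kernel_graphon[OF graphon_checkerboard[of G]] kernel_graphon[OF gs] kernel_graphon[OF g]
      have "cut_norm (\<lambda>z. checkerboard G z - g z)
          \<le> cut_norm (\<lambda>z. checkerboard G z - step n w z) + cut_norm (\<lambda>z. step n w z - g z)"
        by (intro cut_norm_triangle k)
      also have "cut_norm (\<lambda>z. checkerboard G z - step n w z) \<le> 2 * a"
        unfolding cut_norm_checkerboard_diff[OF sg n] using G by (intro cut_norm_step_le n) blast
      also have "cut_norm (\<lambda>z. step n w z - g z) \<le> (\<integral>z. \<bar>g z - step n w z\<bar> \<partial>unit_square)"
        using cut_norm_le_L1[OF kernel_diff[OF k(2,3)]] by (simp add: abs_minus_commute)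
      finally show "cut_norm (\<lambda>z. checkerboard G z - g z) \<le> \<rho>" using a(3) gw \<kappa>(3) by linarith
    qed
    then have YX: "card ?Y \<le> card ?X" by (intro card_mono) auto
    have "\<bar>graphon_entropy g - graphon_entropy (step n w)\<bar> < \<eta> / 3"
      using gw \<kappa>(4) by (intro d(2) g gs) simp
    then have "graphon_entropy g - \<eta> / 3 \<le> graphon_entropy (step n w)" by linarith
    then have "(real n)\<^sup>2 * (graphon_entropy g - \<eta> / 3) \<le> (real n)\<^sup>2 * graphon_entropy (step n w)"
      by (intro mult_left_mono) auto
    also have "\<dots> = (\<Sum>u\<in>{1..n}. \<Sum>v\<in>{1..n}. binary_entropy (w u v))"
      unfolding graphon_entropy_step[OF n gs] using n by simp
    finally have S: "(real n)\<^sup>2 * (graphon_entropy g - \<eta> / 3) \<le> (\<Sum>u\<in>{1..n}. \<Sum>v\<in>{1..n}. binary_entropy (w u v))" .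
    have "2 * a * (real n)\<^sup>2 \<le> \<eta> / 3 * (real n)\<^sup>2" by (intro mult_right_mono a) simp
    then have "(real n)\<^sup>2 * (graphon_entropy g - \<eta>) \<le> - (\<eta> / 3) * (real n)\<^sup>2
        + ((\<Sum>u\<in>{1..n}. \<Sum>v\<in>{1..n}. binary_entropy (w u v)) - 2 * a * (real n)\<^sup>2)"
      using S by (simp add: algebra_simps)
    then have "exp ((real n)\<^sup>2 * (graphon_entropy g - \<eta>)) \<le> exp (- (\<eta> / 3) * (real n)\<^sup>2)
        * exp ((\<Sum>u\<in>{1..n}. \<Sum>v\<in>{1..n}. binary_entropy (w u v)) - 2 * a * (real n)\<^sup>2)"
      by (simp flip: exp_add)
    also have "\<dots> \<le> 1 / 2 * exp ((\<Sum>u\<in>{1..n}. \<Sum>v\<in>{1..n}. binary_entropy (w u v)) - 2 * a * (real n)\<^sup>2)"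
      using elim(1) by (intro mult_right_mono) auto
    also have "\<dots> \<le> real (card ?Y)" using elim(3) w by blast
    also have "\<dots> \<le> real (card ?X)" using YX by simp
    finally show ?case .
  qed
qed

section \<open>The entropy gap\<close>

text \<open>An invariant of the classes may be computed at any representative.\<close>

lemma reduced_class_value:
  assumes "graphon h" "\<And>f. graphon f \<Longrightarrow> cut_distance h f = 0 \<Longrightarrow> F f = F h"
  shows "the_elem (F ` (cut_equiv `` {h})) = F h"
proof (rule the_elem_image_unique)
  have "h \<in> cut_equiv `` {h}" using assms(1) by (simp add: cut_equiv_def cut_distance_refl kernel_graphon)
  then show "cut_equiv `` {h} \<noteq> {}" by blast
qed (use assms in \<open>auto simp: cut_equiv_def\<close>)

lemma reduced_density_class:
  assumes "simple_graph P" "graphon h"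
  shows "reduced_density P (cut_equiv `` {h}) = subgraph_density P h"
  unfolding reduced_density_def
  by (rule reduced_class_value[OF assms(2)]) (use density_diff_le_cut_distance[OF assms] in force)

lemma reduced_entropy_class: "graphon h \<Longrightarrow> reduced_entropy (cut_equiv `` {h}) = graphon_entropy h"
  unfolding reduced_entropy_def by (rule reduced_class_value) (auto simp: graphon_entropy_cong)

lemma graph_cut_distance_class:
  assumes "graphon h"
  shows "graph_cut_distance G (cut_equiv `` {h}) = cut_distance (checkerboard G) h"
  unfolding graph_cut_distance_def
proof (rule reduced_class_value[OF assms])
  fix f assume f: "graphon f" "cut_distance h f = 0"
  note k = kernel_graphon[OF f(1)] kernel_graphon[OF assms] kernel_graphon[OF graphon_checkerboard[of G]]
  show "cut_distance (checkerboard G) f = cut_distance (checkerboard G) h"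
    using cut_distance_triangle[OF k(3,2,1)] cut_distance_triangle[OF k(3,1,2)] f(2)
      cut_distance_commute[OF k(1,2)] by simp
qed

lemma reduced_graphonsE:
  assumes "g \<in> reduced_graphons"
  obtains h where "graphon h" "g = cut_equiv `` {h}"
  using assms unfolding reduced_graphons_def by (auto elim: quotientE)

lemma entropy_maximizer_class:
  assumes P: "\<And>i. i \<in> {1..k} \<Longrightarrow> simple_graph (P i)" and h: "graphon h"
  shows "entropy_maximizer k P t (cut_equiv `` {h}) \<longleftrightarrow>
    (\<forall>i\<in>{1..k}. subgraph_density (P i) h = t i) \<and>
    (\<forall>f. graphon f \<longrightarrow> (\<forall>i\<in>{1..k}. subgraph_density (P i) f = t i) \<longrightarrow> graphon_entropy f \<le> graphon_entropy h)"
proof -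
  have reduced: "cut_equiv `` {f} \<in> reduced_graphons" if "graphon f" for f
    unfolding reduced_graphons_def using that by (intro quotientI) simp
  have dens: "(\<forall>i\<in>{1..k}. reduced_density (P i) (cut_equiv `` {f}) = t i) \<longleftrightarrow>
      (\<forall>i\<in>{1..k}. subgraph_density (P i) f = t i)" if "graphon f" for f
    using P that by (intro ball_cong refl) (simp add: reduced_density_class)
  have "entropy_maximizer k P t (cut_equiv `` {h}) \<longleftrightarrow>
    (\<forall>i\<in>{1..k}. subgraph_density (P i) h = t i) \<and>
    (\<forall>g. g \<in> reduced_graphons \<and> (\<forall>i\<in>{1..k}. reduced_density (P i) g = t i) \<longrightarrow>
      reduced_entropy g \<le> graphon_entropy h)"
    unfolding entropy_maximizer_def is_arg_max_linorder using reduced[OF h] dens[OF h]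
    by (simp add: reduced_entropy_class[OF h])
  also have "(\<forall>g. g \<in> reduced_graphons \<and> (\<forall>i\<in>{1..k}. reduced_density (P i) g = t i) \<longrightarrow>
      reduced_entropy g \<le> graphon_entropy h) \<longleftrightarrow>
    (\<forall>f. graphon f \<longrightarrow> (\<forall>i\<in>{1..k}. subgraph_density (P i) f = t i) \<longrightarrow> graphon_entropy f \<le> graphon_entropy h)"
  proof (intro iffI allI impI)
    fix f assume all: "\<forall>g. g \<in> reduced_graphons \<and> (\<forall>i\<in>{1..k}. reduced_density (P i) g = t i) \<longrightarrow> reduced_entropy g \<le> graphon_entropy h"
      and f: "graphon f" "\<forall>i\<in>{1..k}. subgraph_density (P i) f = t i"
    show "graphon_entropy f \<le> graphon_entropy h"
      using all[rule_format, of "cut_equiv `` {f}"] reduced[OF f(1)] dens[OF f(1)] f(2) reduced_entropy_class[OF f(1)] by simp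
  next
    fix g assume all: "\<forall>f. graphon f \<longrightarrow> (\<forall>i\<in>{1..k}. subgraph_density (P i) f = t i) \<longrightarrow> graphon_entropy f \<le> graphon_entropy h"
      and g: "g \<in> reduced_graphons \<and> (\<forall>i\<in>{1..k}. reduced_density (P i) g = t i)"
    obtain f where f: "graphon f" "g = cut_equiv `` {f}" using g by (auto elim: reduced_graphonsE)
    then show "reduced_entropy g \<le> graphon_entropy h"
      using all g dens[OF f(1)] by (simp add: reduced_entropy_class)
  qed
  finally show ?thesis .
qed

text \<open>If there were no gap, a sequence of finite weighted graphs away from \<open>g\<close> with densities tending to \<open>t\<close> and
  with entropies not much below that of \<open>g\<close> would have a limit point: a maximizer other than \<open>g\<close>.\<close>

lemma entropy_gap:
  assumes P: "\<And>i. i \<in> {1..k} \<Longrightarrow> simple_graph (P i)" and g: "graphon g"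
    and unique: "\<And>f. graphon f \<Longrightarrow> (\<And>i. i \<in> {1..k} \<Longrightarrow> subgraph_density (P i) f = t i) \<Longrightarrow>
      graphon_entropy g \<le> graphon_entropy f \<Longrightarrow> cut_distance f g = 0"
    and \<epsilon>: "0 < \<epsilon>"
  shows "\<exists>\<eta>>0. \<forall>n W. n \<ge> 1 \<longrightarrow> (\<forall>u\<in>{1..n}. \<forall>v\<in>{1..n}. W u v = W v u \<and> W u v \<in> {0..1}) \<longrightarrow>
    (\<forall>i\<in>{1..k}. \<bar>subgraph_density (P i) (step n W) - t i\<bar> \<le> \<eta>) \<longrightarrow>
    \<epsilon> \<le> cut_distance (step n W) g \<longrightarrow> graphon_entropy (step n W) < graphon_entropy g - \<eta>"
proof -
  define Q where "Q = (\<lambda>\<eta> n W. n \<ge> 1 \<and> (\<forall>u v. u \<in> {1..n} \<longrightarrow> v \<in> {1..n} \<longrightarrow> W u v = W v u \<and> W u v \<in> {0..1}) \<and>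
      (\<forall>i\<in>{1..k}. \<bar>subgraph_density (P i) (step n W) - t i\<bar> \<le> \<eta>) \<and>
      \<epsilon> \<le> cut_distance (step n W) g \<and> graphon_entropy g - \<eta> \<le> graphon_entropy (step n W))"
  have "\<exists>\<eta>>0. \<forall>n W. \<not> Q \<eta> n W"
  proof (rule ccontr)
    assume "\<not> (\<exists>\<eta>>0. \<forall>n W. \<not> Q \<eta> n W)"
    then have "\<exists>n W. Q \<eta> n W" if "\<eta> > 0" for \<eta> using that by blast
    then have "\<exists>n W. Q (1 / real (Suc j)) n W" for j by simp
    then obtain n W where Q: "\<And>j. Q (1 / real (Suc j)) (n j) (W j)" by metis
    have n: "n j \<ge> 1" for j using Q[of j] by (simp add: Q_def)
    have W: "W j u v = W j v u \<and> W j u v \<in> {0..1}" if "u \<in> {1..n j}" "v \<in> {1..n j}" for j u v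
      using Q[of j] that unfolding Q_def by blast
    obtain r f where r: "strict_mono r" and f: "graphon f"
      and lim: "(\<lambda>j. cut_distance (step (n (r j)) (W (r j))) f) \<longlonglongrightarrow> 0"
      using finite_graphons_precompact[of n W, OF n W] by blast
    define h where "h = (\<lambda>j. step (n (r j)) (W (r j)))"
    have h: "graphon (h j)" for j unfolding h_def using n W by (intro graphon_step) blast+
    note k = kernel_graphon[OF h] kernel_graphon[OF f] kernel_graphon[OF g]
    have lim: "(\<lambda>j. cut_distance (h j) f) \<longlonglongrightarrow> 0" using lim by (simp add: h_def)
    have rate: "(\<lambda>j. 1 / real (Suc (r j))) \<longlonglongrightarrow> 0"
      using LIMSEQ_subseq_LIMSEQ[OF lim_1_over_n[THEN LIMSEQ_Suc] r] by (simp add: comp_def)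
    have dens: "subgraph_density (P i) f = t i" if i: "i \<in> {1..k}" for i
    proof -
      have "\<bar>subgraph_density (P i) f - t i\<bar> \<le> real (card (edge_pairs (P i))) * cut_distance (h j) f + 1 / real (Suc (r j))" for j
        using density_diff_le_cut_distance[OF P[OF i] h[of j] f] Q[of "r j"] i unfolding Q_def h_def by force
      moreover have "(\<lambda>j. real (card (edge_pairs (P i))) * cut_distance (h j) f + 1 / real (Suc (r j))) \<longlonglongrightarrow> 0"
        using tendsto_add[OF tendsto_mult_left[OF lim] rate] by simp
      ultimately have "\<bar>subgraph_density (P i) f - t i\<bar> \<le> 0"
        by (intro LIMSEQ_le_const[where a = "\<bar>subgraph_density (P i) f - t i\<bar>"]) auto
      then show ?thesis by simp
    qed
    have "graphon_entropy g \<le> graphon_entropy f"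
    proof (rule field_le_epsilon)
      fix e :: real assume "0 < e"
      then have e: "0 < e / 2" by simp
      obtain \<rho> where \<rho>: "\<rho> > 0" "\<And>f'. graphon f' \<Longrightarrow> cut_distance f f' < \<rho> \<Longrightarrow> graphon_entropy f' < graphon_entropy f + e / 2"
        using graphon_entropy_upper_semicontinuous[OF f e] by metis
      have "\<forall>\<^sub>F j in sequentially. cut_distance (h j) f < \<rho>" using lim \<rho>(1) by (rule order_tendstoD(2))
      moreover have "\<forall>\<^sub>F j in sequentially. 1 / real (Suc (r j)) < e / 2" using rate e by (rule order_tendstoD(2))
      ultimately have "\<forall>\<^sub>F j in sequentially. graphon_entropy g \<le> graphon_entropy f + e"
      proof eventually_elim
        case (elim j)
        have "graphon_entropy (h j) < graphon_entropy f + e / 2"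
          using elim(1) cut_distance_commute[OF k(1,2)] by (intro \<rho>(2) h) simp
        moreover have "graphon_entropy g - 1 / real (Suc (r j)) \<le> graphon_entropy (h j)"
          using Q[of "r j"] unfolding Q_def h_def by blast
        ultimately show ?case using elim(2) by linarith
      qed
      then show "graphon_entropy g \<le> graphon_entropy f + e" by simp
    qed
    then have zero: "cut_distance f g = 0" by (intro unique f dens)
    have "\<epsilon> \<le> cut_distance (h j) f" for j
    proof -
      have "\<epsilon> \<le> cut_distance (h j) g" using Q[of "r j"] unfolding Q_def h_def by blast
      also have "\<dots> \<le> cut_distance (h j) f + cut_distance f g" by (intro cut_distance_triangle k)
      finally show ?thesis using zero by simp
    qed
    then have "\<epsilon> \<le> 0" by (intro LIMSEQ_le_const[OF lim]) auto
    then show False using \<epsilon> by simp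
  qed
  then obtain \<eta> where \<eta>: "\<eta> > 0" "\<And>n W. \<not> Q \<eta> n W" by blast
  show ?thesis
  proof (intro exI[of _ \<eta>] conjI allI impI)
    fix n W
    assume "n \<ge> 1" "\<forall>u\<in>{1..n}. \<forall>v\<in>{1..n}. W u v = W v u \<and> W u v \<in> {0..1}"
      "\<forall>i\<in>{1..k}. \<bar>subgraph_density (P i) (step n W) - t i\<bar> \<le> \<eta>" "\<epsilon> \<le> cut_distance (step n W) g"
    then show "graphon_entropy (step n W) < graphon_entropy g - \<eta>"
      using \<eta>(2)[of n W] unfolding Q_def not_le[symmetric] by blast
  qed (rule \<eta>(1))
qed

section \<open>Concentration near the maximizer\<close>

lemma subexponential_choices:
  fixes R :: nat
  assumes "R \<ge> 1" "0 < b"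
  shows "\<forall>\<^sub>F n in sequentially. real R ^ n * real (n\<^sup>2 + 1) ^ R\<^sup>2 \<le> exp (b * (real n)\<^sup>2)"
proof -
  have "(\<lambda>n. real n / (real n)\<^sup>2) \<longlonglongrightarrow> 0" "(\<lambda>n. ln (real (n\<^sup>2 + 1)) / (real n)\<^sup>2) \<longlonglongrightarrow> 0" by real_asymp+
  from tendsto_add[OF tendsto_mult_left[OF this(1), of "ln (real R)"] tendsto_mult_left[OF this(2), of "real (R\<^sup>2)"]]
  have "(\<lambda>n. ln (real R) * (real n / (real n)\<^sup>2) + real (R\<^sup>2) * (ln (real (n\<^sup>2 + 1)) / (real n)\<^sup>2)) \<longlonglongrightarrow> 0" by simp
  then have "\<forall>\<^sub>F n in sequentially. ln (real R) * (real n / (real n)\<^sup>2) + real (R\<^sup>2) * (ln (real (n\<^sup>2 + 1)) / (real n)\<^sup>2) < b"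
    using assms(2) by (rule order_tendstoD(2))
  then show ?thesis using eventually_ge_at_top[of 1]
  proof eventually_elim
    case (elim n)
    have "real n * ln (real R) + real (R\<^sup>2) * ln (real (n\<^sup>2 + 1))
        = (ln (real R) * (real n / (real n)\<^sup>2) + real (R\<^sup>2) * (ln (real (n\<^sup>2 + 1)) / (real n)\<^sup>2)) * (real n)\<^sup>2"
      using elim(2) by (simp add: field_simps)
    also have "\<dots> \<le> b * (real n)\<^sup>2" using elim(1) by (intro mult_right_mono) auto
    finally have le: "real n * ln (real R) + real (R\<^sup>2) * ln (real (n\<^sup>2 + 1)) \<le> b * (real n)\<^sup>2" .
    have "real R ^ n * real (n\<^sup>2 + 1) ^ R\<^sup>2 = exp (real n * ln (real R) + real (R\<^sup>2) * ln (real (n\<^sup>2 + 1)))"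
      using assms(1) by (simp only: exp_add exp_of_nat_mult) (simp add: add_pos_nonneg)
    also have "\<dots> \<le> exp (b * (real n)\<^sup>2)" using le by (simp only: exp_le_cancel_iff)
    finally show ?case .
  qed
qed

text \<open>A graph with almost the right densities that is far from \<open>g\<close> has a regularity partition whose averages inherit
  both properties, and hence have entropy below the gap. So there are few such graphs.\<close>

lemma few_graphs_far_away:
  assumes P: "\<And>i. i \<in> {1..k} \<Longrightarrow> simple_graph (P i)" and g: "graphon g"
    and \<epsilon>: "0 < \<epsilon>" and \<eta>: "0 < \<eta>" and b: "0 < b"
    and gap: "\<forall>n W. n \<ge> 1 \<longrightarrow> (\<forall>u\<in>{1..n}. \<forall>v\<in>{1..n}. W u v = W v u \<and> W u v \<in> {0..1}) \<longrightarrow>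
      (\<forall>i\<in>{1..k}. \<bar>subgraph_density (P i) (step n W) - t i\<bar> \<le> \<eta>) \<longrightarrow>
      \<epsilon> / 2 \<le> cut_distance (step n W) g \<longrightarrow> graphon_entropy (step n W) < s"
  shows "\<forall>\<^sub>F n in sequentially.
    real (card {G \<in> constrained_graphs k P t (\<eta> / 2) n. \<epsilon> \<le> cut_distance (checkerboard G) g})
      \<le> exp ((s + b) * (real n)\<^sup>2)"
proof -
  define M where "M = (\<Sum>i\<in>{1..k}. real (card (edge_pairs (P i))))"
  have M: "real (card (edge_pairs (P i))) \<le> M" if "i \<in> {1..k}" for i
    unfolding M_def using that by (intro member_le_sum) auto
  have M0: "0 \<le> M" by (auto simp: M_def intro: sum_nonneg)
  (* Cut distance at most \<rho> changes the densities by at most \<eta> / 2 and the distance to g by at most \<epsilon> / 2. *)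
  define \<rho> where "\<rho> = min (\<epsilon> / 2) (\<eta> / (2 * (M + 1)))"
  have \<rho>: "0 < \<rho>" "\<rho> \<le> \<epsilon> / 2"
    unfolding \<rho>_def using \<epsilon> \<eta> M0 by simp (rule min.cobounded1)
  have M\<rho>: "M * \<rho> \<le> \<eta> / 2"
  proof -
    have "M * \<rho> \<le> (M + 1) * (\<eta> / (2 * (M + 1)))" using M0 \<rho>(1) by (intro mult_mono) (auto simp: \<rho>_def)
    also have "\<dots> = \<eta> / 2" using M0 by (simp add: field_simps)
    finally show ?thesis .
  qed
  obtain L :: nat where L: "1 / \<rho>\<^sup>2 < real L" using reals_Archimedean2 by blast
  have "0 < 1 / \<rho>\<^sup>2" using \<rho>(1) by simp
  then have L1: "L \<ge> 1" using L by linarith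
  have L\<rho>: "1 / real L \<le> \<rho>\<^sup>2" using L L1 \<rho>(1) by (simp add: field_simps)
  define R :: nat where "R = 4 ^ L"
  have "R \<ge> 1" by (simp add: R_def)
  from subexponential_choices[OF this b] show ?thesis using eventually_ge_at_top[of 1]
  proof eventually_elim
    case (elim n)
    have n: "n \<ge> 1" by fact
    define B where "B = {G \<in> constrained_graphs k P t (\<eta> / 2) n. \<epsilon> \<le> cut_distance (checkerboard G) g}"
    have BL: "B \<subseteq> labeled_graphs n" by (auto simp: B_def constrained_graphs_def)
    have "\<exists>c. (\<forall>u. c u < R) \<and> (\<Sum>u\<in>{1..n}. \<Sum>v\<in>{1..n}. binary_entropy (block_average n c (adjacency G) u v)) \<le> s * (real n)\<^sup>2"
      if G: "G \<in> B" for G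
    proof -
      have sg: "simple_graph G" "fst G = n" using G BL by (auto simp: labeled_graphs_def)
      obtain c :: "nat \<Rightarrow> nat" where c: "\<And>u. c u < 4 ^ L"
        "\<And>U V. U \<subseteq> {1..n} \<Longrightarrow> V \<subseteq> {1..n} \<Longrightarrow>
          (\<Sum>u\<in>U. \<Sum>v\<in>V. adjacency G u v - block_average n c (adjacency G) u v)\<^sup>2 \<le> (real n) ^ 4 / real L"
        by (rule weak_regularity[of n "adjacency G" L, OF adjacency_01 L1]) blast
      define W where "W = block_average n c (adjacency G)"
      have W: "W u v = W v u \<and> W u v \<in> {0..1}" for u v
        unfolding W_def block_average_def
        using block_density_commute[of n "adjacency G", OF adjacency_commute] block_density_bounds[of n "adjacency G", OF adjacency_01]
        by blast
      have gW: "graphon (step n W)" using n W by (intro graphon_step) blast+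
      note kk = kernel_graphon[OF graphon_checkerboard[of G]] kernel_graphon[OF gW] kernel_graphon[OF g]
      have "cut_norm (\<lambda>z. checkerboard G z - step n W z) \<le> \<rho>"
        unfolding cut_norm_checkerboard_diff[OF sg n]
      proof (rule cut_norm_step_le[OF n])
        fix U V assume UV: "U \<subseteq> {1..n}" "V \<subseteq> {1..n}"
        have "(\<Sum>u\<in>U. \<Sum>v\<in>V. adjacency G u v - W u v)\<^sup>2 \<le> (real n) ^ 4 * (1 / real L)"
          using c(2)[OF UV] by (simp add: W_def)
        also have "\<dots> \<le> (real n) ^ 4 * \<rho>\<^sup>2" using L\<rho> by (intro mult_left_mono) auto
        also have "\<dots> = (\<rho> * (real n)\<^sup>2)\<^sup>2" by (simp add: power_mult_distrib)
        finally show "\<bar>\<Sum>u\<in>U. \<Sum>v\<in>V. adjacency G u v - W u v\<bar> \<le> \<rho> * (real n)\<^sup>2"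
          using \<rho>(1) unfolding abs_le_square_iff[symmetric] by simp
      qed
      then have close: "cut_distance (checkerboard G) (step n W) \<le> \<rho>"
        using cut_distance_le_cut_norm[OF kk(1,2)] by simp
      have "graphon_entropy (step n W) < s"
      proof (rule gap[rule_format, OF n W])
        fix i assume i: "i \<in> {1..k}"
        have "\<bar>subgraph_density (P i) (checkerboard G) - subgraph_density (P i) (step n W)\<bar>
            \<le> real (card (edge_pairs (P i))) * cut_distance (checkerboard G) (step n W)"
          by (rule density_diff_le_cut_distance[OF P[OF i] graphon_checkerboard gW])
        also have "\<dots> \<le> M * \<rho>" using M[OF i] close M0 cut_distance_nonneg[OF kk(1,2)] by (intro mult_mono) auto
        finally have "\<bar>subgraph_density (P i) (checkerboard G) - subgraph_density (P i) (step n W)\<bar> \<le> \<eta> / 2" using M\<rho> by simp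
        moreover have "\<bar>subgraph_density (P i) (checkerboard G) - t i\<bar> < \<eta> / 2"
        proof -
          have "subgraph_density (P i) (checkerboard G) \<in> {t i - \<eta> / 2<..<t i + \<eta> / 2}"
            using G i by (simp add: B_def constrained_graphs_def)
          then show ?thesis unfolding greaterThanLessThan_iff by linarith
        qed
        ultimately show "\<bar>subgraph_density (P i) (step n W) - t i\<bar> \<le> \<eta>" by linarith
      next
        have "\<epsilon> \<le> cut_distance (checkerboard G) g" using G by (simp add: B_def)
        also have "\<dots> \<le> cut_distance (checkerboard G) (step n W) + cut_distance (step n W) g"
          by (intro cut_distance_triangle kk)
        finally show "\<epsilon> / 2 \<le> cut_distance (step n W) g" using close \<rho>(2) by linarith
      qed
      then have "(\<Sum>u\<in>{1..n}. \<Sum>v\<in>{1..n}. binary_entropy (W u v)) \<le> s * (real n)\<^sup>2"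
        using n unfolding graphon_entropy_step[OF n gW] by (simp add: field_simps)
      then show ?thesis using c(1) by (auto simp: W_def R_def)
    qed
    then obtain c where c: "\<And>G u. G \<in> B \<Longrightarrow> c G u < R"
      "\<And>G. G \<in> B \<Longrightarrow> (\<Sum>u\<in>{1..n}. \<Sum>v\<in>{1..n}. binary_entropy (block_average n (c G) (adjacency G) u v)) \<le> s * (real n)\<^sup>2"
      by metis
    have "real (card B) \<le> real R ^ n * real (n\<^sup>2 + 1) ^ R\<^sup>2 * exp (s * (real n)\<^sup>2)"
      by (rule card_graphs_with_low_entropy_coloring[OF n BL c])
    also have "\<dots> \<le> exp (b * (real n)\<^sup>2) * exp (s * (real n)\<^sup>2)" using elim(1) by (intro mult_right_mono) auto
    also have "\<dots> = exp ((s + b) * (real n)\<^sup>2)" by (simp add: exp_add[symmetric] algebra_simps)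
    finally show ?case by (simp add: B_def)
  qed
qed

lemma many_constrained_graphs:
  assumes P: "\<And>i. i \<in> {1..k} \<Longrightarrow> simple_graph (P i)" and g: "graphon g"
    and t: "\<And>i. i \<in> {1..k} \<Longrightarrow> subgraph_density (P i) g = t i" and \<delta>: "0 < \<delta>" and b: "0 < b"
  shows "\<forall>\<^sub>F n in sequentially. exp ((graphon_entropy g - b) * (real n)\<^sup>2) \<le> real (card (constrained_graphs k P t \<delta> n))"
proof -
  define M where "M = (\<Sum>i\<in>{1..k}. real (card (edge_pairs (P i))))"
  have M: "real (card (edge_pairs (P i))) \<le> M" if "i \<in> {1..k}" for i
    unfolding M_def using that by (intro member_le_sum) auto
  have M0: "0 \<le> M" by (auto simp: M_def intro: sum_nonneg)
  define \<rho> where "\<rho> = \<delta> / (2 * (M + 1))"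
  have \<rho>: "0 < \<rho>" using \<delta> M0 by (simp add: \<rho>_def)
  have M\<rho>: "M * \<rho> < \<delta>"
  proof -
    have "M * \<rho> \<le> (M + 1) * \<rho>" using \<rho> by simp
    also have "\<dots> = \<delta> / 2" using M0 by (simp add: \<rho>_def field_simps)
    finally show ?thesis using \<delta> by simp
  qed
  from many_graphs_near_graphon[OF g \<rho> b] show ?thesis
  proof eventually_elim
    case (elim n)
    let ?X = "{G \<in> labeled_graphs n. cut_norm (\<lambda>z. checkerboard G z - g z) \<le> \<rho>}"
    have "?X \<subseteq> constrained_graphs k P t \<delta> n"
    proof
      fix G assume G: "G \<in> ?X"
      note kk = kernel_graphon[OF graphon_checkerboard[of G]] kernel_graphon[OF g]
      have "subgraph_density (P i) (checkerboard G) \<in> {t i - \<delta><..<t i + \<delta>}" if i: "i \<in> {1..k}" for i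
      proof -
        have "\<bar>subgraph_density (P i) (checkerboard G) - t i\<bar>
            \<le> real (card (edge_pairs (P i))) * cut_norm (\<lambda>z. checkerboard G z - g z)"
          using density_diff_le_cut_norm[OF P[OF i] graphon_checkerboard g] t[OF i] by simp
        also have "\<dots> \<le> M * \<rho>" using M[OF i] G M0 cut_norm_nonneg[OF kernel_diff[OF kk]] by (intro mult_mono) auto
        finally show ?thesis using M\<rho> by (auto simp: abs_le_iff)
      qed
      then show "G \<in> constrained_graphs k P t \<delta> n" using G by (simp add: constrained_graphs_def)
    qed
    moreover have "finite (constrained_graphs k P t \<delta> n)"
      by (rule finite_subset[OF _ finite_labeled_graphs[of n]]) (auto simp: constrained_graphs_def)
    ultimately have "card ?X \<le> card (constrained_graphs k P t \<delta> n)" by (intro card_mono)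
    then show ?case using elim by (simp add: mult.commute)
  qed
qed

theorem theorem6:
  fixes k :: nat and P :: "nat \<Rightarrow> sgraph" and t :: "nat \<Rightarrow> real"
    and g0 :: "(real \<times> real \<Rightarrow> real) set" and \<epsilon> :: real
  assumes "\<And>i. i \<in> {1..k} \<Longrightarrow> simple_graph (P i)"
    and "achievable k P t"
    and "entropy_maximizer k P t g0"
    and "\<And>g. entropy_maximizer k P t g \<Longrightarrow> g = g0"
    and "\<epsilon> > 0"
  shows "\<exists>(\<delta>::real) (N::nat) (K::real). \<delta> > 0 \<and> N > 0 \<and> K > 0 \<and>
    (\<forall>n>N. real (card {G \<in> constrained_graphs k P t \<delta> n. graph_cut_distance G g0 < \<epsilon>})
            / real (card (constrained_graphs k P t \<delta> n))
          > 1 - exp (- K * (real n)\<^sup>2))"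
proof -
  note P = assms(1)
  have "g0 \<in> reduced_graphons" using assms(3) by (simp add: entropy_maximizer_def is_arg_max_def)
  then obtain g where g: "graphon g" and g0: "g0 = cut_equiv `` {g}" by (rule reduced_graphonsE)
  note maximizer = entropy_maximizer_class[where k = k and P = P and t = t, OF P]
  have max: "\<forall>i\<in>{1..k}. subgraph_density (P i) g = t i"
    "\<And>f. graphon f \<Longrightarrow> \<forall>i\<in>{1..k}. subgraph_density (P i) f = t i \<Longrightarrow> graphon_entropy f \<le> graphon_entropy g"
    using assms(3) maximizer[OF _ g] unfolding g0 by blast+
  have t: "subgraph_density (P i) g = t i" if "i \<in> {1..k}" for i using max(1) that by blast
  have unique: "cut_distance f g = 0"
    if f: "graphon f" and dens: "\<And>i. i \<in> {1..k} \<Longrightarrow> subgraph_density (P i) f = t i"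
      and le: "graphon_entropy g \<le> graphon_entropy f" for f
  proof -
    have "entropy_maximizer k P t (cut_equiv `` {f})"
      using maximizer[OF _ f] max(2) dens le by (blast intro: order_trans)
    then have "cut_equiv `` {f} = cut_equiv `` {g}" using assms(4) g0 by simp
    then have "(f, g) \<in> cut_equiv" using eq_equiv_class[OF _ equiv_cut_equiv] g by simp
    then show ?thesis by (simp add: cut_equiv_def)
  qed
  have "0 < \<epsilon> / 2" using assms(5) by simp
  obtain \<eta> where \<eta>: "\<eta> > 0" and gap: "\<forall>n W. n \<ge> 1 \<longrightarrow>
      (\<forall>u\<in>{1..n}. \<forall>v\<in>{1..n}. W u v = W v u \<and> W u v \<in> {0..1}) \<longrightarrow>
      (\<forall>i\<in>{1..k}. \<bar>subgraph_density (P i) (step n W) - t i\<bar> \<le> \<eta>) \<longrightarrow>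
      \<epsilon> / 2 \<le> cut_distance (step n W) g \<longrightarrow> graphon_entropy (step n W) < graphon_entropy g - \<eta>"
    using entropy_gap[where k = k and P = P and t = t, OF P g unique \<open>0 < \<epsilon> / 2\<close>] by blast
  have pos: "0 < \<eta> / 4" "0 < \<eta> / 2" using \<eta> by simp_all
  let ?C = "\<lambda>n. constrained_graphs k P t (\<eta> / 2) n"
  let ?B = "\<lambda>n. {G \<in> ?C n. \<epsilon> \<le> cut_distance (checkerboard G) g}"
  (* The gap \<eta> exceeds the two losses \<eta> / 4, which leaves \<eta> / 2; the strict inequality uses half of it. *)
  have "\<forall>\<^sub>F n in sequentially. real (card (?B n)) \<le> exp ((graphon_entropy g - \<eta> + \<eta> / 4) * (real n)\<^sup>2) \<and>
      exp ((graphon_entropy g - \<eta> / 4) * (real n)\<^sup>2) \<le> real (card (?C n)) \<and> n \<ge> 1"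
    by (intro eventually_conj few_graphs_far_away[OF P g assms(5) \<eta> pos(1) gap]
        many_constrained_graphs[OF P g t pos(2,1)] eventually_ge_at_top)
  then obtain N where N: "\<And>n. n \<ge> N \<Longrightarrow> real (card (?B n)) \<le> exp ((graphon_entropy g - \<eta> + \<eta> / 4) * (real n)\<^sup>2)"
    "\<And>n. n \<ge> N \<Longrightarrow> exp ((graphon_entropy g - \<eta> / 4) * (real n)\<^sup>2) \<le> real (card (?C n))"
    "\<And>n. n \<ge> N \<Longrightarrow> n \<ge> 1"
    unfolding eventually_sequentially by blast
  have "1 - exp (- (\<eta> / 4) * (real n)\<^sup>2)
      < real (card {G \<in> ?C n. graph_cut_distance G g0 < \<epsilon>}) / real (card (?C n))" if "n \<ge> N" for n
  proof -
    note n = N[OF that]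
    let ?A = "{G \<in> ?C n. graph_cut_distance G g0 < \<epsilon>}"
    have fin: "finite (?C n)"
      by (rule finite_subset[OF _ finite_labeled_graphs[of n]]) (auto simp: constrained_graphs_def)
    have C: "0 < real (card (?C n))" using n(2) by (rule less_le_trans[OF exp_gt_zero])
    have "?C n = ?A \<union> ?B n" "?A \<inter> ?B n = {}"
      unfolding g0 graph_cut_distance_class[OF g] by auto
    then have "card (?C n) = card ?A + card (?B n)"
      using fin by (metis (no_types, lifting) card_Un_disjoint finite_Un)
    then have "real (card ?A) / real (card (?C n)) = 1 - real (card (?B n)) / real (card (?C n))"
      using C by (simp add: field_simps)
    moreover have "real (card (?B n)) / real (card (?C n)) < exp (- (\<eta> / 4) * (real n)\<^sup>2)"
    proof -
      have "real (card (?B n)) / real (card (?C n))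
          \<le> exp ((graphon_entropy g - \<eta> + \<eta> / 4) * (real n)\<^sup>2) / exp ((graphon_entropy g - \<eta> / 4) * (real n)\<^sup>2)"
        using n(1,2) C by (intro frac_le) auto
      also have "\<dots> = exp (- (\<eta> / 2) * (real n)\<^sup>2)" by (simp add: exp_diff[symmetric] algebra_simps)
      also have "\<dots> < exp (- (\<eta> / 4) * (real n)\<^sup>2)" using \<eta> n(3) by simp
      finally show ?thesis .
    qed
    ultimately show ?thesis by linarith
  qed
  then have "\<forall>n>max 1 N. 1 - exp (- (\<eta> / 4) * (real n)\<^sup>2)
      < real (card {G \<in> ?C n. graph_cut_distance G g0 < \<epsilon>}) / real (card (?C n))" by simp
  moreover have "0 < max 1 N" by simp
  ultimately show ?thesis using pos by blast
qed

end
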